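(* Let $P=\langle p_1,\ldots,p_n\rangle$ be a probability distribution over $n$ symbols and let $\mathcal{L}(P)$ be the optimal (minimum) average codeword length of a binary prefix code for $P$. Then, for any constant $c>1$, in the word RAM model with word size $w=\Omega(\log n)$, one can store a prefix code for $P$ with average codeword length at most $c\,\mathcal{L}(P)$ using $O(n^{1/c}\log n)$ bits, such that encoding and decoding any symbol takes $O(1)$ time.
   Context: A prefix code assigns to each symbol $a_i$ a binary codeword $c_i$ of length $\ell_i$ such that no codeword is a prefix of another; its average codeword length is $\sum_i p_i\ell_i$. "Storing a code" means building a data structure from which one can encode (given $i$, output $c_i$) and decode (given a bit stream beginning with some codeword $c_i$, output $a_i$ and the length of $c_i$). The constant in $O(n^{1/c}\log n)$ may depend on $c$ but not on $n$ or $P$. *)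

theory Defs
  imports Complex_Main "HOL-Library.FuncSet" "HOL-Library.Sublist"
begin

section \<open>Prefix codes\<close>

text \<open>The symbols are \<open>0, \<dots>, n - 1\<close>. Functions on symbols are only constrained below \<open>n\<close>.\<close>

definition prob_dist :: "nat \<Rightarrow> (nat \<Rightarrow> real) \<Rightarrow> bool" where
  "prob_dist n p \<longleftrightarrow> (\<forall>i<n. 0 \<le> p i) \<and> (\<Sum>i<n. p i) = 1"

definition prefix_code :: "nat \<Rightarrow> (nat \<Rightarrow> bool list) \<Rightarrow> bool" where
  "prefix_code n code \<longleftrightarrow> (\<forall>i<n. \<forall>j<n. i \<noteq> j \<longrightarrow> \<not> prefix (code i) (code j))"

definition avg_len :: "nat \<Rightarrow> (nat \<Rightarrow> real) \<Rightarrow> (nat \<Rightarrow> bool list) \<Rightarrow> real" where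
  "avg_len n p code = (\<Sum>i<n. p i * real (length (code i)))"

text \<open>The infimum is attained for every probability distribution (lemma
  \<open>opt_avg_len_attained\<close>), so this is the minimum average codeword length.\<close>

definition opt_avg_len :: "nat \<Rightarrow> (nat \<Rightarrow> real) \<Rightarrow> real" where
  "opt_avg_len n p = Inf {avg_len n p code |code. prefix_code n code}"

lemma prefix_code_unary: "prefix_code n (\<lambda>i. replicate i True @ [False])"
  unfolding prefix_code_def
proof (intro allI impI notI)
  fix i j :: nat
  assume ij: "i \<noteq> j" and pre: "prefix (replicate i True @ [False]) (replicate j True @ [False])"
  have le: "i \<le> j"
    using prefix_length_le[OF pre] by simp
  with ij have lt: "i < j" by simp
  obtain zs where zs: "replicate j True @ [False] = (replicate i True @ [False]) @ zs"
    using pre by (auto simp: prefix_def)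
  have "(replicate j True @ [False]) ! i = True"
    using lt by (simp add: nth_append)
  moreover have "((replicate i True @ [False]) @ zs) ! i = False"
    by (simp add: nth_append)
  ultimately show False using zs by simp
qed

lemma opt_avg_len_attained:
  assumes "prob_dist n p"
  shows "\<exists>code. prefix_code n code \<and> avg_len n p code = opt_avg_len n p"
    and "prefix_code n code \<Longrightarrow> opt_avg_len n p \<le> avg_len n p code"
proof -
  define S where "S = {avg_len n p code |code. prefix_code n code}"
  have p0: "0 \<le> p i" if "i < n" for i
    using assms that by (auto simp: prob_dist_def)
  have S0: "0 \<le> x" if "x \<in> S" for x
    using that by (auto simp: S_def avg_len_def intro!: sum_nonneg mult_nonneg_nonneg p0)
  hence bdd: "bdd_below S" by (auto simp: bdd_below_def)
  define B where "B = avg_len n p (\<lambda>i. replicate i True @ [False])"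
  have BS: "B \<in> S" using prefix_code_unary by (auto simp: S_def B_def)
  define F where "F = PiE {..<n} (\<lambda>i. {0..nat \<lfloor>B / p i\<rfloor>})"
  have finF: "finite F" unfolding F_def by (rule finite_PiE) auto
  have "{x \<in> S. x \<le> B} \<subseteq> (\<lambda>f. \<Sum>i<n. p i * real (f i)) ` F"
  proof
    fix x assume "x \<in> {x \<in> S. x \<le> B}"
    then obtain code where x: "x = avg_len n p code" and xB: "x \<le> B"
      by (auto simp: S_def)
    define f where "f = restrict (\<lambda>i. if p i > 0 then length (code i) else 0) {..<n}"
    have "x = (\<Sum>i<n. p i * real (f i))"
      unfolding x avg_len_def f_def using p0 by (intro sum.cong) (auto simp: less_le)
    moreover have "f \<in> F"
      unfolding F_def
    proof (rule PiE_I)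
      fix i assume i: "i \<in> {..<n}"
      show "f i \<in> {0..nat \<lfloor>B / p i\<rfloor>}"
      proof (cases "p i > 0")
        case True
        have "p i * real (length (code i)) \<le> avg_len n p code"
          unfolding avg_len_def using i p0
          by (intro member_le_sum[where f = "\<lambda>i. p i * real (length (code i))"]) auto
        hence "real (length (code i)) \<le> B / p i"
          using xB x True by (simp add: field_simps)
        hence "length (code i) \<le> nat \<lfloor>B / p i\<rfloor>" by linarith
        thus ?thesis using i by (simp add: f_def)
      qed (use i in \<open>simp add: f_def\<close>)
    qed (simp add: f_def)
    ultimately show "x \<in> (\<lambda>f. \<Sum>i<n. p i * real (f i)) ` F" by blast
  qed
  hence fin: "finite {x \<in> S. x \<le> B}" using finF finite_surj by blast
  define m where "m = Min {x \<in> S. x \<le> B}"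
  have "m \<in> {x \<in> S. x \<le> B}" unfolding m_def using fin BS by (intro Min_in) auto
  hence mS: "m \<in> S" and mB: "m \<le> B" by auto
  have mle: "m \<le> x" if "x \<in> S" for x
    using that fin mB by (cases "x \<le> B") (auto simp: m_def)
  have "Inf S = m" by (rule cInf_eq_minimum[OF mS mle])
  hence opt: "opt_avg_len n p = m" by (simp add: opt_avg_len_def S_def)
  show "\<exists>code. prefix_code n code \<and> avg_len n p code = opt_avg_len n p"
    using mS opt by (auto simp: S_def)
  show "prefix_code n code \<Longrightarrow> opt_avg_len n p \<le> avg_len n p code"
    using mle opt by (auto simp: S_def)
qed


section \<open>The word RAM\<close>

text \<open>Registers and memory cells hold words, that is, numbers below \<open>2 ^ w\<close>. A program
  names its registers statically, so it uses only a constant number of them. The word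
  size is available to it as the operand \<open>WordSize\<close>.\<close>

datatype operand = Reg nat | Const nat | WordSize

datatype binop =
  Add | Sub | Mul | MulHigh | Div | Mod | And | Or | Xor | ShiftL | ShiftR | Eq | Less

fun binop_val :: "nat \<Rightarrow> binop \<Rightarrow> nat \<Rightarrow> nat \<Rightarrow> nat" where
  "binop_val w Add x y = (x + y) mod 2 ^ w"
| "binop_val w Sub x y = (x + (2 ^ w - y)) mod 2 ^ w"
| "binop_val w Mul x y = (x * y) mod 2 ^ w"
| "binop_val w MulHigh x y = (x * y) div 2 ^ w"
| "binop_val w Div x y = x div y"
| "binop_val w Mod x y = x mod y"
| "binop_val w And x y = Bit_Operations.and x y"
| "binop_val w Or x y = Bit_Operations.or x y"
| "binop_val w Xor x y = Bit_Operations.xor x y"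
| "binop_val w ShiftL x y = (x * 2 ^ y) mod 2 ^ w"
| "binop_val w ShiftR x y = x div 2 ^ y"
| "binop_val w Eq x y = of_bool (x = y)"
| "binop_val w Less x y = of_bool (x < y)"

text \<open>The operand list of \<open>Load\<close> and \<open>Store\<close> is the memory address in base \<open>2 ^ w\<close>, least
  significant word first. Ordinary indirect addressing is the case of a singleton list.
  If the word size is only \<open>\<kappa> * log 2 n\<close> with a small \<open>\<kappa> > 0\<close>, an address or a symbol
  takes a constant number of words, more than one.\<close>

datatype prog =
    Skip
  | Assign nat binop operand operand
  | Load nat "operand list"
  | Store "operand list" operand
  | Seq prog prog
  | If operand prog prog
  | While operand prog

text \<open>Register contents and memory contents.\<close>

type_synonym state = "(nat \<Rightarrow> nat) \<times> (nat \<Rightarrow> nat)"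

fun operand_val :: "nat \<Rightarrow> (nat \<Rightarrow> nat) \<Rightarrow> operand \<Rightarrow> nat" where
  "operand_val w \<rho> (Reg r) = \<rho> r"
| "operand_val w \<rho> (Const k) = k mod 2 ^ w"
| "operand_val w \<rho> WordSize = w"

definition multiword :: "nat \<Rightarrow> nat list \<Rightarrow> nat" where
  "multiword w vs = horner_sum id (2 ^ w) vs"

definition address :: "nat \<Rightarrow> (nat \<Rightarrow> nat) \<Rightarrow> operand list \<Rightarrow> nat" where
  "address w \<rho> as = multiword w (map (operand_val w \<rho>) as)"

text \<open>\<open>exec w c s t s'\<close>: on word size \<open>w\<close>, program \<open>c\<close> started in state \<open>s\<close> halts after \<open>t\<close>
  time units in state \<open>s'\<close>.\<close>

inductive exec :: "nat \<Rightarrow> prog \<Rightarrow> state \<Rightarrow> nat \<Rightarrow> state \<Rightarrow> bool" for w where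
  Skip: "exec w Skip s 0 s"
| Assign: "exec w (Assign r f x y) (\<rho>, \<mu>) 1
    (\<rho>(r := binop_val w f (operand_val w \<rho> x) (operand_val w \<rho> y)), \<mu>)"
| Load: "exec w (Load r as) (\<rho>, \<mu>) (1 + length as) (\<rho>(r := \<mu> (address w \<rho> as)), \<mu>)"
| Store: "exec w (Store as x) (\<rho>, \<mu>) (1 + length as)
    (\<rho>, \<mu>(address w \<rho> as := operand_val w \<rho> x))"
| Seq: "exec w c1 s t1 s' \<Longrightarrow> exec w c2 s' t2 s'' \<Longrightarrow> exec w (Seq c1 c2) s (t1 + t2) s''"
| IfTrue: "operand_val w (fst s) x \<noteq> 0 \<Longrightarrow> exec w c1 s t s' \<Longrightarrow>
    exec w (If x c1 c2) s (1 + t) s'"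
| IfFalse: "operand_val w (fst s) x = 0 \<Longrightarrow> exec w c2 s t s' \<Longrightarrow>
    exec w (If x c1 c2) s (1 + t) s'"
| WhileFalse: "operand_val w (fst s) x = 0 \<Longrightarrow> exec w (While x c) s 1 s"
| WhileTrue: "operand_val w (fst s) x \<noteq> 0 \<Longrightarrow> exec w c s t1 s' \<Longrightarrow>
    exec w (While x c) s' t2 s'' \<Longrightarrow> exec w (While x c) s (1 + t1 + t2) s''"

inductive_cases exec_SkipE: "exec w Skip s t s'"
  and exec_AssignE: "exec w (Assign r f x y) s t s'"
  and exec_LoadE: "exec w (Load r as) s t s'"
  and exec_StoreE: "exec w (Store as x) s t s'"
  and exec_SeqE: "exec w (Seq c1 c2) s t s'"
  and exec_IfE: "exec w (If x c1 c2) s t s'"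
  and exec_WhileE: "exec w (While x c) s t s'"

lemma exec_deterministic:
  "exec w c s t s' \<Longrightarrow> exec w c s u s'' \<Longrightarrow> t = u \<and> s' = s''"
proof (induction arbitrary: u s'' rule: exec.induct)
  case (Skip s)
  then show ?case by (auto elim: exec_SkipE)
next
  case (Assign r f x y \<rho> \<mu>)
  then show ?case by (auto elim: exec_AssignE)
next
  case (Load r as \<rho> \<mu>)
  then show ?case by (auto elim: exec_LoadE)
next
  case (Store as x \<rho> \<mu>)
  then show ?case by (auto elim: exec_StoreE)
next
  case (Seq c1 s t1 s' c2 t2 s3)
  from Seq.prems show ?case
  proof (rule exec_SeqE)
    fix u1 m u2
    assume u: "u = u1 + u2" "exec w c1 s u1 m" "exec w c2 m u2 s''"
    have "t1 = u1 \<and> s' = m" using Seq.IH(1) u(2) .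
    then show ?thesis using Seq.IH(2)[of u2 s''] u by simp
  qed
next
  case (IfTrue s x c1 t s' c2)
  from IfTrue.prems show ?case
  proof (rule exec_IfE)
    fix v assume "u = Suc v" "exec w c1 s v s''"
    then show ?thesis using IfTrue.IH[of v s''] by simp
  qed (use IfTrue.hyps(1) in simp)
next
  case (IfFalse s x c2 t s' c1)
  from IfFalse.prems show ?case
  proof (rule exec_IfE)
    fix v assume "u = Suc v" "exec w c2 s v s''"
    then show ?thesis using IfFalse.IH[of v s''] by simp
  qed (use IfFalse.hyps(1) in simp)
next
  case (WhileFalse s x c)
  from WhileFalse.prems show ?case
    by (rule exec_WhileE) (use WhileFalse.hyps in simp)+
next
  case (WhileTrue s x c t1 s' t2 s3)
  from WhileTrue.prems show ?case
  proof (rule exec_WhileE)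
    fix u1 m u2
    assume u: "u = Suc (u1 + u2)" "exec w c s u1 m" "exec w (While x c) m u2 s''"
    have "t1 = u1 \<and> s' = m" using WhileTrue.IH(1) u(2) .
    then show ?thesis using WhileTrue.IH(2)[of u2 s''] u by simp
  qed (use WhileTrue.hyps(1) in simp)
qed

section \<open>Storing a code\<close>

text \<open>Bit strings are packed into words, least significant bit first. Memory beyond the
  stored bits is zero.\<close>

definition bits_val :: "bool list \<Rightarrow> nat" where
  "bits_val bs = horner_sum of_bool 2 bs"

definition packed :: "nat \<Rightarrow> bool list \<Rightarrow> nat \<Rightarrow> nat" where
  "packed w bs a = bits_val (take w (drop (a * w) bs))"

text \<open>A query receives its argument \<open>x\<close> as \<open>d\<close> words in the registers \<open>0, \<dots>, d - 1\<close> (the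
  lowest \<open>d * w\<close> bits of \<open>x\<close>) and leaves a pair of results, each of \<open>d\<close> words, in the
  registers \<open>0, \<dots>, d - 1\<close> and \<open>d, \<dots>, 2 * d - 1\<close>. It must leave memory as it
  found it, so that it has no working space besides its registers.\<close>

definition input_regs :: "nat \<Rightarrow> nat \<Rightarrow> nat \<Rightarrow> nat \<Rightarrow> nat" where
  "input_regs w d x r = (if r < d then x div 2 ^ (w * r) mod 2 ^ w else 0)"

definition answers ::
    "nat \<Rightarrow> nat \<Rightarrow> nat \<Rightarrow> bool list \<Rightarrow> prog \<Rightarrow> nat \<Rightarrow> nat \<Rightarrow> nat \<Rightarrow> bool" where
  "answers w d T bits c x y z \<longleftrightarrow>
    (\<exists>t \<rho>. t \<le> T \<and> exec w c (input_regs w d x, packed w bits) t (\<rho>, packed w bits) \<and>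
       multiword w (map \<rho> [0..<d]) = y \<and> multiword w (map \<rho> [d..<2 * d]) = z)"

text \<open>A codeword is output as its bits together with its length.\<close>

definition encodes ::
    "nat \<Rightarrow> nat \<Rightarrow> nat \<Rightarrow> bool list \<Rightarrow> prog \<Rightarrow> nat \<Rightarrow> (nat \<Rightarrow> bool list) \<Rightarrow> bool" where
  "encodes w d T bits c n code \<longleftrightarrow>
    (\<forall>i<n. answers w d T bits c i (bits_val (code i)) (length (code i)))"

text \<open>Decoding sees the first \<open>d\<close> words of the bit stream \<open>\<sigma>\<close>.\<close>

definition decodes ::
    "nat \<Rightarrow> nat \<Rightarrow> nat \<Rightarrow> bool list \<Rightarrow> prog \<Rightarrow> nat \<Rightarrow> (nat \<Rightarrow> bool list) \<Rightarrow> bool" where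
  "decodes w d T bits c n code \<longleftrightarrow>
    (\<forall>i<n. \<forall>\<sigma> :: nat \<Rightarrow> bool. (\<forall>j < length (code i). \<sigma> j = code i ! j) \<longrightarrow>
       answers w d T bits c (bits_val (map \<sigma> [0..<d * w])) i (length (code i)))"

end

theory Submission
  imports Defs
begin

unbundle bit_operations_syntax

text \<open>
  Cut an optimal code at depth \<open>m \<approx> log 2 n / c\<close>. The at most \<open>2 ^ (m + 1)\<close> symbols with short codewords keep
  them, up to one additional bit in a single subtree at constant depth; all other symbols share that
  subtree with codewords of fixed length about \<open>log 2 n\<close>, which is at most \<open>c\<close> times their optimal length.

  Encoding and decoding are lookups in a dictionary of the short codewords, with an affine map over
  the field with two elements as default. The dictionary is hash-and-displace: slot
  \<open>D (g x) XOR f x\<close> with XOR-linear \<open>g\<close> and \<open>f\<close>, found greedily one output bit at a time.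
  XOR-linear maps are evaluated by table lookups on chunks of \<open>log 2 n / (2 * c)\<close> bits or less, so the queries
  need no arithmetic on numbers of several words.

  Large words are divided into cells of \<open>O(log n)\<close> bits; smaller words are combined, as many as
  a number needs; for words of bounded size the program tabulates all possible answers.
\<close>

section \<open>Expressions\<close>

text \<open>The programs are fixed by \<open>c\<close> and \<open>\<kappa>\<close> before
  \<open>n\<close>, the distribution and the word size are known. Whatever grows with
  \<open>n\<close> must therefore be read from memory, and program constants may depend only on
  quantities bounded in terms of \<open>c\<close> and \<open>\<kappa>\<close>. The space constant is
  even chosen before \<open>\<kappa>\<close>. The depth \<open>m\<close> balances two demands:
  \<open>c * (m + 1)\<close> must reach the length of the new long codewords, while
  \<open>2 ^ m\<close> must stay of order \<open>n powr (1 / c)\<close>. As a record already costs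
  order \<open>log 2 n\<close> bits, the number of slots has to be linear in the number of short
  codewords. This excludes a single linear hash function found by counting colliding pairs, which is
  injective only with quadratically many slots, and forces the displacement stage. A chunk table has
  order \<open>n powr (1 / (2 * c))\<close> rows; the spare factor of the same order absorbs the
  number of chunks, for which the only bound free of \<open>\<kappa>\<close> is logarithmic.
  Construction time is not counted, so all tables merely have to exist.\<close>

datatype ex = Opd operand | Bin binop ex ex | Ld "ex list" | Ite ex ex ex

text \<open>Expressions have neither loops nor stores. Hence the compiled program runs in a time
  bounded in terms of the expression alone and leaves memory as it was.\<close>

fun eval :: "nat \<Rightarrow> (nat \<Rightarrow> nat) \<Rightarrow> (nat \<Rightarrow> nat) \<Rightarrow> ex \<Rightarrow> nat" where
  "eval w \<rho> \<mu> (Opd x) = operand_val w \<rho> x"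
| "eval w \<rho> \<mu> (Bin f a b) = binop_val w f (eval w \<rho> \<mu> a) (eval w \<rho> \<mu> b)"
| "eval w \<rho> \<mu> (Ld as) = \<mu> (multiword w (map (eval w \<rho> \<mu>) as))"
| "eval w \<rho> \<mu> (Ite a b c) = (if eval w \<rho> \<mu> a \<noteq> 0 then eval w \<rho> \<mu> b else eval w \<rho> \<mu> c)"

fun operand_below :: "nat \<Rightarrow> operand \<Rightarrow> bool" where
  "operand_below k (Reg r) \<longleftrightarrow> r < k"
| "operand_below k _ \<longleftrightarrow> True"

fun regs_below :: "nat \<Rightarrow> ex \<Rightarrow> bool" where
  "regs_below k (Opd x) \<longleftrightarrow> operand_below k x"
| "regs_below k (Bin f a b) \<longleftrightarrow> regs_below k a \<and> regs_below k b"
| "regs_below k (Ld as) \<longleftrightarrow> list_all (regs_below k) as"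
| "regs_below k (Ite a b c) \<longleftrightarrow> regs_below k a \<and> regs_below k b \<and> regs_below k c"

text \<open>Stack discipline: the value goes to register \<open>r\<close>, the registers above
  \<open>r\<close> are scratch and those below \<open>r\<close> survive. Correctness will require
  that all operands lie below \<open>r\<close>, so that no input is overwritten. \<open>Or\<close>
  with the constant 0 serves as a copy instruction.\<close>

fun compile :: "ex \<Rightarrow> nat \<Rightarrow> prog" and compiles :: "ex list \<Rightarrow> nat \<Rightarrow> prog" where
  "compile (Opd x) r = Assign r Or x (Const 0)"
| "compile (Bin f a b) r =
    Seq (compile a r) (Seq (compile b (Suc r)) (Assign r f (Reg r) (Reg (Suc r))))"
| "compile (Ld as) r = Seq (compiles as r) (Load r (map Reg [r..<r + length as]))"
| "compile (Ite a b c) r = Seq (compile a r) (If (Reg r) (compile b r) (compile c r))"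
| "compiles [] r = Skip"
| "compiles (a # as) r = Seq (compile a r) (compiles as (Suc r))"

lemma eval_cong:
  assumes "regs_below k x" "\<And>r. r < k \<Longrightarrow> \<rho> r = \<rho>' r"
  shows "eval w \<rho> \<mu> x = eval w \<rho>' \<mu> x"
  using assms
proof (induction x)
  case (Opd x)
  then show ?case by (cases x) auto
next
  case (Ld xs)
  then have "map (eval w \<rho> \<mu>) xs = map (eval w \<rho>' \<mu>) xs"
    by (auto simp: list_all_iff)
  then show ?case by (simp only: eval.simps)
next
  case (Ite a b c)
  then show ?case by simp
qed auto

text \<open>\<open>T\<close> is fixed before the word size, the registers and the memory; this
  uniformity is the constant query time.\<close>

definition computes :: "prog \<Rightarrow> nat \<Rightarrow> nat \<Rightarrow> ex list \<Rightarrow> nat \<Rightarrow> bool" where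
  "computes c k r xs T \<longleftrightarrow> (\<forall>w \<rho> \<mu>. \<exists>t \<rho>'. t \<le> T \<and> exec w c (\<rho>, \<mu>) t (\<rho>', \<mu>) \<and>
     (\<forall>j<length xs. \<rho>' (r + j) = eval w \<rho> \<mu> (xs ! j)) \<and> (\<forall>j<r. \<rho>' j = \<rho> j))"

lemma compile_correct:
  "regs_below k x \<Longrightarrow> k \<le> r \<Longrightarrow> \<exists>T. computes (compile x r) k r [x] T"
  "list_all (regs_below k) xs \<Longrightarrow> k \<le> r \<Longrightarrow> \<exists>T. computes (compiles xs r) k r xs T"
proof (induction x r and xs r rule: compile_compiles.induct)
  case (1 x r)
  have "exec w (compile (Opd x) r) (\<rho>, \<mu>) 1 (\<rho>(r := operand_val w \<rho> x), \<mu>)" for w \<rho> \<mu>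
    using exec.Assign[of w r Or x "Const 0" \<rho> \<mu>] by simp
  then show ?case unfolding computes_def
    by (intro exI[of _ 1] allI) (force simp: less_Suc_eq)
next
  case (2 f a b r)
  then obtain Ta Tb where Ta: "computes (compile a r) k r [a] Ta"
    and Tb: "computes (compile b (Suc r)) k (Suc r) [b] Tb"
    by fastforce
  show ?case unfolding computes_def
  proof (rule exI[of _ "Ta + (Tb + 1)"], intro allI)
    fix w \<rho> \<mu>
    obtain t1 \<rho>1 where 1: "t1 \<le> Ta" "exec w (compile a r) (\<rho>, \<mu>) t1 (\<rho>1, \<mu>)"
      "\<rho>1 r = eval w \<rho> \<mu> a" "\<forall>j<r. \<rho>1 j = \<rho> j"
      using Ta unfolding computes_def by fastforce
    obtain t2 \<rho>2 where 2: "t2 \<le> Tb" "exec w (compile b (Suc r)) (\<rho>1, \<mu>) t2 (\<rho>2, \<mu>)"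
      "\<rho>2 (Suc r) = eval w \<rho>1 \<mu> b" "\<forall>j<Suc r. \<rho>2 j = \<rho>1 j"
      using Tb unfolding computes_def by fastforce
    have b: "eval w \<rho>1 \<mu> b = eval w \<rho> \<mu> b"
      using "2.prems" 1(4) by (intro eval_cong[of k]) auto
    have 3: "exec w (Assign r f (Reg r) (Reg (Suc r))) (\<rho>2, \<mu>) 1
        (\<rho>2(r := binop_val w f (\<rho>2 r) (\<rho>2 (Suc r))), \<mu>)"
      using exec.Assign[of w r f "Reg r" "Reg (Suc r)" \<rho>2 \<mu>] by simp
    show "\<exists>t \<rho>'. t \<le> Ta + (Tb + 1) \<and> exec w (compile (Bin f a b) r) (\<rho>, \<mu>) t (\<rho>', \<mu>) \<and>
        (\<forall>j<length [Bin f a b]. \<rho>' (r + j) = eval w \<rho> \<mu> ([Bin f a b] ! j)) \<and> (\<forall>j<r. \<rho>' j = \<rho> j)"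
      using 1 2 b exec.Seq[OF 1(2) exec.Seq[OF 2(2) 3]]
      by (intro exI[of _ "t1 + (t2 + 1)"] exI[of _ "\<rho>2(r := binop_val w f (\<rho>2 r) (\<rho>2 (Suc r)))"]) auto
  qed
next
  case (3 as r)
  then obtain T where T: "computes (compiles as r) k r as T"
    by auto
  show ?case unfolding computes_def
  proof (rule exI[of _ "T + (1 + length as)"], intro allI)
    fix w \<rho> \<mu>
    obtain t1 \<rho>1 where 1: "t1 \<le> T" "exec w (compiles as r) (\<rho>, \<mu>) t1 (\<rho>1, \<mu>)"
      "\<forall>j<length as. \<rho>1 (r + j) = eval w \<rho> \<mu> (as ! j)" "\<forall>j<r. \<rho>1 j = \<rho> j"
      using T unfolding computes_def by blast
    have ad: "address w \<rho>1 (map Reg [r..<r + length as]) = multiword w (map (eval w \<rho> \<mu>) as)"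
      unfolding address_def using 1(3) by (intro arg_cong[of _ _ "multiword w"] nth_equalityI) auto
    have 3: "exec w (Load r (map Reg [r..<r + length as])) (\<rho>1, \<mu>) (1 + length as)
        (\<rho>1(r := eval w \<rho> \<mu> (Ld as)), \<mu>)"
      using exec.Load[of w r "map Reg [r..<r + length as]" \<rho>1 \<mu>] ad by simp
    show "\<exists>t \<rho>'. t \<le> T + (1 + length as) \<and> exec w (compile (Ld as) r) (\<rho>, \<mu>) t (\<rho>', \<mu>) \<and>
        (\<forall>j<length [Ld as]. \<rho>' (r + j) = eval w \<rho> \<mu> ([Ld as] ! j)) \<and> (\<forall>j<r. \<rho>' j = \<rho> j)"
      using 1 exec.Seq[OF 1(2) 3]
      by (intro exI[of _ "t1 + (1 + length as)"] exI[of _ "\<rho>1(r := eval w \<rho> \<mu> (Ld as))"]) auto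
  qed
next
  case (4 a b c r)
  then obtain Ta Tb Tc where Ta: "computes (compile a r) k r [a] Ta"
    and Tb: "computes (compile b r) k r [b] Tb" and Tc: "computes (compile c r) k r [c] Tc"
    by fastforce
  show ?case unfolding computes_def
  proof (rule exI[of _ "Ta + (1 + (Tb + Tc))"], intro allI)
    fix w \<rho> \<mu>
    obtain t1 \<rho>1 where 1: "t1 \<le> Ta" "exec w (compile a r) (\<rho>, \<mu>) t1 (\<rho>1, \<mu>)"
      "\<rho>1 r = eval w \<rho> \<mu> a" "\<forall>j<r. \<rho>1 j = \<rho> j"
      using Ta unfolding computes_def by fastforce
    obtain t2 \<rho>2 where 2: "t2 \<le> Tb" "exec w (compile b r) (\<rho>1, \<mu>) t2 (\<rho>2, \<mu>)"
      "\<rho>2 r = eval w \<rho>1 \<mu> b" "\<forall>j<r. \<rho>2 j = \<rho>1 j"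
      using Tb unfolding computes_def by fastforce
    obtain t3 \<rho>3 where 3: "t3 \<le> Tc" "exec w (compile c r) (\<rho>1, \<mu>) t3 (\<rho>3, \<mu>)"
      "\<rho>3 r = eval w \<rho>1 \<mu> c" "\<forall>j<r. \<rho>3 j = \<rho>1 j"
      using Tc unfolding computes_def by fastforce
    have b: "eval w \<rho>1 \<mu> b = eval w \<rho> \<mu> b" "eval w \<rho>1 \<mu> c = eval w \<rho> \<mu> c"
      using "4.prems" 1(4) by (auto intro!: eval_cong[of k])
    show "\<exists>t \<rho>'. t \<le> Ta + (1 + (Tb + Tc)) \<and> exec w (compile (Ite a b c) r) (\<rho>, \<mu>) t (\<rho>', \<mu>) \<and>
        (\<forall>j<length [Ite a b c]. \<rho>' (r + j) = eval w \<rho> \<mu> ([Ite a b c] ! j)) \<and> (\<forall>j<r. \<rho>' j = \<rho> j)"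
    proof (cases "eval w \<rho> \<mu> a = 0")
      case True
      then have "exec w (If (Reg r) (compile b r) (compile c r)) (\<rho>1, \<mu>) (1 + t3) (\<rho>3, \<mu>)"
        using 1(3) 3(2) by (intro exec.IfFalse) auto
      from exec.Seq[OF 1(2) this] show ?thesis using True 1 3 b
        by (intro exI[of _ "t1 + (1 + t3)"] exI[of _ \<rho>3]) auto
    next
      case False
      then have "exec w (If (Reg r) (compile b r) (compile c r)) (\<rho>1, \<mu>) (1 + t2) (\<rho>2, \<mu>)"
        using 1(3) 2(2) by (intro exec.IfTrue) auto
      from exec.Seq[OF 1(2) this] show ?thesis using False 1 2 b
        by (intro exI[of _ "t1 + (1 + t2)"] exI[of _ \<rho>2]) auto
    qed
  qed
next
  case (5 r)
  show ?case unfolding computes_def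
    by (intro exI[of _ 0] allI) (auto intro: exec.Skip)
next
  case (6 a as r)
  then obtain Ta Tb where Ta: "computes (compile a r) k r [a] Ta"
    and Tb: "computes (compiles as (Suc r)) k (Suc r) as Tb"
    by fastforce
  show ?case unfolding computes_def
  proof (rule exI[of _ "Ta + Tb"], intro allI)
    fix w \<rho> \<mu>
    obtain t1 \<rho>1 where 1: "t1 \<le> Ta" "exec w (compile a r) (\<rho>, \<mu>) t1 (\<rho>1, \<mu>)"
      "\<rho>1 r = eval w \<rho> \<mu> a" "\<forall>j<r. \<rho>1 j = \<rho> j"
      using Ta unfolding computes_def by fastforce
    obtain t2 \<rho>2 where 2: "t2 \<le> Tb" "exec w (compiles as (Suc r)) (\<rho>1, \<mu>) t2 (\<rho>2, \<mu>)"
      "\<forall>j<length as. \<rho>2 (Suc r + j) = eval w \<rho>1 \<mu> (as ! j)" "\<forall>j<Suc r. \<rho>2 j = \<rho>1 j"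
      using Tb unfolding computes_def by blast
    have b: "eval w \<rho>1 \<mu> (as ! j) = eval w \<rho> \<mu> (as ! j)" if "j < length as" for j
      using "6.prems" 1(4) that by (intro eval_cong[of k]) (auto simp: list_all_length)
    have "\<rho>2 (r + j) = eval w \<rho> \<mu> ((a # as) ! j)" if "j < length (a # as)" for j
      using that 1(3) 2 b by (cases j) auto
    then show "\<exists>t \<rho>'. t \<le> Ta + Tb \<and> exec w (compiles (a # as) r) (\<rho>, \<mu>) t (\<rho>', \<mu>) \<and>
        (\<forall>j<length (a # as). \<rho>' (r + j) = eval w \<rho> \<mu> ((a # as) ! j)) \<and> (\<forall>j<r. \<rho>' j = \<rho> j)"
      using 1 2 exec.Seq[OF 1(2) 2(2)]
      by (intro exI[of _ "t1 + t2"] exI[of _ \<rho>2]) auto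
  qed
qed

fun moves :: "nat \<Rightarrow> nat \<Rightarrow> prog" where
  "moves b 0 = Skip"
| "moves b (Suc j) = Seq (moves b j) (Assign j Or (Reg (b + j)) (Const 0))"

lemma exec_moves:
  "j \<le> b \<Longrightarrow> exec w (moves b j) (\<rho>, \<mu>) j (\<lambda>r. if r < j then \<rho> (b + r) else \<rho> r, \<mu>)"
proof (induction j)
  case 0
  then show ?case by (simp add: exec.Skip)
next
  case (Suc j)
  let ?\<rho> = "\<lambda>r. if r < j then \<rho> (b + r) else \<rho> r"
  have "exec w (Assign j Or (Reg (b + j)) (Const 0)) (?\<rho>, \<mu>) 1 (?\<rho>(j := \<rho> (b + j)), \<mu>)"
    using exec.Assign[of w j Or "Reg (b + j)" "Const 0" ?\<rho> \<mu>] by simp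
  moreover have "?\<rho>(j := \<rho> (b + j)) = (\<lambda>r. if r < Suc j then \<rho> (b + r) else \<rho> r)"
    by (auto simp: fun_eq_iff less_Suc_eq)
  ultimately show ?case
    using exec.Seq[OF Suc.IH, of "Assign j Or (Reg (b + j)) (Const 0)" 1] Suc.prems by simp
qed

text \<open>All results are built from register \<open>2 * d\<close> upwards, because every
  expression still reads the input in the registers below \<open>d\<close>. Only then are they moved
  down, between disjoint ranges.\<close>

lemma program_of_expressions:
  assumes "list_all (regs_below d) xs" "length xs = 2 * d"
  obtains c T where "\<And>w bits x. answers w d T bits c x
    (multiword w (map (eval w (input_regs w d x) (packed w bits)) (take d xs)))
    (multiword w (map (eval w (input_regs w d x) (packed w bits)) (drop d xs)))"
proof -
  obtain T where T: "computes (compiles xs (2 * d)) d (2 * d) xs T"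
    using compile_correct(2)[OF assms(1), of "2 * d"] by auto
  show thesis
  proof (rule that[of "T + 2 * d" "Seq (compiles xs (2 * d)) (moves (2 * d) (2 * d))"])
    fix w bits x
    let ?\<rho>0 = "input_regs w d x" and ?\<mu> = "packed w bits"
    obtain t \<rho> where 1: "t \<le> T" "exec w (compiles xs (2 * d)) (?\<rho>0, ?\<mu>) t (\<rho>, ?\<mu>)"
      "\<forall>j<length xs. \<rho> (2 * d + j) = eval w ?\<rho>0 ?\<mu> (xs ! j)"
      using T unfolding computes_def by blast
    note ex = exec.Seq[OF 1(2) exec_moves[OF order_refl]]
    have "\<rho> (2 * d + (d + j)) = eval w ?\<rho>0 ?\<mu> (xs ! (d + j))" if "j < d" for j
      using 1(3)[rule_format, of "d + j"] assms(2) that by simp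
    then show "answers w d (T + 2 * d) bits (Seq (compiles xs (2 * d)) (moves (2 * d) (2 * d))) x
      (multiword w (map (eval w ?\<rho>0 ?\<mu>) (take d xs)))
      (multiword w (map (eval w ?\<rho>0 ?\<mu>) (drop d xs)))"
      unfolding answers_def using 1 ex assms(2)
      by (intro exI[of _ "t + 2 * d"] exI[of _ "\<lambda>r. if r < 2 * d then \<rho> (2 * d + r) else \<rho> r"] conjI
          arg_cong[of _ _ "multiword w"] nth_equalityI) (auto simp: add.assoc)
  qed
qed

section \<open>Perfect hashing with XOR-linear functions\<close>

text \<open>A linear map over the field with two elements on vectors of \<open>B\<close> bits,
  extended to all numbers by ignoring the higher bits.\<close>

definition xor_linear :: "nat \<Rightarrow> (nat \<Rightarrow> nat) \<Rightarrow> bool" where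
  "xor_linear B F \<longleftrightarrow> (\<forall>x y. F (x XOR y) = F x XOR F y) \<and> (\<forall>x. F (x mod 2 ^ B) = F x)"

lemma xor_linearD:
  assumes "xor_linear B F"
  shows "F (x XOR y) = F x XOR F y" "F (x mod 2 ^ B) = F x" "F 0 = 0"
  using assms by (auto simp: xor_linear_def) (metis xor_self_eq)

lemma xor_less_two_power:
  fixes x y :: nat
  assumes "x < 2 ^ n" "y < 2 ^ n"
  shows "x XOR y < 2 ^ n"
  using assms by (metis take_bit_nat_eq_self_iff take_bit_xor)

lemma xor_linear_mono:
  assumes "xor_linear B F" "B \<le> B'"
  shows "xor_linear B' F"
proof -
  have "F (x mod 2 ^ B') = F x" for x
    using xor_linearD(2)[OF assms(1), of x] xor_linearD(2)[OF assms(1), of "x mod 2 ^ B'"] assms(2)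
    by (simp add: mod_mod_cancel le_imp_power_dvd)
  then show ?thesis using assms(1) by (simp add: xor_linear_def)
qed

lemma xor_linear_zero: "xor_linear B (\<lambda>x. 0)"
  by (simp add: xor_linear_def)

lemma xor_linear_mod: "xor_linear B (\<lambda>x. x mod 2 ^ B)"
  by (simp add: xor_linear_def flip: take_bit_eq_mod)

lemma xor_linear_xor:
  "xor_linear B F \<Longrightarrow> xor_linear B G \<Longrightarrow> xor_linear B (\<lambda>x. F x XOR G x)"
  by (auto simp: xor_linear_def ac_simps)

lemma xor_linear_mult:
  "xor_linear B F \<Longrightarrow> xor_linear B (\<lambda>x. F x * 2 ^ k)"
  by (auto simp: xor_linear_def simp flip: push_bit_eq_mult)

lemma xor_linear_div:
  "xor_linear B F \<Longrightarrow> xor_linear B (\<lambda>x. F x div 2 ^ k)"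
  by (auto simp: xor_linear_def simp flip: drop_bit_eq_div)

lemma xor_linear_mod_comp:
  "xor_linear B F \<Longrightarrow> xor_linear B (\<lambda>x. F x mod 2 ^ k)"
  by (auto simp: xor_linear_def simp flip: take_bit_eq_mod)

lemma xor_linear_comp:
  "xor_linear B F \<Longrightarrow> xor_linear B' G \<Longrightarrow> xor_linear B (\<lambda>x. G (F x))"
  by (auto simp: xor_linear_def)

lemma xor_linear_bit:
  assumes "k < B"
  shows "xor_linear B (\<lambda>x. of_bool (bit x k))"
  using assms by (auto simp: xor_linear_def bit_xor_iff bit_take_bit_iff simp flip: take_bit_eq_mod)

text \<open>A random linear functional separates two distinct vectors with probability 1/2; the
  induction derandomizes this by fixing one coefficient at a time. Pairs that agree in bit
  \<open>B\<close> do not notice whether this bit is added to \<open>g\<close>, and every other pair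
  collides under exactly one of \<open>g\<close> and \<open>h\<close>, so one of the two is good for
  at least half of them.\<close>

lemma ex_xor_linear_bit_hash:
  fixes Q :: "(nat \<times> nat) set"
  assumes "finite Q" "\<And>x y. (x, y) \<in> Q \<Longrightarrow> x mod 2 ^ B \<noteq> y mod 2 ^ B"
  shows "\<exists>g. xor_linear B g \<and> (\<forall>x. g x < 2) \<and> 2 * card {(x, y) \<in> Q. g x = g y} \<le> card Q"
  using assms
proof (induction B arbitrary: Q)
  case 0
  then have "Q = {}" by auto
  then show ?case by (intro exI[of _ "\<lambda>x. 0"]) (simp add: xor_linear_def)
next
  case (Suc B)
  define Qs where "Qs = {(x, y) \<in> Q. bit x B = bit y B}"
  define Qd where "Qd = {(x, y) \<in> Q. bit x B \<noteq> bit y B}"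
  have fin: "finite Qs" "finite Qd"
    using Suc.prems(1) unfolding Qs_def Qd_def by (auto intro: rev_finite_subset)
  have Q: "card Q = card Qs + card Qd"
    using fin by (subst card_Un_disjoint[symmetric]) (auto simp: Qs_def Qd_def intro!: arg_cong[where f = card])
  have "x mod 2 ^ B \<noteq> y mod 2 ^ B" if "(x, y) \<in> Qs" for x y
  proof
    assume eq: "x mod 2 ^ B = y mod 2 ^ B"
    have "take_bit (Suc B) x = take_bit (Suc B) y"
    proof (rule bit_eqI)
      fix n
      show "bit (take_bit (Suc B) x) n = bit (take_bit (Suc B) y) n"
        using that eq[folded take_bit_eq_mod]
        by (auto simp: bit_take_bit_iff Qs_def less_Suc_eq) (metis bit_take_bit_iff)+
    qed
    then show False
      using Suc.prems(2)[of x y] that by (auto simp: Qs_def take_bit_eq_mod)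
  qed
  then obtain g where g: "xor_linear B g" "\<And>x. g x < 2" "2 * card {(x, y) \<in> Qs. g x = g y} \<le> card Qs"
    using Suc.IH[OF fin(1)] by blast
  define h where "h x = g x XOR of_bool (bit x B)" for x :: nat
  have gl: "xor_linear (Suc B) g" using xor_linear_mono[OF g(1), of "Suc B"] by simp
  have hl: "xor_linear (Suc B) h"
    unfolding h_def[abs_def] by (intro xor_linear_xor gl xor_linear_bit) simp
  have h2: "h x < 2" for x
    using xor_less_two_power[of "g x" 1 "of_bool (bit x B)"] g(2)[of x] by (auto simp: h_def)
  have flip: "h x = h y \<longleftrightarrow> g x \<noteq> g y" if "(x, y) \<in> Qd" for x y
    using that g(2)[of x] g(2)[of y] by (auto simp: Qd_def h_def less_2_cases_iff)
  have same: "h x = h y \<longleftrightarrow> g x = g y" if "(x, y) \<in> Qs" for x y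
    using that g(2)[of x] g(2)[of y] by (auto simp: Qs_def h_def less_2_cases_iff)
  have split: "card {(x, y) \<in> Q. f x = f y} = card {(x, y) \<in> Qs. f x = f y} + card {(x, y) \<in> Qd. f x = f y}"
    for f :: "nat \<Rightarrow> nat"
    using fin
    by (subst card_Un_disjoint[symmetric])
      (auto simp: Qs_def Qd_def intro!: arg_cong[where f = card] elim: rev_finite_subset)
  have "card Qd = card {(x, y) \<in> Qd. g x = g y} + card {(x, y) \<in> Qd. h x = h y}"
    using fin flip
    by (subst card_Un_disjoint[symmetric])
      (auto intro!: arg_cong[where f = card] elim: rev_finite_subset)
  moreover have "{(x, y) \<in> Qs. h x = h y} = {(x, y) \<in> Qs. g x = g y}"
    using same by auto
  then have "card {(x, y) \<in> Qs. h x = h y} = card {(x, y) \<in> Qs. g x = g y}" by simp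
  ultimately have "2 * card {(x, y) \<in> Q. g x = g y} \<le> card Q \<or> 2 * card {(x, y) \<in> Q. h x = h y} \<le> card Q"
    using split[of g] split[of h] Q g(3) by linarith
  then show ?case using gl hl g(2) h2 by blast
qed

text \<open>Each further output bit is chosen for the pairs that still collide and halves their
  number. The product form matters: once \<open>card Q < 2 ^ M\<close>, it leaves no collision at
  all.\<close>

lemma ex_xor_linear_hash:
  fixes Q :: "(nat \<times> nat) set"
  assumes "finite Q" "\<And>x y. (x, y) \<in> Q \<Longrightarrow> x mod 2 ^ B \<noteq> y mod 2 ^ B"
  shows "\<exists>h. xor_linear B h \<and> (\<forall>x. h x < 2 ^ M) \<and> 2 ^ M * card {(x, y) \<in> Q. h x = h y} \<le> card Q"
proof (induction M)
  case 0
  have "card {(x, y) \<in> Q. True} \<le> card Q" by simp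
  then show ?case by (intro exI[of _ "\<lambda>x. 0"]) (simp add: xor_linear_def)
next
  case (Suc M)
  then obtain h where h: "xor_linear B h" "\<And>x. h x < 2 ^ M"
    "2 ^ M * card {(x, y) \<in> Q. h x = h y} \<le> card Q"
    by blast
  define Q' where "Q' = {(x, y) \<in> Q. h x = h y}"
  have "finite Q'" using assms(1) by (auto simp: Q'_def elim: rev_finite_subset)
  then obtain g where g: "xor_linear B g" "\<And>x. g x < 2" "2 * card {(x, y) \<in> Q'. g x = g y} \<le> card Q'"
    using ex_xor_linear_bit_hash[of Q' B] assms(2) by (auto simp: Q'_def)
  define k where "k x = (h x * 2 ^ 1) XOR g x" for x
  have kl: "xor_linear B k"
    unfolding k_def[abs_def] by (intro xor_linear_xor xor_linear_mult h g)
  have kk: "k x = 2 * h x + g x" for x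
    using g(2)[of x] by (auto simp: k_def less_2_cases_iff xor_Suc_0_eq)
  have lt: "k x < 2 ^ Suc M" for x
    using kk[of x] g(2)[of x] h(2)[of x] by auto
  have "k x = k y \<longleftrightarrow> h x = h y \<and> g x = g y" for x y
    using kk[of x] kk[of y] g(2)[of x] g(2)[of y] by presburger
  then have "{(x, y) \<in> Q. k x = k y} = {(x, y) \<in> Q'. g x = g y}"
    by (auto simp: Q'_def)
  then have "2 ^ Suc M * card {(x, y) \<in> Q. k x = k y} \<le> 2 ^ M * card Q'"
    using g(3) by simp
  also have "\<dots> \<le> card Q" using h(3) by (simp add: Q'_def)
  finally show ?case using kl lt by blast
qed

lemma xor_cancel_left_iff: "(x XOR y = x XOR z) \<longleftrightarrow> y = (z :: nat)"
proof
  assume "x XOR y = x XOR z"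
  then have "(x XOR x) XOR y = (x XOR x) XOR z" by (simp only: xor.assoc)
  then show "y = z" by simp
qed simp

text \<open>The buckets of the hash function \<open>g\<close> are placed one after the other, in the order of
  decreasing size; the induction removes the smallest bucket. When a bucket of size \<open>b \<ge> 2\<close> is placed,
  at most \<open>b * a\<close> displacements are blocked, where \<open>a\<close> is the number of keys placed before, and
  \<open>(b - 1) * a\<close> is at most the number of pairs that collide under \<open>g\<close>.\<close>

lemma ex_displacements:
  fixes X :: "nat set" and g f :: "nat \<Rightarrow> nat"
  assumes "finite X" and "finite J"
    and inj: "\<And>x y. x \<in> X \<Longrightarrow> y \<in> X \<Longrightarrow> g x = g y \<Longrightarrow> f x = f y \<Longrightarrow> x = y"
    and f: "\<And>x. f x < 2 ^ R"
    and card: "card X < 2 ^ R"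
    and coll: "2 * card {(x, y). x \<in> X \<and> y \<in> X \<and> x \<noteq> y \<and> g x = g y} < 2 ^ R"
  shows "\<exists>D. (\<forall>\<beta>. D \<beta> < 2 ^ R) \<and> inj_on (\<lambda>x. D (g x) XOR f x) {x \<in> X. g x \<in> J}"
  using assms(2)
proof (induction "card J" arbitrary: J)
  case 0
  then show ?case by (intro exI[of _ "\<lambda>_. 0"]) auto
next
  case (Suc k)
  define S where "S \<beta> = {x \<in> X. g x = \<beta>}" for \<beta>
  have finS: "finite (S \<beta>)" for \<beta> using assms(1) by (simp add: S_def)
  have "J \<noteq> {}" using Suc.hyps(2) by auto
  define \<beta> where "\<beta> = arg_min_on (\<lambda>\<beta>. card (S \<beta>)) J"
  have \<beta>: "\<beta> \<in> J" "\<And>\<gamma>. \<gamma> \<in> J \<Longrightarrow> card (S \<beta>) \<le> card (S \<gamma>)"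
    using arg_min_if_finite(1)[OF Suc.prems \<open>J \<noteq> {}\<close>] arg_min_least[OF Suc.prems \<open>J \<noteq> {}\<close>]
    by (auto simp: \<beta>_def)
  define J' where "J' = J - {\<beta>}"
  have J': "finite J'" "k = card J'" using Suc.hyps(2) Suc.prems \<beta>(1) by (auto simp: J'_def)
  obtain D where D: "\<And>\<gamma>. D \<gamma> < 2 ^ R" "inj_on (\<lambda>x. D (g x) XOR f x) {x \<in> X. g x \<in> J'}"
    using Suc.hyps(1)[OF J'(2) J'(1)] by blast
  define P where "P = {x \<in> X. g x \<in> J'}"
  have finP: "finite P" using assms(1) by (simp add: P_def)
  define b where "b = card (S \<beta>)"
  have blocked: "b * card P < 2 ^ R"
  proof -
    consider "b = 0" | "b = 1" | "b \<ge> 2" by linarith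
    then show ?thesis
    proof cases
      case 2
      have "card P \<le> card X" using assms(1) by (auto simp: P_def intro: card_mono)
      then show ?thesis using 2 card by simp
    next
      case 3
      define C where "C = {(x, y). x \<in> X \<and> y \<in> X \<and> x \<noteq> y \<and> g x = g y}"
      have finC: "finite C" by (rule finite_subset[of _ "X \<times> X"]) (auto simp: C_def assms(1))
      have "card P * (b - 1) = (\<Sum>x\<in>P. b - 1)" by simp
      also have "\<dots> \<le> (\<Sum>x\<in>P. card (S (g x) - {x}))"
      proof (rule sum_mono)
        fix x assume x: "x \<in> P"
        then have "x \<in> S (g x)" by (simp add: S_def P_def)
        moreover have "b \<le> card (S (g x))" using x \<beta>(2)[of "g x"] by (auto simp: b_def P_def J'_def)
        ultimately show "b - 1 \<le> card (S (g x) - {x})" by simp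
      qed
      also have "\<dots> = card (SIGMA x:P. S (g x) - {x})"
        using finP finS by (intro card_SigmaI[symmetric]) auto
      also have "\<dots> \<le> card C"
        by (rule card_mono[OF finC]) (auto simp: C_def P_def S_def)
      finally have "card P * (b - 1) \<le> card C" .
      \<comment> \<open>The factor 2 lost here is the one in the assumption \<open>coll\<close>. A
        bucket with a single key causes no collision, so its case rests on the assumption
        \<open>card\<close> instead.\<close>
      moreover have "b * card P \<le> 2 * (card P * (b - 1))"
      proof -
        have "b \<le> 2 * (b - 1)" using 3 by simp
        then have "b * card P \<le> 2 * (b - 1) * card P" by (rule mult_right_mono) simp
        then show ?thesis by (simp add: ac_simps)
      qed
      ultimately show ?thesis using coll unfolding C_def by linarith
    qed simp
  qed
  define bad where "bad = (\<lambda>(x, z). (D (g z) XOR f z) XOR f x) ` (S \<beta> \<times> P)"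
  have "card bad \<le> b * card P"
    using card_image_le[of "S \<beta> \<times> P" "\<lambda>(x, z). (D (g z) XOR f z) XOR f x"] finS finP
    by (simp add: bad_def b_def card_cartesian_product)
  then have "card bad < card {..<2 ^ R :: nat}" using blocked by simp
  moreover have "finite bad" unfolding bad_def using finS finP by simp
  ultimately have "\<not> {..<2 ^ R} \<subseteq> bad" by (meson card_mono not_le)
  then obtain \<delta> where \<delta>: "\<delta> < 2 ^ R" "\<delta> \<notin> bad" by auto
  \<comment> \<open>Within a bucket the displacement is a common shift, so \<open>f\<close> alone
    has to separate the keys.\<close>
  have inS: "inj_on (\<lambda>x. \<delta> XOR f x) (S \<beta>)"
    using inj by (auto simp: inj_on_def xor_cancel_left_iff S_def)
  have disj: "\<delta> XOR f x \<noteq> D (g z) XOR f z" if "x \<in> S \<beta>" "z \<in> P" for x z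
  proof
    assume "\<delta> XOR f x = D (g z) XOR f z"
    then have "(\<delta> XOR f x) XOR f x = (D (g z) XOR f z) XOR f x" by simp
    then have "\<delta> = (D (g z) XOR f z) XOR f x" by (simp add: xor.assoc)
    then show False using \<delta>(2) that by (auto simp: bad_def)
  qed
  have "inj_on (\<lambda>x. (D(\<beta> := \<delta>)) (g x) XOR f x) {x \<in> X. g x \<in> J}"
  proof (rule inj_onI)
    fix x y
    assume x: "x \<in> {x \<in> X. g x \<in> J}" and y: "y \<in> {x \<in> X. g x \<in> J}"
      and eq: "(D(\<beta> := \<delta>)) (g x) XOR f x = (D(\<beta> := \<delta>)) (g y) XOR f y"
    have cases: "z \<in> S \<beta> \<and> g z = \<beta> \<or> z \<in> P \<and> g z \<noteq> \<beta>" if "z \<in> {x \<in> X. g x \<in> J}" for z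
      using that by (auto simp: S_def P_def J'_def)
    show "x = y"
      using cases[OF x] cases[OF y] eq disj[of x y] disj[of y x] inS D(2)
      by (auto simp: inj_on_def P_def)
  qed
  moreover have "(D(\<beta> := \<delta>)) \<gamma> < 2 ^ R" for \<gamma> using D(1) \<delta>(1) by simp
  ultimately show ?case by blast
qed

text \<open>A nonempty \<open>X\<close> has fewer than \<open>card X * 2 ^ M\<close> ordered pairs
  of distinct keys, so \<open>M\<close> output bits of \<open>g\<close> leave fewer than
  \<open>card X \<le> 2 ^ M\<close> collisions. The output bits of \<open>f\<close> then remove all
  of these, which makes \<open>f\<close> injective on every bucket, and \<open>2 ^ Suc M\<close>
  slots meet both counting conditions of \<open>ex_displacements\<close>.\<close>

lemma ex_perfect_hash:
  fixes X :: "nat set"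
  assumes X: "X \<subseteq> {..<2 ^ B}" and card: "card X \<le> 2 ^ M"
  shows "\<exists>g f D. xor_linear B g \<and> (\<forall>x. g x < 2 ^ M) \<and> xor_linear B f \<and> (\<forall>x. f x < 2 ^ Suc M) \<and>
    (\<forall>\<beta>. D \<beta> < 2 ^ Suc M) \<and> inj_on (\<lambda>x. D (g x) XOR f x) X"
proof (cases "X = {}")
  case True
  then show ?thesis
    by (intro exI[of _ "\<lambda>_. 0"]) (simp add: xor_linear_zero)
next
  case False
  have fin: "finite X" using X finite_subset by blast
  define Q where "Q = {(x, y). x \<in> X \<and> y \<in> X \<and> x \<noteq> y}"
  have Qeq: "Q = (SIGMA x:X. X - {x})" by (auto simp: Q_def)
  have finQ: "finite Q" using fin by (auto simp: Qeq)
  have cardQ: "card Q = card X * (card X - 1)"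
    using fin unfolding Qeq by (subst card_SigmaI) auto
  have neq: "x mod 2 ^ B \<noteq> y mod 2 ^ B" if "(x, y) \<in> Q" for x y
    using that X by (auto simp: Q_def subset_iff)
  obtain g where g: "xor_linear B g" "\<And>x. g x < 2 ^ M" "2 ^ M * card {(x, y) \<in> Q. g x = g y} \<le> card Q"
    using ex_xor_linear_hash[OF finQ neq] by blast
  define Q' where "Q' = {(x, y) \<in> Q. g x = g y}"
  have "card X > 0" using fin False by (simp add: card_gt_0_iff)
  have "card Q \<le> 2 ^ M * (card X - 1)"
    unfolding cardQ using card by (rule mult_right_mono) simp
  then have "2 ^ M * card Q' \<le> 2 ^ M * (card X - 1)"
    using g(3) unfolding Q'_def by (rule order_trans[rotated])
  then have Q': "card Q' \<le> card X - 1" by (simp only: mult_le_cancel1) simp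
  then have Q'lt: "card Q' < 2 ^ M" using card \<open>card X > 0\<close> by linarith
  have finQ': "finite Q'" using finQ by (auto simp: Q'_def elim: rev_finite_subset)
  obtain f where f: "xor_linear B f" "\<And>x. f x < 2 ^ Suc M"
      "2 ^ Suc M * card {(x, y) \<in> Q'. f x = f y} \<le> card Q'"
    using ex_xor_linear_hash[OF finQ', of B "Suc M"] neq by (auto simp: Q'_def)
  have "card {(x, y) \<in> Q'. f x = f y} = 0"
  proof (rule ccontr)
    assume "card {(x, y) \<in> Q'. f x = f y} \<noteq> 0"
    then have "2 ^ Suc M * 1 \<le> 2 ^ Suc M * card {(x, y) \<in> Q'. f x = f y}"
      by (intro mult_left_mono) auto
    also note f(3)
    finally show False using Q'lt by simp
  qed
  moreover have "finite {(x, y) \<in> Q'. f x = f y}"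
    using finQ' by (auto elim: rev_finite_subset)
  ultimately have "{(x, y) \<in> Q'. f x = f y} = {}" by simp
  then have inj: "x = y" if "x \<in> X" "y \<in> X" "g x = g y" "f x = f y" for x y
    using that by (auto simp: Q'_def Q_def)
  have Q'eq: "{(x, y). x \<in> X \<and> y \<in> X \<and> x \<noteq> y \<and> g x = g y} = Q'"
    by (auto simp: Q'_def Q_def)
  have "\<exists>D. (\<forall>\<beta>. D \<beta> < 2 ^ Suc M) \<and> inj_on (\<lambda>x. D (g x) XOR f x) {x \<in> X. g x \<in> {..<2 ^ M}}"
  proof (rule ex_displacements[OF fin finite_lessThan])
    show "card X < 2 ^ Suc M" using card by (rule le_less_trans) simp
    show "2 * card {(x, y). x \<in> X \<and> y \<in> X \<and> x \<noteq> y \<and> g x = g y} < 2 ^ Suc M"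
      unfolding Q'eq using Q'lt by simp
  qed (use inj f(2) in auto)
  have "{x \<in> X. g x \<in> {..<2 ^ M}} = X" using g(2) by auto
  then show ?thesis
    using g(1,2) f(1,2) \<open>\<exists>D. _\<close> by (simp only:) blast
qed

section \<open>Memory cells\<close>

lemma bits_val_bit: "bit (bits_val bs) n \<longleftrightarrow> n < length bs \<and> bs ! n"
  unfolding bits_val_def by (auto simp: bit_horner_sum_bit_iff)

lemma bits_val_less: "bits_val bs < 2 ^ length bs"
proof -
  have "take_bit (length bs) (bits_val bs) = bits_val bs"
    by (rule bit_eqI) (auto simp: bit_take_bit_iff bits_val_bit)
  then show ?thesis by (metis take_bit_nat_eq_self_iff)
qed

lemma packed_bit: "bit (packed w bs a) n \<longleftrightarrow> n < w \<and> a * w + n < length bs \<and> bs ! (a * w + n)"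
  unfolding packed_def by (auto simp: bits_val_bit)

lemma packed_less: "packed w bs a < 2 ^ w"
proof -
  have "take_bit w (packed w bs a) = packed w bs a"
    by (rule bit_eqI) (auto simp: bit_take_bit_iff packed_bit)
  then show ?thesis by (metis take_bit_nat_eq_self_iff)
qed

text \<open>No cell straddles two words: a word holds \<open>w div s\<close> cells and its top
  \<open>w mod s\<close> bits stay zero. A cell is then read from one word by a shift and a
  mask.\<close>

definition cell_bit :: "nat \<Rightarrow> nat \<Rightarrow> (nat \<Rightarrow> nat) \<Rightarrow> nat \<Rightarrow> bool" where
  "cell_bit w s cells p \<longleftrightarrow> p mod w < w div s * s \<and>
     bit (cells (p div w * (w div s) + p mod w div s)) (p mod w mod s)"

text \<open>If \<open>0 < s \<le> w\<close>, at least half of every word belongs to cells, since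
  \<open>w < (w div s + 1) * s\<close>. So \<open>2 * s * N\<close> bits suffice for
  \<open>N\<close> cells, whatever the word size.\<close>

definition layout :: "nat \<Rightarrow> nat \<Rightarrow> nat \<Rightarrow> (nat \<Rightarrow> nat) \<Rightarrow> bool list" where
  "layout w s N cells = map (cell_bit w s cells) [0..<2 * s * N]"

lemma length_layout: "length (layout w s N cells) = 2 * s * N"
  by (simp add: layout_def)

lemma packed_layout:
  assumes s: "0 < s" "s \<le> w" and cells: "\<And>z. cells z < 2 ^ s" "\<And>z. N \<le> z \<Longrightarrow> cells z = 0"
    and i: "i < w div s"
  shows "packed w (layout w s N cells) a div 2 ^ (i * s) mod 2 ^ s = cells (a * (w div s) + i)"
proof -
  define k where "k = w div s"
  have k: "k * s \<le> w" "w < (k + 1) * s" "k \<ge> 1"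
    using s by (auto simp: k_def dividend_less_div_times Suc_leI div_greater_zero_iff)
  have "bit (take_bit s (drop_bit (i * s) (packed w (layout w s N cells) a))) j =
      bit (cells (a * k + i)) j" for j
  proof (cases "j < s")
    case False
    then have "\<not> bit (cells (a * k + i)) j"
      using cells(1)[of "a * k + i"] by (metis bit_take_bit_iff take_bit_nat_eq_self_iff)
    then show ?thesis using False by (simp add: bit_take_bit_iff)
  next
    case True
    define n where "n = i * s + j"
    have "(i + 1) * s \<le> k * s" using i by (intro mult_right_mono) (auto simp: k_def)
    then have n: "n < k * s" using True by (simp add: n_def)
    then have nw: "n < w" using k by simp
    have pos: "(a * w + n) div w = a" "(a * w + n) mod w = n" "n div s = i" "n mod s = j"
      using nw True by (auto simp: n_def)
    have cb: "cell_bit w s cells (a * w + n) \<longleftrightarrow> bit (cells (a * k + i)) j"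
      unfolding cell_bit_def pos k_def[symmetric] using n by simp
    \<comment> \<open>Positions beyond the end of the string read as zero. If one of them belongs to
      this cell, the cell must be one of the zero cells from \<open>N\<close> on.\<close>
    have "cells (a * k + i) = 0" if "2 * s * N \<le> a * w + n"
    proof -
      have "w \<le> 2 * (k * s)"
      proof -
        have "s \<le> k * s" using k(3) by simp
        moreover have "w < k * s + s" using k(2) by simp
        ultimately show ?thesis by linarith
      qed
      then have "a * w \<le> a * (2 * (k * s))" by (rule mult_left_mono) simp
      then have "2 * s * N < s * (2 * (a * k) + i + 1)"
      proof -
        have "2 * s * N < a * (2 * (k * s)) + i * s + s"
          using that True \<open>a * w \<le> _\<close> unfolding n_def by linarith
        also have "\<dots> = s * (2 * (a * k) + i + 1)" by (simp add: algebra_simps)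
        finally show ?thesis .
      qed
      then have "2 * N < 2 * (a * k) + i + 1" by (metis mult.assoc mult.left_commute mult_less_cancel1)
      then show ?thesis using cells(2) by simp
    qed
    then show ?thesis
      using True nw cb
      by (cases "a * w + n < 2 * s * N") (auto simp: bit_take_bit_iff bit_drop_bit_eq packed_bit length_layout n_def[symmetric] layout_def)
  qed
  then have "take_bit s (drop_bit (i * s) (packed w (layout w s N cells) a)) = cells (a * k + i)"
    by (rule bit_eqI)
  then show ?thesis by (simp add: take_bit_eq_mod drop_bit_eq_div k_def)
qed

section \<open>Numbers of several words\<close>

definition digit :: "nat \<Rightarrow> nat \<Rightarrow> nat \<Rightarrow> nat" where
  "digit b z i = z div 2 ^ (b * i) mod 2 ^ b"

lemma digit_less: "digit b z i < 2 ^ b"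
  by (simp add: digit_def)

lemma digit_0: "digit b z 0 = z mod 2 ^ b"
  by (simp add: digit_def)

lemma bit_digit: "bit (digit b z i) n \<longleftrightarrow> n < b \<and> bit z (b * i + n)"
  by (simp add: digit_def bit_take_bit_iff bit_drop_bit_eq flip: take_bit_eq_mod drop_bit_eq_div)

lemma digit_xor: "digit b (x XOR y) i = digit b x i XOR digit b y i"
  by (rule bit_eqI) (auto simp: bit_digit bit_xor_iff)

lemma multiword_append:
  "multiword w (xs @ ys) = multiword w xs + 2 ^ (w * length xs) * multiword w ys"
  unfolding multiword_def
  by (induction xs) (auto simp: algebra_simps power_add)

lemma multiword_Nil [simp]: "multiword w [] = 0"
  by (simp add: multiword_def)

lemma multiword_Cons: "multiword w (x # xs) = x + 2 ^ w * multiword w xs"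
  by (simp add: multiword_def)

lemma multiword_digits: "multiword w (map (digit w z) [0..<e]) = z mod 2 ^ (w * e)"
proof (induction e)
  case (Suc e)
  have "z mod (2 ^ (w * e) * 2 ^ w) = 2 ^ (w * e) * (z div 2 ^ (w * e) mod 2 ^ w) + z mod 2 ^ (w * e)"
    by (rule mod_mult2_eq)
  then show ?case
    using Suc by (simp add: multiword_append multiword_Cons digit_def power_add algebra_simps)
qed simp

lemma digits_eqI:
  assumes "x < 2 ^ (b * e)" "y < 2 ^ (b * e)" "\<And>i. i < e \<Longrightarrow> digit b x i = digit b y i"
  shows "x = y"
proof -
  have "map (digit b x) [0..<e] = map (digit b y) [0..<e]" using assms(3) by simp
  then have "x mod 2 ^ (b * e) = y mod 2 ^ (b * e)" by (simp only: multiword_digits[symmetric])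
  then show ?thesis using assms(1,2) by simp
qed

lemma multiword_zeros: "multiword w (map (\<lambda>_. 0) xs) = 0"
  by (induction xs) (auto simp: multiword_Cons)

fun xor_sum :: "(nat \<Rightarrow> nat) \<Rightarrow> nat \<Rightarrow> nat" where
  "xor_sum f 0 = 0"
| "xor_sum f (Suc n) = xor_sum f n XOR f n"

lemma xor_sum_cong: "(\<And>i. i < n \<Longrightarrow> f i = g i) \<Longrightarrow> xor_sum f n = xor_sum g n"
  by (induction n) auto

lemma xor_sum_add: "xor_sum f (a + b) = xor_sum f a XOR xor_sum (\<lambda>i. f (a + i)) b"
  by (induction b) (auto simp: xor.assoc)

lemma xor_sum_mult: "xor_sum f (e * q) = xor_sum (\<lambda>j. xor_sum (\<lambda>l. f (j * q + l)) q) e"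
proof (induction e)
  case (Suc e)
  have "xor_sum f (Suc e * q) = xor_sum f (e * q + q)" by (simp add: add.commute)
  then show ?case using Suc by (simp add: xor_sum_add)
qed simp

lemma xor_linear_sum: "xor_linear B G \<Longrightarrow> G (xor_sum f n) = xor_sum (\<lambda>i. G (f i)) n"
  by (induction n) (auto simp: xor_linearD)

lemma xor_sum_xor: "xor_sum (\<lambda>i. f i XOR g i) n = xor_sum f n XOR xor_sum g n"
  by (induction n) (auto simp: ac_simps)

lemma xor_sum_digits: "xor_sum (\<lambda>i. digit b z i * 2 ^ (b * i)) n = z mod 2 ^ (b * n)"
proof (induction n)
  case (Suc n)
  have "take_bit (b * n) z XOR push_bit (b * n) (digit b z n) = take_bit (b * Suc n) z"
  proof (rule bit_eqI)
    fix m
    show "bit (take_bit (b * n) z XOR push_bit (b * n) (digit b z n)) m = bit (take_bit (b * Suc n) z) m"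
      by (cases "m < b * n") (auto simp: bit_xor_iff bit_take_bit_iff bit_push_bit_iff bit_digit)
  qed
  then show ?case using Suc by (simp add: take_bit_eq_mod push_bit_eq_mult)
qed simp

lemma digit_xor_sum: "digit b (xor_sum f n) i = xor_sum (\<lambda>c. digit b (f c) i) n"
  by (induction n) (auto simp: digit_xor, simp add: digit_def)

text \<open>\<open>2 ^ w - x\<close> is the negation of \<open>x\<close> in two's complement: it
  agrees with \<open>x\<close> up to the lowest set bit and is its complement above. The induction
  strips the trailing zeros.\<close>

lemma lowest_bit:
  fixes x :: nat
  assumes "x mod 2 ^ Suc b = 2 ^ b" "x < 2 ^ w"
  shows "x AND (2 ^ w - x) = 2 ^ b"
  using assms
proof (induction b arbitrary: x w)
  case 0
  obtain v where v: "w = Suc v" using 0 by (cases w) auto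
  \<comment> \<open>Numbers with sum \<open>2 ^ u - 1\<close> are complements of each other within
    \<open>u\<close> bits.\<close>
  have disj: "a + c + 1 = 2 ^ u \<Longrightarrow> a AND c = 0" for a c u :: nat
  proof (induction u arbitrary: a c)
    case (Suc u)
    have "(a mod 2) * (c mod 2) = 0" "a div 2 + c div 2 + 1 = 2 ^ u"
    proof -
      have s: "a + c + 1 = 2 * 2 ^ u" using Suc.prems by simp
      then have "odd (a + c)" by presburger
      then show "(a mod 2) * (c mod 2) = 0" by (auto simp: mod_2_eq_odd)
      show "a div 2 + c div 2 + 1 = 2 ^ u" using s by linarith
    qed
    then show ?case using Suc.IH[of "a div 2" "c div 2"] by (subst and_nat_rec) (auto simp: mod_2_eq_odd split: if_splits)
  qed auto
  obtain a where a: "x = 2 * a + 1" using 0(1) by (metis mod_mult_div_eq mult.commute add.commute power_0 power_one_right power_Suc mult_1_right)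
  define c where "c = 2 ^ v - a - 1"
  have c: "2 ^ w - x = 2 * c + 1" "a + c + 1 = 2 ^ v" using 0(2) a v by (auto simp: c_def)
  have "x AND (2 ^ w - x) = (2 * a + 1) AND (2 * c + 1)" by (subst c(1), subst a) (rule refl)
  then show ?case using disj[OF c(2)] by (subst (asm) (2) and_nat_rec) auto
next
  case (Suc b)
  obtain v where v: "w = Suc v" using Suc.prems by (cases w) auto
  have "x mod 2 = x mod 2 ^ Suc (Suc b) mod 2" by (rule mod_mod_cancel[symmetric]) simp
  then have "even x" unfolding Suc.prems(1) by (simp add: even_iff_mod_2_eq_zero)
  then obtain a where a: "x = 2 * a" by blast
  have "2 * (a mod 2 ^ Suc b) = 2 * 2 ^ b" using Suc.prems(1) by (simp add: a mult_mod_right)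
  then have 1: "a mod 2 ^ Suc b = 2 ^ b" by simp
  have 2: "a < 2 ^ v" using Suc.prems(2) a v by simp
  have "2 ^ w - x = 2 * (2 ^ v - a)" by (simp add: a v)
  then show ?case using Suc.IH[OF 1 2] a by (subst and_nat_rec) auto
qed

section \<open>Queries\<close>

abbreviation const_ex :: "nat \<Rightarrow> ex" where "const_ex n \<equiv> Opd (Const n)"

text \<open>Cell \<open>0\<close> contains \<open>s * 2 ^ h + 2 ^ (h - 1)\<close> with \<open>h = s div 2\<close>: its lowest set bit reveals
  \<open>h\<close> before the size of the cells is known.\<close>

definition low_ex :: ex where
  "low_ex = Bin And (Ld []) (Bin Sub (const_ex 0) (Ld []))"

definition half_ex :: ex where
  "half_ex = Bin Add low_ex low_ex"

text \<open>The reduction modulo \<open>2 ^ h\<close> cuts off the other cells of the word, whose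
  bits start at \<open>s \<ge> 2 * h\<close>. It keeps \<open>s\<close> intact because
  \<open>s < 2 ^ h\<close>.\<close>

definition size_ex :: ex where
  "size_ex = Bin Mod (Bin Div (Ld []) half_ex) half_ex"

definition per_word_ex :: ex where
  "per_word_ex = Bin Div (Opd WordSize) size_ex"

definition mask_ex :: "ex \<Rightarrow> ex" where
  "mask_ex a = Bin Sub (Bin ShiftL (const_ex 1) a) (const_ex 1)"

text \<open>Only the lowest word of the address is divided by the number of cells per word. This is
  right because addresses of several words occur only if a cell is a whole word, and then the
  divisor is 1.\<close>

definition cell_ex :: "ex \<Rightarrow> ex list \<Rightarrow> ex" where
  "cell_ex a as = Bin And
     (Bin ShiftR (Ld (Bin Div a per_word_ex # as)) (Bin Mul (Bin Mod a per_word_ex) size_ex))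
     (mask_ex size_ex)"

definition chunk_size :: "nat \<Rightarrow> nat \<Rightarrow> nat" where
  "chunk_size q s = (s + (q - 1)) div q"

definition chunk_size_ex :: "nat \<Rightarrow> ex" where
  "chunk_size_ex q = Bin Div (Bin Add size_ex (const_ex (q - 1))) (const_ex q)"

definition chunk_ex :: "nat \<Rightarrow> nat \<Rightarrow> nat \<Rightarrow> ex" where
  "chunk_ex q j l = Bin And (Bin ShiftR (Opd (Reg j)) (Bin Mul (chunk_size_ex q) (const_ex l)))
     (mask_ex (chunk_size_ex q))"

text \<open>Chunk \<open>c\<close> is chunk \<open>c mod q\<close> of word \<open>c div q\<close>;
  together with its value it selects a record. The address takes a single word because the chunk
  tables will lie within the first \<open>2 ^ s\<close> cells (assumption \<open>room\<close>
  below).\<close>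

definition chunk_cell_ex :: "nat \<Rightarrow> nat \<Rightarrow> nat \<Rightarrow> nat \<Rightarrow> ex" where
  "chunk_cell_ex q t off c = cell_ex (Bin Add (Bin ShiftL
     (Bin Add (Bin ShiftL (const_ex c) (chunk_size_ex q)) (chunk_ex q (c div q) (c mod q)))
     (const_ex t)) (const_ex off)) []"

fun xor_ex :: "(nat \<Rightarrow> ex) \<Rightarrow> nat \<Rightarrow> ex" where
  "xor_ex f 0 = const_ex 0"
| "xor_ex f (Suc n) = Bin Xor (xor_ex f n) (f n)"

fun all_ex :: "(nat \<Rightarrow> ex) \<Rightarrow> nat \<Rightarrow> ex" where
  "all_ex f 0 = const_ex 1"
| "all_ex f (Suc n) = Ite (all_ex f n) (f n) (const_ex 0)"

text \<open>Memory is an array of records of \<open>2 ^ t\<close> cells. After two header cells, a record consists of 18 fields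
  of \<open>e\<close> cells: nine for encoding and nine for decoding. Fields \<open>0\<close> to \<open>4\<close> of a query hold the chunk tables of
  its affine maps \<open>g\<close>, \<open>f\<close>, the key and the two default results; fields \<open>5\<close> to \<open>8\<close> hold the displacement
  of a bucket and the key and the two results of a slot. Buckets and slots are stored multiplied by
  \<open>2 ^ t\<close>, which makes them addresses.\<close>

definition offset :: "nat \<Rightarrow> nat \<Rightarrow> nat \<Rightarrow> nat" where
  "offset e \<phi> i = 2 + \<phi> * e + i"

definition affine_ex :: "nat \<Rightarrow> nat \<Rightarrow> nat \<Rightarrow> nat \<Rightarrow> nat \<Rightarrow> ex" where
  "affine_ex e q t \<phi> i = xor_ex (chunk_cell_ex q t (offset e \<phi> i)) (e * q)"

definition field_ex :: "nat \<Rightarrow> (nat \<Rightarrow> ex) \<Rightarrow> nat \<Rightarrow> nat \<Rightarrow> ex" where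
  "field_ex e A \<phi> i = cell_ex (Bin Add (A 0) (const_ex (offset e \<phi> i))) (map A [1..<e])"

definition slot_ex :: "nat \<Rightarrow> nat \<Rightarrow> nat \<Rightarrow> nat \<Rightarrow> nat \<Rightarrow> ex" where
  "slot_ex e q t \<phi> i =
     Bin Xor (field_ex e (affine_ex e q t \<phi>) (\<phi> + 5) i) (affine_ex e q t (\<phi> + 1) i)"

definition hit_ex :: "nat \<Rightarrow> nat \<Rightarrow> nat \<Rightarrow> nat \<Rightarrow> ex" where
  "hit_ex e q t \<phi> = all_ex (\<lambda>i. Bin Eq (field_ex e (slot_ex e q t \<phi>) (\<phi> + 6) i)
     (affine_ex e q t (\<phi> + 2) i)) e"

definition result_ex :: "nat \<Rightarrow> nat \<Rightarrow> nat \<Rightarrow> nat \<Rightarrow> nat \<Rightarrow> nat \<Rightarrow> ex" where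
  "result_ex e q t \<phi> b i = Ite (hit_ex e q t \<phi>)
     (field_ex e (slot_ex e q t \<phi>) (\<phi> + 7 + b) i) (affine_ex e q t (\<phi> + 3 + b) i)"

text \<open>Row \<open>r\<close> stands for chunk \<open>r div 2 ^ \<omega>\<close> with value
  \<open>r mod 2 ^ \<omega>\<close>, which is put back to its place in the argument. By linearity
  the XOR over all chunks is \<open>G\<close> of the argument; the constant \<open>\<kappa>\<close>
  is stored with chunk 0 only, so that it enters exactly once.\<close>

definition chunk_table :: "nat \<Rightarrow> nat \<Rightarrow> nat \<Rightarrow> nat \<Rightarrow> (nat \<Rightarrow> nat) \<Rightarrow> nat \<Rightarrow> nat" where
  "chunk_table w \<omega> q \<kappa> G r = (if r div 2 ^ \<omega> = 0 then \<kappa> else 0) XOR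
     G (r mod 2 ^ \<omega> * 2 ^ (w * (r div 2 ^ \<omega> div q) + \<omega> * (r div 2 ^ \<omega> mod q)))"

section \<open>Evaluation of the queries on a given memory\<close>

lemma double_less_two_power: "h \<ge> 3 \<Longrightarrow> 2 * h + 1 < 2 ^ h"
  by (induction h rule: nat_induct_at_least) auto

lemma and_mask: "x AND (2 ^ m - 1) = x mod 2 ^ m" for x :: nat
  by (metis mask_eq_exp_minus_1 take_bit_eq_mask take_bit_eq_mod)

text \<open>\<open>geometry\<close> describes two regimes. Either a number fits one cell and a word
  holds one or more cells, or a cell is a whole word and a number takes \<open>e\<close> of them. In
  both, address arithmetic stays simple: there is only one digit, or only one cell per word.\<close>

locale cell_machine =
  fixes w s e q t N \<omega> :: nat and cells \<mu> :: "nat \<Rightarrow> nat" and tab :: "nat \<Rightarrow> nat \<Rightarrow> nat"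
  defines "\<omega> \<equiv> chunk_size q s"
  assumes geometry: "e = 1 \<and> s \<le> w \<or> s = w"
    and pos: "0 < e" "0 < q" "16 \<le> s" "q \<le> s"
    and read: "\<And>z. \<mu> (z div (w div s)) div 2 ^ (z mod (w div s) * s) mod 2 ^ s = cells z"
    and word: "\<mu> 0 < 2 ^ w"
    and header: "cells 0 = s * 2 ^ (s div 2) + 2 ^ (s div 2 - 1)"
    and room: "e * q * 2 ^ \<omega> * 2 ^ t \<le> 2 ^ s" "e * q * 2 ^ \<omega> \<le> N"
    and tab: "\<And>r \<phi> i. r < N \<Longrightarrow> i < e \<Longrightarrow> \<phi> < 18 \<Longrightarrow> cells (r * 2 ^ t + offset e \<phi> i) = digit s (tab \<phi> r) i"
    and fields: "2 + 18 * e \<le> 2 ^ t"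
begin

lemma sw: "s \<le> w" "0 < s" "0 < w" "s < 2 ^ w" "2 ^ s \<le> (2 :: nat) ^ w" "q < 2 ^ w"
proof -
  show "s \<le> w" using geometry by auto
  then show "2 ^ s \<le> (2 :: nat) ^ w" by (simp add: power_increasing)
  moreover have "s < 2 ^ s" by (rule less_exp)
  ultimately show "s < 2 ^ w" "q < 2 ^ w" using pos by linarith+
  show "0 < s" "0 < w" using pos \<open>s \<le> w\<close> by auto
qed

lemma omega: "\<omega> * q \<ge> s" "\<omega> < s + 1" "\<omega> \<ge> 1"
proof -
  have "s + (q - 1) < q * ((s + (q - 1)) div q) + q"
    using mult_div_mod_eq[of q "s + (q - 1)"] mod_less_divisor[OF pos(2), of "s + (q - 1)"]
    by linarith
  then show *: "\<omega> * q \<ge> s" by (simp add: \<omega>_def chunk_size_def mult.commute)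
  show "\<omega> \<ge> 1" using * sw(2) by (cases \<omega>) auto
  have "(s + (q - 1)) * 1 \<le> s * q"
  proof -
    obtain q' s' where "q = Suc q'" "s = Suc s'" using pos(2) sw(2) by (cases q; cases s) auto
    then show ?thesis by (simp add: algebra_simps)
  qed
  then have "s + (q - 1) < (s + 1) * q" using pos(2) by (simp add: algebra_simps)
  then show "\<omega> < s + 1" by (simp add: \<omega>_def chunk_size_def div_less_iff_less_mult pos(2))
qed

lemma eval_low: "eval w \<rho> \<mu> low_ex = 2 ^ (s div 2 - 1)"
  and first_word: "\<mu> 0 mod 2 ^ s = cells 0"
proof -
  show *: "\<mu> 0 mod 2 ^ s = cells 0" using read[of 0] by simp
  define h where "h = s div 2"
  have h: "Suc (h - 1) = h" "h \<le> s" using pos by (auto simp: h_def)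
  have "\<mu> 0 mod 2 ^ h = \<mu> 0 mod 2 ^ s mod 2 ^ h" using h by (simp add: mod_mod_cancel le_imp_power_dvd)
  also have "\<dots> = (s * 2 ^ h + 2 ^ (h - 1)) mod 2 ^ h" unfolding * header h_def ..
  also have "\<dots> = 2 ^ (h - 1) mod 2 ^ h" by simp
  also have "\<dots> = 2 ^ (h - 1)" using h(1) by (intro mod_less power_strict_increasing) auto
  finally have m: "\<mu> 0 mod 2 ^ Suc (h - 1) = 2 ^ (h - 1)" unfolding h(1) .
  then have "\<mu> 0 \<noteq> 0" by (intro notI) simp
  then have "(2 ^ w - \<mu> 0) mod 2 ^ w = 2 ^ w - \<mu> 0" by simp
  then show "eval w \<rho> \<mu> low_ex = 2 ^ (s div 2 - 1)"
    using lowest_bit[OF m word] by (simp add: low_ex_def h_def)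
qed

lemma eval_half: "eval w \<rho> \<mu> half_ex = 2 ^ (s div 2)"
proof -
  have "2 ^ (s div 2 - 1) + 2 ^ (s div 2 - 1) = (2 :: nat) ^ (s div 2)"
    using pos by (cases "s div 2") auto
  moreover have "(2 :: nat) ^ (s div 2) < 2 ^ w" using sw pos by (intro power_strict_increasing) auto
  ultimately show ?thesis by (simp add: half_ex_def eval_low)
qed

lemma eval_size: "eval w \<rho> \<mu> size_ex = s"
proof -
  define h where "h = s div 2"
  have h: "h + h \<le> s" "s \<le> 2 * h + 1" "h \<ge> 3" using pos by (auto simp: h_def)
  have sh: "s < 2 ^ h" using double_less_two_power[OF h(3)] h(2) by simp
  have "cells 0 < 2 ^ (h + h)"
  proof -
    have "(2 :: nat) ^ (h - 1) < 2 ^ h" using h by (intro power_strict_increasing) auto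
    then have "cells 0 < (s + 1) * 2 ^ h" unfolding header h_def[symmetric] by simp
    also have "\<dots> \<le> 2 ^ h * 2 ^ h" using sh by (intro mult_right_mono) auto
    finally show ?thesis by (simp add: power_add)
  qed
  then have c: "\<mu> 0 mod 2 ^ (h + h) = cells 0"
    unfolding first_word[symmetric] using h(1)
    by (simp add: mod_mod_cancel le_imp_power_dvd first_word flip: mod_mod_cancel[of "2 ^ (h + h)" "2 ^ s" "\<mu> 0"])
  have "\<mu> 0 div 2 ^ h mod 2 ^ h = \<mu> 0 mod 2 ^ (h + h) div 2 ^ h"
    using take_bit_drop_bit[of h h "\<mu> 0"] by (simp add: take_bit_eq_mod drop_bit_eq_div)
  also have "\<dots> = s"
    unfolding c header h_def[symmetric] using h by (subst div_add1_eq) simp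
  finally show ?thesis by (simp add: size_ex_def eval_half h_def)
qed

lemma eval_per_word: "eval w \<rho> \<mu> per_word_ex = w div s"
  by (simp add: per_word_ex_def eval_size)

lemma eval_mask:
  assumes "eval w \<rho> \<mu> a = m" "m \<le> w"
  shows "eval w \<rho> \<mu> (mask_ex a) = 2 ^ m - 1"
proof (cases "m = w")
  \<comment> \<open>The shift overflows to 0 and the subtraction wraps around to the mask of all
    \<open>w\<close> bits.\<close>
  case True
  then show ?thesis using assms sw(3) by (simp add: mask_ex_def)
next
  case False
  then have lt: "(2 :: nat) ^ m < 2 ^ w" using assms by simp
  have "(2 ^ m + (2 ^ w - 1)) mod 2 ^ w = (2 ^ m - 1 :: nat)"
  proof -
    have eq: "2 ^ m + (2 ^ w - 1) = (2 ^ m - 1) + (2 :: nat) ^ w" by simp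
    have "2 ^ m - 1 < (2 :: nat) ^ w" using lt by linarith
    then show ?thesis unfolding eq by (simp only: mod_add_self2 mod_less)
  qed
  then show ?thesis using lt assms sw(3) by (simp add: mask_ex_def)
qed

lemma eval_cell:
  assumes "eval w \<rho> \<mu> a mod (w div s) = z mod (w div s)"
    and "multiword w (eval w \<rho> \<mu> a div (w div s) # map (eval w \<rho> \<mu>) as) = z div (w div s)"
  shows "eval w \<rho> \<mu> (cell_ex a as) = cells z"
proof -
  define k where "k = w div s"
  have "k * s \<le> w" "k > 0" using sw(1,2) by (auto simp: k_def div_greater_zero_iff)
  then have "z mod k * s \<le> w"
    by (meson le_trans less_imp_le mod_less_divisor mult_le_mono1)
  also have "w < 2 ^ w" by (rule less_exp)
  finally have "(z mod k * s) mod 2 ^ w = z mod k * s" by simp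
  then have off: "eval w \<rho> \<mu> (Bin Mul (Bin Mod a per_word_ex) size_ex) = z mod k * s"
    using assms(1) by (simp add: eval_per_word eval_size k_def)
  have "multiword w (map (eval w \<rho> \<mu>) (Bin Div a per_word_ex # as)) = z div k"
    using assms(2) by (simp add: eval_per_word k_def)
  then show ?thesis
    using read[of z] off eval_mask[OF eval_size sw(1)]
    by (simp add: cell_ex_def and_mask k_def[symmetric] del: eval.simps(3) flip: One_nat_def)
      (simp flip: One_nat_def)
qed

lemma eval_cell_single:
  assumes "eval w \<rho> \<mu> a = z"
  shows "eval w \<rho> \<mu> (cell_ex a []) = cells z"
  using assms by (intro eval_cell) (auto simp: multiword_Cons)

lemma eval_cell_digits:
  assumes z: "z < 2 ^ (s * e)"
    and a: "eval w \<rho> \<mu> a = digit s z 0" "\<And>i. 0 < i \<Longrightarrow> i < e \<Longrightarrow> eval w \<rho> \<mu> (A i) = digit s z i"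
  shows "eval w \<rho> \<mu> (cell_ex a (map A [1..<e])) = cells z"
proof (rule eval_cell)
  have as: "map (eval w \<rho> \<mu>) (map A [1..<e]) = map (digit s z) [1..<e]"
    using a(2) by auto
  have "e = 1 \<or> e > 1 \<and> s = w" using geometry pos(1) by linarith
  then show "eval w \<rho> \<mu> a mod (w div s) = z mod (w div s)"
    and "multiword w (eval w \<rho> \<mu> a div (w div s) # map (eval w \<rho> \<mu>) (map A [1..<e])) = z div (w div s)"
  proof (atomize (full), elim disjE)
    assume e: "e = 1"
    then have "digit s z 0 = z" using z by (simp add: digit_0)
    then show "eval w \<rho> \<mu> a mod (w div s) = z mod (w div s) \<and>
      multiword w (eval w \<rho> \<mu> a div (w div s) # map (eval w \<rho> \<mu>) (map A [1..<e])) = z div (w div s)"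
      using e a(1) by (simp add: multiword_Cons)
  next
    assume e: "e > 1 \<and> s = w"
    have "[0..<e] = 0 # [1..<e]" using e by (simp add: upt_conv_Cons)
    then have "multiword w (map (digit s z) [0..<e]) = multiword w (digit s z 0 # map (digit s z) [1..<e])"
      by simp
    then show "eval w \<rho> \<mu> a mod (w div s) = z mod (w div s) \<and>
      multiword w (eval w \<rho> \<mu> a div (w div s) # map (eval w \<rho> \<mu>) (map A [1..<e])) = z div (w div s)"
      unfolding as a(1) using e z sw(3) multiword_digits[of w z e] by simp
  qed
qed

lemma offset_less: "\<phi> < 18 \<Longrightarrow> i < e \<Longrightarrow> offset e \<phi> i < 2 ^ t"
proof -
  assume \<phi>: "\<phi> < 18" and i: "i < e"
  have "\<phi> * e \<le> 17 * e" using \<phi> by (intro mult_right_mono) auto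
  then have "\<phi> * e + i < 18 * e" using i by linarith
  then show ?thesis using fields by (simp add: offset_def)
qed

lemma t_le: "t \<le> s"
proof -
  have "1 \<le> e * q * 2 ^ \<omega>" using pos by (simp add: Suc_le_eq)
  then have "1 * 2 ^ t \<le> e * q * 2 ^ \<omega> * 2 ^ t" by (rule mult_right_mono) simp
  then have "(2 :: nat) ^ t \<le> 2 ^ s" using room(1) by linarith
  then show ?thesis by simp
qed

text \<open>The record address is a multiple of \<open>2 ^ t\<close> and the offset is smaller than
  \<open>2 ^ t\<close>, so the addition carries nothing out of the lowest digit. This is why
  \<open>field_ex\<close> changes \<open>A 0\<close> only.\<close>

lemma eval_field:
  assumes z: "z = r * 2 ^ t" "z < 2 ^ (s * e)" "r < N" and i: "i < e" "\<phi> < 18"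
    and A: "\<And>i. i < e \<Longrightarrow> eval w \<rho> \<mu> (A i) = digit s z i"
  shows "eval w \<rho> \<mu> (field_ex e A \<phi> i) = digit s (tab \<phi> r) i"
proof -
  define o' where "o' = offset e \<phi> i"
  have o': "o' < 2 ^ t" using offset_less i by (simp add: o'_def)
  have dvd: "2 ^ t dvd z mod 2 ^ s"
    using z(1) t_le by (simp add: dvd_mod_iff le_imp_power_dvd)
  have lt: "z mod 2 ^ s + o' < 2 ^ s"
  proof -
    obtain m where m: "z mod 2 ^ s = 2 ^ t * m" using dvd by blast
    have "2 ^ s = 2 ^ t * (2 :: nat) ^ (s - t)" using t_le by (simp flip: power_add)
    then have "2 ^ t * m < 2 ^ t * 2 ^ (s - t)" using m by (metis mod_less_divisor zero_less_numeral zero_less_power)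
    then have "m + 1 \<le> 2 ^ (s - t)" by simp
    then have "2 ^ t * (m + 1) \<le> 2 ^ t * 2 ^ (s - t)" by (rule mult_left_mono) simp
    then show ?thesis using o' m \<open>2 ^ s = _\<close> by simp
  qed
  have add: "(z + o') mod 2 ^ s = z mod 2 ^ s + o'"
    using lt by (metis mod_add_left_eq mod_less)
  have div: "(z + o') div 2 ^ (s * j) mod 2 ^ s = z div 2 ^ (s * j) mod 2 ^ s" if "j > 0" for j
  proof -
    have "(z + o') div 2 ^ s = z div 2 ^ s"
      using lt by (subst div_add1_eq) simp
    moreover have "2 ^ (s * j) = 2 ^ s * (2 :: nat) ^ (s * (j - 1))"
      using that by (cases j) (auto simp: power_add)
    ultimately show ?thesis by (simp add: div_mult2_eq)
  qed
  have "z + o' < 2 ^ (s * e)"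
  proof -
    have "2 ^ (s * e) = 2 ^ t * (2 :: nat) ^ (s * e - t)"
      using t_le pos(1) by (subst power_add[symmetric]) (simp add: le_trans[of t s "s * e"])
    then have "r < 2 ^ (s * e - t)" using z(1,2) by (simp add: mult.commute)
    then have "(r + 1) * 2 ^ t \<le> 2 ^ (s * e - t) * 2 ^ t" by (intro mult_right_mono) auto
    then show ?thesis using \<open>2 ^ (s * e) = _\<close> z(1) o' by (simp add: mult.commute)
  qed
  then have "eval w \<rho> \<mu> (field_ex e A \<phi> i) = cells (z + o')"
    unfolding field_ex_def
  proof (rule eval_cell_digits)
    have "o' < 2 ^ w" "z mod 2 ^ s + o' < 2 ^ w" using lt sw(5) by linarith+
    then show "eval w \<rho> \<mu> (Bin Add (A 0) (const_ex (offset e \<phi> i))) = digit s (z + o') 0"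
      using A[of 0] pos(1) by (simp add: digit_0 add o'_def[symmetric])
    show "eval w \<rho> \<mu> (A j) = digit s (z + o') j" if "0 < j" "j < e" for j
      using A[OF that(2)] div[OF that(1)] by (simp add: digit_def)
  qed
  then show ?thesis
    using tab[OF z(3) i] by (simp add: z(1) o'_def)
qed

lemma eval_chunk_size: "eval w \<rho> \<mu> (chunk_size_ex q) = \<omega>"
proof -
  have "s + (q - 1) < 2 ^ s"
  proof -
    have "s + (q - 1) < 2 * s" using pos by linarith
    also have "\<dots> < 2 ^ s"
    proof -
      obtain m where m: "s = Suc m" "m \<ge> 3" using pos(3) by (cases s) auto
      then show ?thesis using double_less_two_power[of m] by simp
    qed
    finally show ?thesis .
  qed
  then have "s + (q - 1) < 2 ^ w" "q - 1 < 2 ^ w" using sw(5) by linarith+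
  then show ?thesis using sw(6) by (simp add: chunk_size_ex_def eval_size \<omega>_def chunk_size_def)
qed

lemma eval_chunk:
  assumes "l < q"
  shows "eval w \<rho> \<mu> (chunk_ex q j l) = digit \<omega> (\<rho> j) l"
proof -
  have "\<omega> * l \<le> 2 ^ \<omega> * l" by (rule mult_right_mono[OF less_imp_le[OF less_exp]]) simp
  also have "\<dots> < 2 ^ \<omega> * q" using assms by simp
  also have "\<dots> = 1 * q * 2 ^ \<omega> * 1" by simp
  also have "\<dots> \<le> e * q * 2 ^ \<omega> * 2 ^ t" using pos(1) by (intro mult_mono) auto
  also have "\<dots> \<le> 2 ^ w" using room(1) sw(5) by linarith
  finally have "\<omega> * l < 2 ^ w" .
  moreover have "l < 2 ^ w" using assms sw(6) by linarith
  moreover have "\<omega> \<le> w" using omega(2) sw(1) by linarith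
  ultimately show ?thesis
    using eval_mask[OF eval_chunk_size] eval_chunk_size
    by (simp add: chunk_ex_def and_mask digit_def flip: One_nat_def)
qed

lemma eval_chunk_cell:
  assumes c: "c < e * q" and i: "i < e" "\<phi> < 18"
  shows "eval w \<rho> \<mu> (chunk_cell_ex q t (offset e \<phi> i) c) =
    digit s (tab \<phi> (c * 2 ^ \<omega> + digit \<omega> (\<rho> (c div q)) (c mod q))) i"
proof -
  define v where "v = digit \<omega> (\<rho> (c div q)) (c mod q)"
  define o' where "o' = offset e \<phi> i"
  have o': "o' < 2 ^ t" using offset_less i by (simp add: o'_def)
  have v: "eval w \<rho> \<mu> (chunk_ex q (c div q) (c mod q)) = v"
    using eval_chunk pos(2) by (simp add: v_def)
  have "v < 2 ^ \<omega>" by (simp add: v_def digit_less)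
  moreover have "(c + 1) * 2 ^ \<omega> \<le> e * q * 2 ^ \<omega>" using c by (intro mult_right_mono) auto
  ultimately have r: "c * 2 ^ \<omega> + v < e * q * 2 ^ \<omega>" by simp
  then have "(c * 2 ^ \<omega> + v + 1) * 2 ^ t \<le> e * q * 2 ^ \<omega> * 2 ^ t" by (intro mult_right_mono) auto
  moreover have "(c * 2 ^ \<omega> + v + 1) * 2 ^ t = (c * 2 ^ \<omega> + v) * 2 ^ t + 2 ^ t" by simp
  ultimately have "(c * 2 ^ \<omega> + v) * 2 ^ t + 2 ^ t \<le> 2 ^ w" using room(1) sw(5) by linarith
  then have le: "(c * 2 ^ \<omega> + v) * 2 ^ t + o' < 2 ^ w" using o' by linarith
  have "1 \<le> (2 :: nat) ^ t" "1 \<le> (2 :: nat) ^ \<omega>" by auto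
  then have "(c * 2 ^ \<omega> + v) \<le> (c * 2 ^ \<omega> + v) * 2 ^ t" "c \<le> c * 2 ^ \<omega>"
    by (metis mult.right_neutral mult_le_mono2)+
  then have small: "(c * 2 ^ \<omega> + v) * 2 ^ t < 2 ^ w" "c * 2 ^ \<omega> + v < 2 ^ w" "c * 2 ^ \<omega> < 2 ^ w"
    "c < 2 ^ w" "o' < 2 ^ w"
    using le by (meson add_lessD1 add_lessD1[OF le_less_trans] le_less_trans add.commute le_add1 le_add2)+
  have "t < 2 ^ w" using t_le sw(1,4) by linarith
  have "eval w \<rho> \<mu> (chunk_cell_ex q t (offset e \<phi> i) c) = cells ((c * 2 ^ \<omega> + v) * 2 ^ t + o')"
    unfolding chunk_cell_ex_def
  proof (rule eval_cell_single)
    have 2: "eval w \<rho> \<mu> (Bin Add (Bin ShiftL (const_ex c) (chunk_size_ex q)) (chunk_ex q (c div q) (c mod q)))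
        = c * 2 ^ \<omega> + v"
      using small by (simp add: eval_chunk_size v)
    show "eval w \<rho> \<mu> (Bin Add (Bin ShiftL (Bin Add (Bin ShiftL (const_ex c) (chunk_size_ex q))
        (chunk_ex q (c div q) (c mod q))) (const_ex t)) (const_ex (offset e \<phi> i)))
        = (c * 2 ^ \<omega> + v) * 2 ^ t + o'"
      using small le \<open>t < 2 ^ w\<close> 2 by (simp add: o'_def)
  qed
  moreover have "c * 2 ^ \<omega> + v < N" using r room(2) by linarith
  ultimately show ?thesis using tab i by (simp add: o'_def v_def)
qed

lemma eval_xor: "eval w \<rho> \<mu> (xor_ex f n) = xor_sum (\<lambda>i. eval w \<rho> \<mu> (f i)) n"
  by (induction n) auto

text \<open>The \<open>q\<close> chunks of a word cover at least its lowest \<open>s\<close> bits.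
  If \<open>s = w\<close>, this is the whole word; if \<open>e = 1\<close>, \<open>G\<close> ignores
  the bits from \<open>s\<close> on, whether a chunk contains them or not.\<close>

lemma xor_sum_chunks:
  assumes G: "xor_linear (s * e) G" and \<rho>: "\<And>j. j < e \<Longrightarrow> \<rho> j = digit w x j"
  shows "xor_sum (\<lambda>c. G (digit \<omega> (\<rho> (c div q)) (c mod q) * 2 ^ (w * (c div q) + \<omega> * (c mod q)))) (e * q) = G x"
proof -
  have inner: "xor_sum (\<lambda>l. digit \<omega> z l * 2 ^ (w * j + \<omega> * l)) q = z mod 2 ^ (\<omega> * q) * 2 ^ (w * j)" for z j
  proof -
    have "xor_sum (\<lambda>l. f l * 2 ^ k) n = xor_sum f n * 2 ^ k" for f k n
      by (induction n) (auto simp flip: push_bit_eq_mult)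
    from this[of "\<lambda>l. digit \<omega> z l * 2 ^ (\<omega> * l)" "w * j" q] show ?thesis
      using xor_sum_digits[of \<omega> z q] by (simp add: power_add ac_simps)
  qed
  have word: "G (digit w x j mod 2 ^ (\<omega> * q) * 2 ^ (w * j)) = G (digit w x j * 2 ^ (w * j))" if "j < e" for j
    using geometry
  proof (elim disjE)
    assume e: "e = 1 \<and> s \<le> w"
    then have "j = 0" using that by simp
    have "G (digit w x j mod 2 ^ (\<omega> * q)) = G (digit w x j mod 2 ^ (\<omega> * q) mod 2 ^ s)"
      using xor_linearD(2)[OF G] e by simp
    also have "\<dots> = G (digit w x j mod 2 ^ s)" using omega(1) by (simp add: mod_mod_cancel le_imp_power_dvd)
    also have "\<dots> = G (digit w x j)" using xor_linearD(2)[OF G] e by simp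
    finally show ?thesis using \<open>j = 0\<close> by simp
  next
    assume "s = w"
    then have "digit w x j < 2 ^ (\<omega> * q)"
      using digit_less[of w x j] omega(1) by (metis less_le_trans one_le_numeral power_increasing)
    then show ?thesis by simp
  qed
  have "xor_sum (\<lambda>c. G (digit \<omega> (\<rho> (c div q)) (c mod q) * 2 ^ (w * (c div q) + \<omega> * (c mod q)))) (e * q)
      = xor_sum (\<lambda>j. xor_sum (\<lambda>l. G (digit \<omega> (\<rho> j) l * 2 ^ (w * j + \<omega> * l))) q) e"
    unfolding xor_sum_mult using pos(2) by (intro xor_sum_cong) auto
  also have "\<dots> = xor_sum (\<lambda>j. G (\<rho> j mod 2 ^ (\<omega> * q) * 2 ^ (w * j))) e"
    by (simp only: xor_linear_sum[OF G, symmetric] inner)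
  also have "\<dots> = xor_sum (\<lambda>j. G (digit w x j * 2 ^ (w * j))) e"
    using word \<rho> by (intro xor_sum_cong) auto
  also have "\<dots> = G (x mod 2 ^ (w * e))"
    unfolding xor_linear_sum[OF G, symmetric] xor_sum_digits ..
  also have "\<dots> = G (x mod 2 ^ (w * e) mod 2 ^ (s * e))" using xor_linearD(2)[OF G] by simp
  also have "\<dots> = G x"
    using sw(1) xor_linearD(2)[OF G] by (simp add: mod_mod_cancel le_imp_power_dvd)
  finally show ?thesis .
qed

lemma eval_affine:
  assumes G: "xor_linear (s * e) G" and \<rho>: "\<And>j. j < e \<Longrightarrow> \<rho> j = digit w x j"
    and i: "i < e" "\<phi> < 18" and T: "\<And>r. r < N \<Longrightarrow> tab \<phi> r = chunk_table w \<omega> q \<kappa> G r"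
  shows "eval w \<rho> \<mu> (affine_ex e q t \<phi> i) = digit s (\<kappa> XOR G x) i"
proof -
  define v where "v c = digit \<omega> (\<rho> (c div q)) (c mod q)" for c
  have tabv: "tab \<phi> (c * 2 ^ \<omega> + v c) =
      (if c = 0 then \<kappa> else 0) XOR G (v c * 2 ^ (w * (c div q) + \<omega> * (c mod q)))" if c: "c < e * q" for c
  proof -
    have v: "v c < 2 ^ \<omega>" by (simp add: v_def digit_less)
    have "(c + 1) * 2 ^ \<omega> \<le> e * q * 2 ^ \<omega>" using c by (intro mult_right_mono) auto
    then have "c * 2 ^ \<omega> + v c < N" using v room(2) by simp
    moreover have "(c * 2 ^ \<omega> + v c) div 2 ^ \<omega> = c" "(c * 2 ^ \<omega> + v c) mod 2 ^ \<omega> = v c"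
      using v by auto
    ultimately show ?thesis unfolding T[OF \<open>c * 2 ^ \<omega> + v c < N\<close>] chunk_table_def by simp
  qed
  have one: "xor_sum (\<lambda>c. if c = 0 then \<kappa> else 0) (Suc n) = \<kappa>" for n
    by (induction n) auto
  have "0 < e * q" using pos by simp
  then obtain n where n: "e * q = Suc n" by (cases "e * q") auto
  have "eval w \<rho> \<mu> (affine_ex e q t \<phi> i) = xor_sum (\<lambda>c. digit s (tab \<phi> (c * 2 ^ \<omega> + v c)) i) (e * q)"
    unfolding affine_ex_def eval_xor v_def using eval_chunk_cell i by (intro xor_sum_cong) auto
  also have "\<dots> = digit s (xor_sum (\<lambda>c. tab \<phi> (c * 2 ^ \<omega> + v c)) (e * q)) i"
    by (simp add: digit_xor_sum)
  also have "xor_sum (\<lambda>c. tab \<phi> (c * 2 ^ \<omega> + v c)) (e * q) = xor_sum (\<lambda>c. (if c = 0 then \<kappa> else 0) XOR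
      G (v c * 2 ^ (w * (c div q) + \<omega> * (c mod q)))) (e * q)"
    using tabv by (rule xor_sum_cong)
  also have "\<dots> = \<kappa> XOR G x"
    unfolding xor_sum_xor using xor_sum_chunks[OF G \<rho>] one[of n] by (simp add: n v_def)
  finally show ?thesis .
qed

lemma eval_all: "eval w \<rho> \<mu> (all_ex f n) \<noteq> 0 \<longleftrightarrow> (\<forall>i<n. eval w \<rho> \<mu> (f i) \<noteq> 0)"
proof (induction n)
  case 0
  show ?case using sw(3) by simp
next
  case (Suc n)
  then show ?case by (auto simp: less_Suc_eq)
qed

lemma eval_result:
  fixes \<kappa> :: "nat \<Rightarrow> nat" and G :: "nat \<Rightarrow> nat \<Rightarrow> nat"
  assumes G: "\<And>k. k < 5 \<Longrightarrow> xor_linear (s * e) (G k)" and \<rho>: "\<And>j. j < e \<Longrightarrow> \<rho> j = digit w x j"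
    and T: "\<And>k r. k < 5 \<Longrightarrow> r < N \<Longrightarrow> tab (\<phi> + k) r = chunk_table w \<omega> q (\<kappa> k) (G k) r"
    and \<phi>: "\<phi> \<le> 9"
    and g: "\<kappa> 0 XOR G 0 x = g * 2 ^ t" "g * 2 ^ t < 2 ^ (s * e)" "g < N"
    and h: "tab (\<phi> + 5) g XOR (\<kappa> 1 XOR G 1 x) = h * 2 ^ t" "h * 2 ^ t < 2 ^ (s * e)" "h < N"
    and keys: "tab (\<phi> + 6) h < 2 ^ (s * e)" "\<kappa> 2 XOR G 2 x < 2 ^ (s * e)"
    and i: "i < e" and b: "b < 2"
  shows "eval w \<rho> \<mu> (result_ex e q t \<phi> b i) =
    digit s (if tab (\<phi> + 6) h = \<kappa> 2 XOR G 2 x then tab (\<phi> + 7 + b) h else \<kappa> (3 + b) XOR G (3 + b) x) i"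
proof -
  have aff: "eval w \<rho> \<mu> (affine_ex e q t (\<phi> + k) i) = digit s (\<kappa> k XOR G k x) i" if "k < 5" "i < e" for k i
    using that \<phi> by (intro eval_affine[where \<rho> = \<rho>]) (auto intro: G \<rho> T)
  have D: "eval w \<rho> \<mu> (field_ex e (affine_ex e q t \<phi>) (\<phi> + 5) i) = digit s (tab (\<phi> + 5) g) i" if "i < e" for i
    using aff[of 0] that \<phi> g by (intro eval_field[OF refl g(2)]) auto
  have slot: "eval w \<rho> \<mu> (slot_ex e q t \<phi> i) = digit s (h * 2 ^ t) i" if "i < e" for i
    using D[OF that] aff[of 1 i] that by (simp add: slot_ex_def digit_xor flip: h(1))
  have F: "eval w \<rho> \<mu> (field_ex e (slot_ex e q t \<phi>) \<psi> i) = digit s (tab \<psi> h) i" if "i < e" "\<psi> < 18" for i \<psi>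
    using slot that h by (intro eval_field[OF refl h(2)]) auto
  have "eval w \<rho> \<mu> (hit_ex e q t \<phi>) \<noteq> 0 \<longleftrightarrow> (\<forall>i<e. digit s (tab (\<phi> + 6) h) i = digit s (\<kappa> 2 XOR G 2 x) i)"
    unfolding hit_ex_def eval_all using F[of _ "\<phi> + 6"] aff[of 2] \<phi> by auto
  also have "\<dots> \<longleftrightarrow> tab (\<phi> + 6) h = \<kappa> 2 XOR G 2 x"
    using digits_eqI[OF keys] by auto
  finally show ?thesis
    using F[OF i, of "\<phi> + 7 + b"] aff[of "3 + b" i] i b \<phi> by (simp add: result_ex_def add.assoc)
qed

end

section \<open>Memory contents for two dictionaries with affine defaults\<close>

definition lookup :: "(nat \<Rightarrow> nat) \<Rightarrow> nat set \<Rightarrow> (nat \<Rightarrow> nat) \<Rightarrow> nat \<Rightarrow> (nat \<Rightarrow> nat) \<Rightarrow> nat \<Rightarrow> nat" where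
  "lookup \<pi> X val \<kappa> G x = (if \<pi> x \<in> X then val (\<pi> x) else \<kappa> XOR G x)"

text \<open>Arguments outside the dictionary hash to arbitrary slots, so every slot stores its key,
  and comparing it with \<open>\<pi> x\<close> decides between stored value and default.
  \<open>\<pi>\<close> extracts the key from the query; composing it into the hash functions makes
  all five maps affine in the query itself.\<close>

lemma ex_query_tables:
  fixes \<pi> :: "nat \<Rightarrow> nat" and X :: "nat set" and val :: "nat \<Rightarrow> nat \<Rightarrow> nat" and d :: "nat \<Rightarrow> nat"
    and E :: "nat \<Rightarrow> nat \<Rightarrow> nat"
  assumes X: "X \<subseteq> {..<2 ^ P}" "card X \<le> 2 ^ M" and \<pi>: "xor_linear B \<pi>" "\<And>x. \<pi> x < 2 ^ P"
    and E: "\<And>r. r < 2 \<Longrightarrow> xor_linear B (E r)"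
  shows "\<exists>\<kappa> G tab. (\<forall>k<5. xor_linear B (G k)) \<and>
    (\<forall>x. \<exists>g h. g < 2 ^ M \<and> h < 2 ^ Suc M \<and> \<kappa> 0 XOR G 0 x = g * 2 ^ t \<and>
       tab 5 g XOR (\<kappa> 1 XOR G 1 x) = h * 2 ^ t \<and> tab 6 h \<le> 2 ^ P \<and> \<kappa> 2 XOR G 2 x < 2 ^ P \<and>
       (\<forall>r<2. (if tab 6 h = \<kappa> 2 XOR G 2 x then tab (7 + r) h else \<kappa> (3 + r) XOR G (3 + r) x) =
          lookup \<pi> X (val r) (d r) (E r) x))"
proof -
  obtain g f D where gfD: "xor_linear P g" "\<And>x. g x < 2 ^ M" "xor_linear P f" "\<And>x. f x < 2 ^ Suc M"
      "\<And>\<beta>. D \<beta> < 2 ^ Suc M" and inj: "inj_on (\<lambda>x. D (g x) XOR f x) X"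
    using ex_perfect_hash[OF X] by blast
  define slot where "slot x = D (g x) XOR f x" for x
  \<comment> \<open>An empty slot gets the key \<open>2 ^ P\<close>, which \<open>\<pi>\<close>
    never attains, so it is never hit.\<close>
  define key where "key h = (if h \<in> slot ` X then inv_into X slot h else 2 ^ P)" for h
  have keyX: "key (slot z) = z" if "z \<in> X" for z
    using that inv_into_f_f[OF inj that] by (simp add: key_def slot_def[abs_def])
  have key_le: "key h \<le> 2 ^ P" for h
    using X(1) by (auto simp: key_def inv_into_into intro!: less_imp_le) (metis inv_into_into imageI lessThan_iff subsetD)
  have key_notin: "key h \<noteq> z" if "z < 2 ^ P" "z \<notin> X" for h z
    using that by (auto simp: key_def) (metis imageI inv_into_into)
  define \<kappa> where "\<kappa> = (\<lambda>k::nat. if k = 3 then d 0 else if k = 4 then d 1 else 0)"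
  define G where "G = (\<lambda>k::nat. if k = 0 then (\<lambda>x. g (\<pi> x) * 2 ^ t) else if k = 1 then (\<lambda>x. f (\<pi> x) * 2 ^ t)
    else if k = 2 then \<pi> else E (k - 3))"
  define tab where "tab = (\<lambda>k::nat. if k = 5 then (\<lambda>\<beta>. D \<beta> * 2 ^ t) else if k = 6 then key
    else (\<lambda>h. val (k - 7) (key h)))"
  show ?thesis
  proof (rule exI[of _ \<kappa>], rule exI[of _ G], rule exI[of _ tab], intro conjI allI impI)
    fix k :: nat assume k: "k < 5"
    have "xor_linear B (\<lambda>x. g (\<pi> x) * 2 ^ t)" "xor_linear B (\<lambda>x. f (\<pi> x) * 2 ^ t)"
      by (rule xor_linear_mult[OF xor_linear_comp[OF \<pi>(1) gfD(1)]]
          xor_linear_mult[OF xor_linear_comp[OF \<pi>(1) gfD(3)]])+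
    then show "xor_linear B (G k)"
      using \<pi>(1) E[of "k - 3"] k by (simp add: G_def)
  next
    fix x
    have slot_less: "slot (\<pi> x) < 2 ^ Suc M"
      unfolding slot_def by (rule xor_less_two_power[OF gfD(5,4)])
    show "\<exists>ga h. ga < 2 ^ M \<and> h < 2 ^ Suc M \<and> \<kappa> 0 XOR G 0 x = ga * 2 ^ t \<and>
       tab 5 ga XOR (\<kappa> 1 XOR G 1 x) = h * 2 ^ t \<and> tab 6 h \<le> 2 ^ P \<and> \<kappa> 2 XOR G 2 x < 2 ^ P \<and>
       (\<forall>r<2. (if tab 6 h = \<kappa> 2 XOR G 2 x then tab (7 + r) h else \<kappa> (3 + r) XOR G (3 + r) x) =
          lookup \<pi> X (val r) (d r) (E r) x)"
    proof (rule exI[of _ "g (\<pi> x)"], rule exI[of _ "slot (\<pi> x)"], intro conjI allI impI)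
      show "tab 5 (g (\<pi> x)) XOR (\<kappa> 1 XOR G 1 x) = slot (\<pi> x) * 2 ^ t"
        by (simp add: tab_def \<kappa>_def G_def slot_def flip: push_bit_eq_mult)
    next
      fix r :: nat assume r: "r < 2"
      have "key (slot (\<pi> x)) = \<pi> x \<longleftrightarrow> \<pi> x \<in> X"
        using keyX key_notin \<pi>(2) by metis
      then show "(if tab 6 (slot (\<pi> x)) = \<kappa> 2 XOR G 2 x then tab (7 + r) (slot (\<pi> x))
          else \<kappa> (3 + r) XOR G (3 + r) x) = lookup \<pi> X (val r) (d r) (E r) x"
        using r by (auto simp: lookup_def tab_def \<kappa>_def G_def less_2_cases_iff)
    qed (use gfD slot_less key_le \<pi>(2) in \<open>auto simp: tab_def \<kappa>_def G_def\<close>)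
  qed
qed

definition header_cell :: "nat \<Rightarrow> nat" where
  "header_cell s = s * 2 ^ (s div 2) + 2 ^ (s div 2 - 1)"

lemma header_cell_less:
  assumes "16 \<le> s"
  shows "header_cell s < 2 ^ s"
proof -
  define h where "h = s div 2"
  have h: "h + h \<le> s" "s \<le> 2 * h + 1" "h \<ge> 3" using assms by (auto simp: h_def)
  have sh: "s < 2 ^ h" using double_less_two_power[OF h(3)] h(2) by simp
  have "(2 :: nat) ^ (h - 1) < 2 ^ h" using h by (intro power_strict_increasing) auto
  then have "header_cell s < (s + 1) * 2 ^ h" unfolding header_cell_def h_def[symmetric] by simp
  also have "\<dots> \<le> 2 ^ h * 2 ^ h" using sh by (intro mult_right_mono) auto
  also have "\<dots> \<le> 2 ^ s" using h(1) by (simp flip: power_add)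
  finally show ?thesis .
qed

text \<open>Cell 1 tells the program how many cells a number takes. The header fills offsets 0 and 1
  of record 0; skipping these offsets in every record keeps the addresses uniform.\<close>

definition memory_cell :: "nat \<Rightarrow> nat \<Rightarrow> nat \<Rightarrow> nat \<Rightarrow> (nat \<Rightarrow> nat \<Rightarrow> nat) \<Rightarrow> nat \<Rightarrow> nat" where
  "memory_cell s e t N tab z =
     (if z = 0 then header_cell s else if z = 1 then e
      else if z div 2 ^ t < N \<and> 2 \<le> z mod 2 ^ t \<and> z mod 2 ^ t < 2 + 18 * e
      then digit s (tab ((z mod 2 ^ t - 2) div e) (z div 2 ^ t)) ((z mod 2 ^ t - 2) mod e) else 0)"

lemma memory_cell_offset:
  assumes "r < N" "i < e" "\<phi> < 18" "2 + 18 * e \<le> 2 ^ t"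
  shows "memory_cell s e t N tab (r * 2 ^ t + offset e \<phi> i) = digit s (tab \<phi> r) i"
proof -
  define o' where "o' = offset e \<phi> i"
  have "\<phi> * e \<le> 17 * e" using assms(3) by (intro mult_right_mono) auto
  then have "\<phi> * e + i < 18 * e" using assms(2) by linarith
  then have o': "2 \<le> o'" "o' < 2 + 18 * e" "o' - 2 = \<phi> * e + i"
    by (auto simp: o'_def offset_def)
  then have "(r * 2 ^ t + o') div 2 ^ t = r" "(r * 2 ^ t + o') mod 2 ^ t = o'" "r * 2 ^ t + o' \<noteq> 0" "r * 2 ^ t + o' \<noteq> 1"
    using assms(4) by auto
  moreover have "(\<phi> * e + i) div e = \<phi>" "(\<phi> * e + i) mod e = i" using assms(2) by auto
  ultimately show ?thesis
    unfolding o'_def[symmetric] memory_cell_def using o' assms(1) by simp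
qed

text \<open>The index \<open>b\<close> is 0 for encoding and 1 for decoding. All tables share the
  records, so \<open>N\<close> has to reach the larger of the two index ranges.
  \<open>P b < s * e\<close> is strict to make room for the key \<open>2 ^ P b\<close> of the empty
  slots. The nonzero first word distinguishes this memory from an empty one.\<close>

lemma ex_stored_queries:
  fixes \<pi> :: "nat \<Rightarrow> nat \<Rightarrow> nat" and X :: "nat \<Rightarrow> nat set" and val E :: "nat \<Rightarrow> nat \<Rightarrow> nat \<Rightarrow> nat"
    and d :: "nat \<Rightarrow> nat \<Rightarrow> nat" and P :: "nat \<Rightarrow> nat"
  assumes X: "\<And>b. b < 2 \<Longrightarrow> X b \<subseteq> {..<2 ^ P b}" "\<And>b. b < 2 \<Longrightarrow> card (X b) \<le> 2 ^ M"
    and \<pi>: "\<And>b. b < 2 \<Longrightarrow> xor_linear B (\<pi> b)" "\<And>b x. b < 2 \<Longrightarrow> \<pi> b x < 2 ^ P b"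
    and E: "\<And>b r. b < 2 \<Longrightarrow> r < 2 \<Longrightarrow> xor_linear B (E b r)"
    and geometry: "e = 1 \<and> s \<le> w \<or> s = w" and pos: "0 < e" "0 < q" "16 \<le> s" "q \<le> s"
    and room: "e * q * 2 ^ chunk_size q s * 2 ^ t \<le> 2 ^ s"
    and N: "e * q * 2 ^ chunk_size q s \<le> N" "2 ^ Suc M \<le> N"
    and fields: "2 + 18 * e \<le> 2 ^ t"
    and sizes: "M + 1 + t \<le> s * e" "B \<le> s * e" "\<And>b. b < 2 \<Longrightarrow> P b < s * e"
  shows "\<exists>bits. length bits = 2 * s * (N * 2 ^ t) \<and> packed w bits 0 \<noteq> 0 \<and>
    (\<forall>\<rho>. eval w \<rho> (packed w bits) (cell_ex (const_ex 1) []) = e) \<and>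
    (\<forall>\<rho> x b r i. (\<forall>j<e. \<rho> j = digit w x j) \<longrightarrow> b < 2 \<longrightarrow> r < 2 \<longrightarrow> i < e \<longrightarrow>
       eval w \<rho> (packed w bits) (result_ex e q t (9 * b) r i) =
       digit s (lookup (\<pi> b) (X b) (val b r) (d b r) (E b r) x) i)"
proof -
  have "\<exists>\<kappa> G tab. (\<forall>k<5. xor_linear B (G k)) \<and>
    (\<forall>x. \<exists>g h. g < 2 ^ M \<and> h < 2 ^ Suc M \<and> \<kappa> 0 XOR G 0 x = g * 2 ^ t \<and>
       tab 5 g XOR (\<kappa> 1 XOR G 1 x) = h * 2 ^ t \<and> tab 6 h \<le> 2 ^ P b \<and> \<kappa> 2 XOR G 2 x < 2 ^ P b \<and>
       (\<forall>r<2. (if tab 6 h = \<kappa> 2 XOR G 2 x then tab (7 + r) h else \<kappa> (3 + r) XOR G (3 + r) x) =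
          lookup (\<pi> b) (X b) (val b r) (d b r) (E b r) x))" if "b < 2" for b
    by (rule ex_query_tables[where \<pi> = "\<pi> b" and X = "X b" and P = "P b" and val = "val b" and d = "d b" and E = "E b"])
      (use that X \<pi> E in auto)
  then obtain \<kappa> G qtab where Q: "\<And>b k. b < 2 \<Longrightarrow> k < 5 \<Longrightarrow> xor_linear B (G b k)"
    "\<And>b x. b < 2 \<Longrightarrow> \<exists>g h. g < 2 ^ M \<and> h < 2 ^ Suc M \<and> \<kappa> b 0 XOR G b 0 x = g * 2 ^ t \<and>
       qtab b 5 g XOR (\<kappa> b 1 XOR G b 1 x) = h * 2 ^ t \<and> qtab b 6 h \<le> 2 ^ P b \<and> \<kappa> b 2 XOR G b 2 x < 2 ^ P b \<and>
       (\<forall>r<2. (if qtab b 6 h = \<kappa> b 2 XOR G b 2 x then qtab b (7 + r) h else \<kappa> b (3 + r) XOR G b (3 + r) x) =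
          lookup (\<pi> b) (X b) (val b r) (d b r) (E b r) x)"
    by metis
  define \<omega> where "\<omega> = chunk_size q s"
  define tab where "tab \<phi> r = (if \<phi> mod 9 < 5
    then chunk_table w \<omega> q (\<kappa> (\<phi> div 9) (\<phi> mod 9)) (G (\<phi> div 9) (\<phi> mod 9)) r
    else qtab (\<phi> div 9) (\<phi> mod 9) r)" for \<phi> r
  define cells where "cells = memory_cell s e t N tab"
  define bits where "bits = layout w s (N * 2 ^ t) cells"
  have sw: "s \<le> w" "0 < s" using geometry pos by auto
  have t1: "t \<ge> 1"
    using fields by (cases t) auto
  have e: "e < 2 ^ s"
  proof -
    have "e * 1 * 1 * 2 \<le> e * q * 2 ^ \<omega> * 2 ^ t"
      using pos t1 self_le_power[of 2 t] by (intro mult_mono) (auto simp: Suc_le_eq)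
    then show ?thesis using room pos(1) unfolding \<omega>_def by linarith
  qed
  have cells_less: "cells z < 2 ^ s" for z
    using header_cell_less[OF pos(3)] e by (auto simp: cells_def memory_cell_def digit_less)
  have cells_zero: "cells z = 0" if "N * 2 ^ t \<le> z" for z
  proof -
    have "N > 0" using N(2) by (meson less_le_trans zero_less_numeral zero_less_power)
    moreover have "(2 :: nat) ^ t \<ge> 2" using t1 self_le_power[of 2 t] by simp
    ultimately have "1 * 2 \<le> N * 2 ^ t" by (intro mult_mono) auto
    moreover have "N \<le> z div 2 ^ t" using that by (simp add: less_eq_div_iff_mult_less_eq)
    ultimately show ?thesis using that by (simp add: cells_def memory_cell_def)
  qed
  have read: "packed w bits (z div (w div s)) div 2 ^ (z mod (w div s) * s) mod 2 ^ s = cells z" for z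
    using packed_layout[where cells = cells and N = "N * 2 ^ t" and i = "z mod (w div s)" and a = "z div (w div s)",
        OF sw(2,1) cells_less cells_zero, unfolded div_mult_mod_eq] sw
    unfolding bits_def by (simp add: div_greater_zero_iff)
  interpret cell_machine w s e q t N \<omega> cells "packed w bits" tab
  proof (unfold_locales, unfold \<omega>_def)
    show "cells 0 = s * 2 ^ (s div 2) + 2 ^ (s div 2 - 1)"
      by (simp add: cells_def memory_cell_def header_cell_def)
    show "cells (r * 2 ^ t + offset e \<phi> i) = digit s (tab \<phi> r) i" if "r < N" "i < e" "\<phi> < 18" for r \<phi> i
      unfolding cells_def using that fields by (rule memory_cell_offset)
  qed (use geometry pos read room N fields packed_less in auto)
  have bits0: "packed w bits 0 \<noteq> 0"
    using first_word pos(3) by (intro notI) (simp add: header)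
  have "eval w \<rho> (packed w bits) (cell_ex (const_ex 1) []) = e" for \<rho>
  proof -
    have "w > 0" using sw by simp
    then have "eval w \<rho> (packed w bits) (cell_ex (const_ex 1) []) = cells 1"
      by (intro eval_cell_single) simp
    then show ?thesis by (simp add: cells_def memory_cell_def)
  qed
  moreover have "eval w \<rho> (packed w bits) (result_ex e q t (9 * b) r i) =
       digit s (lookup (\<pi> b) (X b) (val b r) (d b r) (E b r) x) i"
    if \<rho>: "\<forall>j<e. \<rho> j = digit w x j" and b: "b < 2" and r: "r < 2" and i: "i < e" for \<rho> x b r i
  proof -
    obtain g h where gh: "g < 2 ^ M" "h < 2 ^ Suc M" "\<kappa> b 0 XOR G b 0 x = g * 2 ^ t"
       "qtab b 5 g XOR (\<kappa> b 1 XOR G b 1 x) = h * 2 ^ t" "qtab b 6 h \<le> 2 ^ P b" "\<kappa> b 2 XOR G b 2 x < 2 ^ P b"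
       "\<And>r. r < 2 \<Longrightarrow> (if qtab b 6 h = \<kappa> b 2 XOR G b 2 x then qtab b (7 + r) h else \<kappa> b (3 + r) XOR G b (3 + r) x) =
          lookup (\<pi> b) (X b) (val b r) (d b r) (E b r) x"
      using Q(2)[OF b, of x] by blast
    have divmod: "(9 * b + k) div 9 = b" "(9 * b + k) mod 9 = k" if "k < 9" for k using that by auto
    have tabq: "tab (9 * b + k) = qtab b k" if "5 \<le> k" "k < 9" for k
      using that by (simp add: tab_def[abs_def])
    have small: "y * 2 ^ t < 2 ^ (s * e)" "y < N" if "y < 2 ^ Suc M" for y
    proof -
      have "y * 2 ^ t < 2 ^ Suc M * 2 ^ t" using that by simp
      also have "\<dots> = 2 ^ (M + 1 + t)" by (simp add: power_add)
      also have "\<dots> \<le> 2 ^ (s * e)" using sizes(1) by (intro power_increasing) auto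
      finally show "y * 2 ^ t < 2 ^ (s * e)" .
      show "y < N" using that N(2) by linarith
    qed
    have P: "(2 :: nat) ^ P b < 2 ^ (s * e)" using sizes(3)[OF b] by simp
    have keys: "qtab b 6 h < 2 ^ (s * e)" "\<kappa> b 2 XOR G b 2 x < 2 ^ (s * e)"
      using gh(5,6) P by linarith+
    have "eval w \<rho> (packed w bits) (result_ex e q t (9 * b) r i) =
      digit s (if tab (9 * b + 6) h = \<kappa> b 2 XOR G b 2 x then tab (9 * b + 7 + r) h
        else \<kappa> b (3 + r) XOR G b (3 + r) x) i"
    proof (rule eval_result[where \<kappa> = "\<kappa> b" and G = "G b" and g = g])
      show "xor_linear (s * e) (G b k)" if "k < 5" for k
        using xor_linear_mono[OF Q(1)[OF b that] sizes(2)] .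
      show "tab (9 * b + k) r' = chunk_table w \<omega> q (\<kappa> b k) (G b k) r'" if "k < 5" for k r'
        using that by (simp add: tab_def)
    qed (use \<rho> b r i gh small[of g] small[of h] keys tabq in auto)
    moreover have "tab (9 * b + 6) h = qtab b 6 h" "tab (9 * b + 7 + r) h = qtab b (7 + r) h"
      using tabq[of 6] tabq[of "7 + r"] r by (auto simp: add.assoc)
    ultimately show ?thesis using gh(7)[OF r] by (simp only:)
  qed
  ultimately show ?thesis
    using bits0 length_layout by (intro exI[of _ bits]) (auto simp: bits_def)
qed

section \<open>The prefix code\<close>

lemma comparable_prefix: "prefix x (y @ z) \<Longrightarrow> prefix x y \<or> prefix y x"
  by (metis prefix_append prefixI prefix_same_cases)

text \<open>If some codeword is longer than \<open>m\<close>, its prefix \<open>v\<close> of length \<open>r\<close> becomes the root of a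
  fixed-length code for all symbols with long codewords. The short codewords below \<open>v\<close> make room for it
  with one additional bit. As they are longer than \<open>r\<close>, this multiplies their length by at most
  \<open>1 + 1 / (r + 1)\<close>.\<close>

lemma ex_short_and_fixed_length_code:
  fixes c :: real
  assumes oc: "prefix_code n oc" and n: "n \<le> 2 ^ L" and r: "r \<le> m" "real r + 2 \<le> c * (real r + 1)"
    and m: "real (r + 1 + L) \<le> c * (real m + 1)" and c: "1 \<le> c"
  shows "\<exists>code S u. prefix_code n code \<and> S \<subseteq> {..<n} \<and> length u = r + 1 \<and>
    (\<forall>i\<in>S. length (code i) \<le> m + 1) \<and> (\<forall>i<n. i \<notin> S \<longrightarrow> code i = u @ map (bit i) [0..<L]) \<and>
    (\<forall>i<n. real (length (code i)) \<le> c * real (length (oc i)))"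
proof (cases "\<exists>i<n. length (oc i) > m")
  case False
  have "real (length (oc i)) \<le> c * real (length (oc i))" for i
    using c mult_right_mono[of 1 c "real (length (oc i))"] by simp
  \<comment> \<open>Without long codewords the optimal code itself serves, and \<open>u\<close> is
    any string of the right length.\<close>
  then show ?thesis using False oc
    by (intro exI[of _ oc] exI[of _ "{..<n}"] exI[of _ "replicate (r + 1) True"]) auto
next
  case True
  then obtain i0 where i0: "i0 < n" "length (oc i0) > m" by blast
  define v where "v = take r (oc i0)"
  have lv: "length v = r" using i0 r by (simp add: v_def)
  have pv: "prefix v (oc i0)" by (simp add: v_def take_is_prefix)
  define B where "B i = map (bit i) [0..<L]" for i :: nat
  define code where "code i = (if length (oc i) > m then v @ [False] @ B i
    else if prefix v (oc i) then v @ [True] @ drop r (oc i) else oc i)" for i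
  define S where "S = {i. i < n \<and> length (oc i) \<le> m}"
  have inc: "\<not> prefix (oc i) (oc j)" if "i < n" "j < n" "i \<noteq> j" for i j
    using oc that by (auto simp: prefix_code_def)
  have Binj: "i = j" if "i < n" "j < n" "B i = B j" for i j
  proof -
    have "bit i k = bit j k" if "k < L" for k
      using \<open>B i = B j\<close> that by (auto simp: B_def)
    then have "take_bit L i = take_bit L j" by (auto intro!: bit_eqI simp: bit_take_bit_iff)
    then show ?thesis using that n by (simp add: take_bit_nat_eq_self)
  qed
  have under: "oc i = v @ drop r (oc i)" if "prefix v (oc i)" for i
    using that lv by (metis append_eq_conv_conj prefix_def)
  \<comment> \<open>Otherwise \<open>oc i\<close> would be a prefix of the longer codeword
    \<open>oc i0\<close>. So no short codeword ends on the path to \<open>v\<close>, and those below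
    \<open>v\<close> are strictly longer than \<open>r\<close>.\<close>
  have other: "\<not> prefix (oc i) v" if "i < n" "length (oc i) \<le> m" for i
    using inc[OF that(1) i0(1)] that i0 pv by (metis not_le prefix_order.trans)
  have "\<not> prefix (code i) (code j)" if i: "i < n" and j: "j < n" and ij: "i \<noteq> j" for i j
  proof
    assume p: "prefix (code i) (code j)"
    consider (L) "length (oc i) > m" | (U) "length (oc i) \<le> m" "prefix v (oc i)"
      | (O) "length (oc i) \<le> m" "\<not> prefix v (oc i)" by linarith
    then show False
    proof cases
      case L
      then have ci: "code i = v @ [False] @ B i" by (simp add: code_def)
      then have "prefix v (code j)" using p by (metis append_prefixD)
      then have "length (oc j) > m"
        using p ci by (cases "prefix v (oc j)") (auto simp: code_def split: if_splits)
      then have "prefix (B i) (B j)" using p ci by (simp add: code_def)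
      then obtain zs where zs: "B j = B i @ zs" by (auto simp: prefix_def)
      then have "length (B j) = length (B i) + length zs" by simp
      then have "length zs = 0" by (simp add: B_def)
      then have "B i = B j" using zs by simp
      then show False using Binj i j ij by blast
    next
      case U
      then have ci: "code i = v @ [True] @ drop r (oc i)" by (simp add: code_def)
      then have "prefix v (code j)" using p by (metis append_prefixD)
      then have "length (oc j) \<le> m \<and> prefix v (oc j)"
        using p ci by (cases "prefix v (oc j)") (auto simp: code_def split: if_splits)
      then have "prefix (drop r (oc i)) (drop r (oc j))" using p ci by (simp add: code_def)
      then have "prefix (oc i) (oc j)"
        using under U \<open>length (oc j) \<le> m \<and> _\<close> by (metis same_prefix_prefix)
      then show False using inc i j ij by blast
    next
      case O
      then have ci: "code i = oc i" by (simp add: code_def)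
      show False
      proof (cases "length (oc j) > m \<or> prefix v (oc j)")
        case True
        then have "prefix v (code j)" by (auto simp: code_def)
        then obtain z where "code j = v @ z" by (auto simp: prefix_def)
        then have "prefix (oc i) v \<or> prefix v (oc i)" using p ci comparable_prefix by metis
        then show False using other[OF i O(1)] O(2) by blast
      next
        case False
        then have "code j = oc j" by (simp add: code_def)
        then show False using p ci inc i j ij by simp
      qed
    qed
  qed
  then have pc: "prefix_code n code" by (simp add: prefix_code_def)
  have len: "real (length (code i)) \<le> c * real (length (oc i))" if i: "i < n" for i
  proof -
    consider (L) "length (oc i) > m" | (U) "length (oc i) \<le> m" "prefix v (oc i)"
      | (O) "length (oc i) \<le> m" "\<not> prefix v (oc i)" by linarith
    then show ?thesis
    proof cases
      case L
      then have "real (length (code i)) = real (r + 1 + L)" by (simp add: code_def lv B_def)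
      also have "\<dots> \<le> c * (real m + 1)" by (rule m)
      also have "\<dots> \<le> c * real (length (oc i))" using L c by (intro mult_left_mono) auto
      finally show ?thesis .
    next
      case U
      have "length (oc i) \<ge> r" using under[OF U(2)] lv by (metis length_append le_add1)
      moreover have "length (oc i) \<noteq> r"
        using under[OF U(2)] other[OF i U(1)] by (metis append_Nil2 drop_all order_refl prefix_order.refl)
      ultimately have l: "length (oc i) \<ge> r + 1" by simp
      have "length (code i) = length (oc i) + 1" using U l by (simp add: code_def lv)
      moreover have "1 \<le> (c - 1) * real (length (oc i))"
      proof -
        have "1 \<le> (c - 1) * (real r + 1)" using r(2) by (simp add: algebra_simps)
        also have "\<dots> \<le> (c - 1) * real (length (oc i))" using l c by (intro mult_left_mono) auto
        finally show ?thesis .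
      qed
      ultimately show ?thesis by (simp add: algebra_simps)
    next
      case O
      then show ?thesis
        using c mult_right_mono[of 1 c "real (length (oc i))"] by (simp add: code_def)
    qed
  qed
  have "length (code i) \<le> m + 1" if "i \<in> S" for i
  proof (cases "prefix v (oc i)")
    case True
    then have "r \<le> length (oc i)" using lv prefix_length_le by blast
    then show ?thesis using that True by (auto simp: code_def S_def lv)
  qed (use that in \<open>auto simp: code_def S_def\<close>)
  moreover have "code i = (v @ [False]) @ map (bit i) [0..<L]" if "i < n" "i \<notin> S" for i
    using that by (auto simp: code_def S_def B_def)
  moreover have "length (v @ [False]) = r + 1" by (simp add: lv)
  ultimately show ?thesis using pc len
    by (intro exI[of _ code] exI[of _ S] exI[of _ "v @ [False]"]) (auto simp: S_def)
qed

definition matches :: "bool list \<Rightarrow> nat \<Rightarrow> bool" where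
  "matches bs x \<longleftrightarrow> (\<forall>k<length bs. bit x k = bs ! k)"

lemma matches_bits_val: "matches bs (bits_val bs)"
  by (simp add: matches_def bits_val_bit)

lemma matches_take:
  assumes "length bs \<le> B"
  shows "matches bs (x mod 2 ^ B) \<longleftrightarrow> matches bs x"
  using assms by (auto simp: matches_def bit_take_bit_iff simp flip: take_bit_eq_mod)

text \<open>Two codewords that match \<open>x\<close> are initial segments of the same bit sequence,
  so one is a prefix of the other.\<close>

lemma prefix_code_matches_unique:
  assumes "prefix_code n code" "i < n" "j < n" "matches (code i) x" "matches (code j) x"
  shows "i = j"
proof -
  have eq: "bs = map (bit x) [0..<length bs]" if "matches bs x" for bs
    using that by (auto simp: matches_def intro!: nth_equalityI)
  have "prefix (map (bit x) [0..<a]) (map (bit x) [0..<b])" if "a \<le> b" for a b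
    using that by (metis le_Suc_ex map_mono_prefix prefixI upt_add_eq_append zero_le)
  then have "prefix (code i) (code j) \<or> prefix (code j) (code i)"
    using eq[OF assms(4)] eq[OF assms(5)] by (metis nat_le_linear)
  then show ?thesis using assms(1-3) by (auto simp: prefix_code_def)
qed

text \<open>For encoding, the keys are the symbols in \<open>S\<close>. For decoding, they are all
  strings of \<open>m\<close> bits that begin with a short codeword, since the end of the codeword
  is not known before the lookup; there are still at most \<open>2 ^ m\<close> of them. The defaults
  are inverse to each other: encoding shifts the symbol past \<open>u\<close>, decoding extracts the
  \<open>L\<close> bits after \<open>u\<close>.\<close>

lemma ex_code_queries:
  assumes code: "prefix_code n code" and n: "n \<le> 2 ^ L" and "S \<subseteq> {..<n}" "\<forall>i\<in>S. length (code i) \<le> m"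
    and "\<forall>i<n. i \<notin> S \<longrightarrow> code i = u @ map (bit i) [0..<L]"
    and B: "length u + L \<le> B" "m \<le> B"
  shows "\<exists>(\<pi> :: nat \<Rightarrow> nat \<Rightarrow> nat) (X :: nat \<Rightarrow> nat set) (val :: nat \<Rightarrow> nat \<Rightarrow> nat \<Rightarrow> nat)
      (d :: nat \<Rightarrow> nat \<Rightarrow> nat) (E :: nat \<Rightarrow> nat \<Rightarrow> nat \<Rightarrow> nat).
    (\<forall>b<2. X b \<subseteq> {..<2 ^ (if b = 0 then L else m)} \<and> card (X b) \<le> 2 ^ m \<and> xor_linear B (\<pi> b) \<and>
       (\<forall>x. \<pi> b x < 2 ^ (if b = 0 then L else m)) \<and> (\<forall>r<2. xor_linear B (E b r))) \<and>
    (\<forall>i<n. lookup (\<pi> 0) (X 0) (val 0 0) (d 0 0) (E 0 0) i = bits_val (code i) \<and>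
       lookup (\<pi> 0) (X 0) (val 0 1) (d 0 1) (E 0 1) i = length (code i)) \<and>
    (\<forall>i<n. \<forall>x. matches (code i) x \<longrightarrow> lookup (\<pi> 1) (X 1) (val 1 0) (d 1 0) (E 1 0) x = i \<and>
       lookup (\<pi> 1) (X 1) (val 1 1) (d 1 1) (E 1 1) x = length (code i))"
proof -
  have S: "S \<subseteq> {..<n}" "\<And>i. i \<in> S \<Longrightarrow> length (code i) \<le> m"
    and long: "\<And>i. i < n \<Longrightarrow> i \<notin> S \<Longrightarrow> code i = u @ map (bit i) [0..<L]"
    using assms(3-5) by auto
  define a where "a = length u"
  define \<pi> where "\<pi> b x = x mod 2 ^ B mod 2 ^ (if b = 0 then L else m)" for b x :: nat
  define X where "X b = (if b = 0 then S else {x. x < 2 ^ m \<and> (\<exists>i\<in>S. matches (code i) x)})" for b :: nat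
  define sym where "sym b x = (if b = 0 then x else (THE i. i \<in> S \<and> matches (code i) x))" for b x :: nat
  define val where "val b r x = (if r = 1 then length (code (sym b x)) else if b = 0 then bits_val (code x) else sym b x)"
    for b r x :: nat
  define d where "d b r = (if r = 1 then a + L else if b = 0 then bits_val u else 0)" for b r :: nat
  define E where "E b r = (if r = 1 then (\<lambda>x. 0) else if b = 0 then (\<lambda>x. x mod 2 ^ B mod 2 ^ L * 2 ^ a)
    else (\<lambda>x. x mod 2 ^ B div 2 ^ a mod 2 ^ L :: nat))" for b r :: nat
  have finS: "finite S" using S(1) finite_subset by blast
  \<comment> \<open>Packing does not identify codewords of different lengths: a value matches its
    own codeword and, by prefix-freeness, no other.\<close>
  have "inj_on (\<lambda>i. bits_val (code i)) S"
    using prefix_code_matches_unique[OF code] matches_bits_val S(1)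
    by (intro inj_onI) (metis lessThan_iff subsetD)
  moreover have "(\<lambda>i. bits_val (code i)) ` S \<subseteq> {..<2 ^ m}"
  proof
    fix y assume "y \<in> (\<lambda>i. bits_val (code i)) ` S"
    then obtain i where i: "i \<in> S" "y = bits_val (code i)" by blast
    have "y < 2 ^ length (code i)" using i bits_val_less by simp
    also have "\<dots> \<le> 2 ^ m" using S(2)[OF i(1)] by (intro power_increasing) auto
    finally show "y \<in> {..<2 ^ m}" by simp
  qed
  ultimately have "card S \<le> card {..<2 ^ m :: nat}"
    by (intro card_inj_on_le) auto
  then have cardS: "card S \<le> 2 ^ m" by simp
  have X: "X b \<subseteq> {..<2 ^ (if b = 0 then L else m)}" "card (X b) \<le> 2 ^ m" for b
  proof -
    show 1: "X b \<subseteq> {..<2 ^ (if b = 0 then L else m)}"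
      using S(1) n by (auto simp: X_def)
    show "card (X b) \<le> 2 ^ m"
    proof (cases "b = 0")
      case False
      then have "card (X b) \<le> card {..<2 ^ m :: nat}" using 1 by (intro card_mono) auto
      then show ?thesis by simp
    qed (simp add: X_def cardS)
  qed
  have lin: "xor_linear B (\<pi> b)" for b
    unfolding \<pi>_def[abs_def] by (intro xor_linear_mod_comp xor_linear_mod)
  have "xor_linear B (\<lambda>x. x mod 2 ^ B mod 2 ^ L * 2 ^ a)" "xor_linear B (\<lambda>x. x mod 2 ^ B div 2 ^ a mod 2 ^ L)"
    by (rule xor_linear_mult xor_linear_mod_comp xor_linear_div xor_linear_mod)+
  then have linE: "xor_linear B (E b r)" for b r
    by (simp add: E_def xor_linear_zero)
  have enc: "lookup (\<pi> 0) (X 0) (val 0 0) (d 0 0) (E 0 0) i = bits_val (code i)"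
    "lookup (\<pi> 0) (X 0) (val 0 1) (d 0 1) (E 0 1) i = length (code i)" if i: "i < n" for i
  proof -
    have "(2 :: nat) ^ L \<le> 2 ^ B" using B by (intro power_increasing) auto
    then have "i < 2 ^ B" "i < 2 ^ L" using i n by linarith+
    then have mods: "i mod 2 ^ B = i" "i mod 2 ^ L = i" by auto
    then have "\<pi> 0 i = i" by (simp add: \<pi>_def)
    moreover have "bits_val u XOR i * 2 ^ a = bits_val (code i)" if "i \<notin> S"
    proof (rule bit_eqI)
      fix k
      show "bit (bits_val u XOR i * 2 ^ a) k = bit (bits_val (code i)) k"
      proof (cases "k < a + L")
        case True
        then show ?thesis unfolding long[OF i that]
          by (auto simp: bit_xor_iff bits_val_bit nth_append a_def bit_push_bit_iff simp flip: push_bit_eq_mult)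
      next
        case False
        have "\<not> bit i (k - a)"
          using mods(2) False by (metis bit_take_bit_iff diff_add_inverse le_diff_conv2 not_less take_bit_eq_mod trans_le_add1 add.commute le_diff_conv)
        then show ?thesis using False unfolding long[OF i that]
          by (auto simp: bit_xor_iff bits_val_bit a_def bit_push_bit_iff simp flip: push_bit_eq_mult)
      qed
    qed
    moreover have "length (code i) = a + L" if "i \<notin> S" using long[OF i that] by (simp add: a_def)
    ultimately show "lookup (\<pi> 0) (X 0) (val 0 0) (d 0 0) (E 0 0) i = bits_val (code i)"
      "lookup (\<pi> 0) (X 0) (val 0 1) (d 0 1) (E 0 1) i = length (code i)"
      by (auto simp: lookup_def X_def val_def d_def E_def sym_def mods)
  qed
  have dec: "lookup (\<pi> 1) (X 1) (val 1 0) (d 1 0) (E 1 0) x = i"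
    "lookup (\<pi> 1) (X 1) (val 1 1) (d 1 1) (E 1 1) x = length (code i)"
    if i: "i < n" and x: "matches (code i) x" for i x
  proof -
    have \<pi>x: "\<pi> 1 x = x mod 2 ^ m" using B by (simp add: \<pi>_def mod_mod_cancel le_imp_power_dvd)
    have uniq: "j = i" if "j \<in> S" "matches (code j) (x mod 2 ^ m)" for j
      using prefix_code_matches_unique[OF code _ i _ x, of j] that S matches_take[of "code j" m x] by auto
    have "lookup (\<pi> 1) (X 1) (val 1 0) (d 1 0) (E 1 0) x = i \<and>
      lookup (\<pi> 1) (X 1) (val 1 1) (d 1 1) (E 1 1) x = length (code i)"
    proof (cases "i \<in> S")
      case True
      then have mt: "matches (code i) (x mod 2 ^ m)" using x S(2) matches_take by blast
      then have "x mod 2 ^ m \<in> X 1" using True by (auto simp: X_def)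
      moreover have "(THE j. j \<in> S \<and> matches (code j) (x mod 2 ^ m)) = i"
      proof (rule the_equality)
        show "i \<in> S \<and> matches (code i) (x mod 2 ^ m)" using True mt ..
        show "j = i" if "j \<in> S \<and> matches (code j) (x mod 2 ^ m)" for j using uniq that by blast
      qed
      then have "sym 1 (x mod 2 ^ m) = i" by (simp add: sym_def)
      moreover
      have "val 1 0 y = sym 1 y" "val 1 1 y = length (code (sym 1 y))" for y
        by (simp_all add: val_def)
      ultimately show ?thesis unfolding lookup_def \<pi>x by simp
    next
      case False
      then have notin: "x mod 2 ^ m \<notin> X 1" using uniq by (auto simp: X_def)
      have "x mod 2 ^ B div 2 ^ a mod 2 ^ L = i"
      proof -
        have iL: "take_bit L i = i" using i n by (simp add: take_bit_nat_eq_self)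
        have "take_bit L (drop_bit a (take_bit B x)) = take_bit L i"
        proof (rule bit_eqI)
          fix k
          show "bit (take_bit L (drop_bit a (take_bit B x))) k = bit (take_bit L i) k"
          proof (cases "k < L")
            case True
            then have "bit x (a + k) = code i ! (a + k)"
              using x long[OF i False] by (simp add: matches_def a_def)
            also have "\<dots> = bit i k" using True long[OF i False] by (simp add: nth_append a_def)
            finally show ?thesis using True B(1)
              by (auto simp: bit_take_bit_iff bit_drop_bit_eq a_def)
          qed (simp add: bit_take_bit_iff)
        qed
        then show ?thesis using iL by (simp add: take_bit_eq_mod drop_bit_eq_div)
      qed
      moreover have "length (code i) = a + L" using long[OF i False] by (simp add: a_def)
      moreover have "d 1 0 XOR E 1 0 x = x mod 2 ^ B div 2 ^ a mod 2 ^ L" "d 1 1 XOR E 1 1 x = a + L"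
        by (simp_all add: d_def E_def)
      ultimately show ?thesis using notin unfolding lookup_def \<pi>x by simp
    qed
    then show "lookup (\<pi> 1) (X 1) (val 1 0) (d 1 0) (E 1 0) x = i"
      "lookup (\<pi> 1) (X 1) (val 1 1) (d 1 1) (E 1 1) x = length (code i)" by auto
  qed
  have "\<pi> b x < 2 ^ (if b = 0 then L else m)" for b x by (simp add: \<pi>_def)
  note facts = X lin this linE enc dec
  show ?thesis
    by (rule exI[of _ \<pi>], rule exI[of _ X], rule exI[of _ val], rule exI[of _ d], rule exI[of _ E])
      (intro conjI allI impI; (rule facts; assumption?))
qed

section \<open>Choice of the parameters\<close>

text \<open>A function of \<open>e\<close> alone, because the programs contain it as a constant,
  once for each possible \<open>e\<close>.\<close>

definition record_bits :: "nat \<Rightarrow> nat" where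
  "record_bits e = (LEAST t. 2 + 18 * e \<le> 2 ^ t)"

lemma record_bits:
  assumes "0 < e"
  shows "2 + 18 * e \<le> 2 ^ record_bits e" "2 ^ record_bits e \<le> 40 * e"
proof -
  have "2 + 18 * e \<le> 2 ^ (2 + 18 * e)" using less_exp less_imp_le by blast
  then show 1: "2 + 18 * e \<le> 2 ^ record_bits e"
    unfolding record_bits_def by (rule LeastI)
  obtain t where t: "record_bits e = Suc t"
    using 1 by (cases "record_bits e") auto
  then have "\<not> 2 + 18 * e \<le> 2 ^ t"
    unfolding record_bits_def using not_less_Least[of t "\<lambda>t. 2 + 18 * e \<le> 2 ^ t"] by simp
  then show "2 ^ record_bits e \<le> 40 * e" using assms t by simp
qed

lemma record_bits_1: "record_bits 1 \<le> 5"
proof -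
  have "(2 :: nat) ^ record_bits 1 < 2 ^ 6" using record_bits(2)[of 1] by simp
  then show ?thesis by (subst (asm) power_strict_increasing_iff) auto
qed

lemma chunk_size_le: "0 < q \<Longrightarrow> chunk_size q s \<le> s div q + 1"
proof -
  assume q: "0 < q"
  have "(s + (q - 1)) div q \<le> (s + q) div q" by (rule div_le_mono) simp
  then show ?thesis using q by (simp add: chunk_size_def)
qed

text \<open>With at least two chunks, the chunk size is at most \<open>s div 2 + 1\<close>, which
  leaves \<open>K\<close> bits for the remaining factors.\<close>

lemma chunk_room:
  assumes "2 \<le> q" "e * q * 2 ^ t \<le> 2 ^ K" "2 * K + 2 \<le> s"
  shows "e * q * 2 ^ chunk_size q s * 2 ^ t \<le> 2 ^ s"
proof -
  have "s div q \<le> s div 2" using assms(1) by (simp add: div_le_mono2)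
  then have \<omega>: "chunk_size q s \<le> s div 2 + 1" using chunk_size_le[of q s] assms(1) by linarith
  have "e * q * 2 ^ chunk_size q s * 2 ^ t = e * q * 2 ^ t * 2 ^ chunk_size q s" by simp
  also have "\<dots> \<le> 2 ^ K * 2 ^ (s div 2 + 1)" using assms(2) \<omega> by (intro mult_mono power_increasing) auto
  also have "\<dots> = 2 ^ (K + (s div 2 + 1))" by (simp add: power_add)
  also have "\<dots> \<le> 2 ^ s" using assms(3) by (intro power_increasing) auto
  finally show ?thesis .
qed

lemma ex_log:
  fixes n :: nat
  assumes "2 \<le> n"
  shows "\<exists>L. 1 \<le> L \<and> n \<le> 2 ^ L \<and> 2 ^ L \<le> 2 * n \<and> real L \<le> 2 * log 2 n"
proof -
  define L where "L = (LEAST L. n \<le> 2 ^ L)"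
  have "n \<le> 2 ^ n" using less_exp less_imp_le by blast
  then have 1: "n \<le> 2 ^ L" unfolding L_def by (rule LeastI)
  then obtain l where l: "L = Suc l" using assms by (cases L) auto
  have "\<not> n \<le> 2 ^ l" using not_less_Least[of l "\<lambda>L. n \<le> 2 ^ L"] l by (simp add: L_def)
  then have 2: "2 ^ L \<le> 2 * n" using l by simp
  have "log 2 (2 ^ l) \<le> log 2 (real n)"
  proof -
    have "(2 :: nat) ^ l \<le> n" using \<open>\<not> n \<le> 2 ^ l\<close> by simp
    then have "(2 :: real) ^ l \<le> real n" by (metis of_nat_le_iff of_nat_numeral of_nat_power)
    then show ?thesis using assms by (subst log_le_cancel_iff) auto
  qed
  then have "real l \<le> log 2 n" by (simp add: log_nat_power)
  moreover have "log 2 2 \<le> log 2 (real n)" using assms by (subst log_le_cancel_iff) auto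
  ultimately have "real L \<le> 2 * log 2 n" using l by simp
  then show ?thesis using 1 2 l by (intro exI[of _ L]) auto
qed

locale approximation_ratio =
  fixes c :: real
  assumes c: "1 < c"
begin

text \<open>This gives \<open>1 / (root_depth + 1) \<le> c - 1\<close>, so one more bit on a
  codeword longer than \<open>root_depth\<close> costs a factor of at most \<open>c\<close>.\<close>

definition root_depth :: nat where "root_depth = nat \<lceil>1 / (c - 1)\<rceil>"
definition bits_factor :: nat where "bits_factor = 3 * root_depth + 9"
text \<open>Cells have at most about \<open>bits_factor * L\<close> bits, so chunks have at most
  about \<open>L / (2 * c)\<close>, and a chunk table has order \<open>n powr (1 / (2 * c))\<close>
  rows.\<close>

definition chunk_count :: nat where "chunk_count = nat \<lceil>2 * c * bits_factor\<rceil>"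
definition size_slack :: nat where "size_slack = 2 * chunk_count + 16"
text \<open>The quotient makes the new long codewords, of length \<open>root_depth + 1 + L\<close>,
  at most \<open>c\<close> times as long as codewords beyond this depth; the second summand
  guarantees that the latter reach depth \<open>root_depth\<close>.\<close>

definition short_length :: "nat \<Rightarrow> nat" where "short_length L = nat \<lceil>(root_depth + 1 + L) / c\<rceil> + root_depth"
text \<open>Enough bits for symbols, codewords, codeword lengths, keys and slot numbers
  alike.\<close>

definition bits_bound :: "nat \<Rightarrow> nat" where "bits_bound L = 2 * L + 3 * root_depth + 7"
text \<open>The 5 is for \<open>record_bits 1\<close>, and \<open>size_slack\<close> meets the
  condition of \<open>chunk_room\<close> with \<open>K = chunk_count + 5\<close>.\<close>

definition max_cell_size :: "nat \<Rightarrow> nat" where "max_cell_size L = bits_bound L + 5 + size_slack"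
definition max_words :: "real \<Rightarrow> nat" where "max_words \<kappa> = nat \<lceil>2 * bits_factor / \<kappa>\<rceil> + 2"
text \<open>The product bounds \<open>e * chunk_count * 2 ^ record_bits e\<close> for
  \<open>e \<le> max_words \<kappa>\<close>. Twice this plus 16 is what \<open>chunk_room\<close>
  and the header demand of a cell that is a whole word; shorter words are left to
  tabulation.\<close>

definition min_word_size :: "real \<Rightarrow> nat" where
  "min_word_size \<kappa> = 2 * (max_words \<kappa> * chunk_count * (40 * max_words \<kappa>)) + 16"

lemma root_depth: "real root_depth + 2 \<le> c * (real root_depth + 1)"
proof -
  have "1 / (c - 1) \<le> real root_depth" unfolding root_depth_def by linarith
  then have "1 \<le> real root_depth * (c - 1)" using c by (simp add: pos_divide_le_eq)
  then show ?thesis using c by (simp add: algebra_simps)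
qed

lemma chunk_count: "2 * c * bits_factor \<le> real chunk_count" "2 \<le> chunk_count"
proof -
  show 1: "2 * c * bits_factor \<le> real chunk_count" unfolding chunk_count_def by linarith
  have "2 * 1 * 9 \<le> 2 * c * real bits_factor" using c by (intro mult_mono) (auto simp: bits_factor_def)
  then show "2 \<le> chunk_count" using 1 by linarith
qed

lemma short_length:
  shows "root_depth \<le> short_length L" "real (root_depth + 1 + L) \<le> c * (real (short_length L) + 1)"
    and "real (short_length L) \<le> real L / c + 2 * root_depth + 2" "short_length L \<le> L + 2 * root_depth + 2"
proof -
  show "root_depth \<le> short_length L" by (simp add: short_length_def)
  have "(root_depth + 1 + L) / c \<le> real (short_length L) + 1" unfolding short_length_def by linarith
  then show "real (root_depth + 1 + L) \<le> c * (real (short_length L) + 1)"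
    using c by (simp add: pos_divide_le_eq mult.commute)
  have "real (short_length L) \<le> (root_depth + 1 + L) / c + 1 + root_depth"
  proof -
    have "0 \<le> (root_depth + 1 + L) / c" using c by simp
    then show ?thesis unfolding short_length_def by linarith
  qed
  moreover have "(root_depth + 1) / c \<le> (root_depth + 1) / 1" using c by (intro divide_left_mono) auto
  ultimately show 1: "real (short_length L) \<le> real L / c + 2 * root_depth + 2"
    by (simp add: add_divide_distrib)
  have "real L / c \<le> real L / 1" using c by (intro divide_left_mono) auto
  then have "real (short_length L) \<le> real (L + 2 * root_depth + 2)" using 1 by simp
  then show "short_length L \<le> L + 2 * root_depth + 2" by (simp only: of_nat_le_iff)
qed

lemma bits_bound_le: "1 \<le> L \<Longrightarrow> bits_bound L \<le> bits_factor * L"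
proof -
  assume "1 \<le> L"
  then have "(3 * root_depth + 7) * 1 \<le> (3 * root_depth + 7) * L" by (intro mult_left_mono) auto
  then show ?thesis by (simp add: bits_bound_def bits_factor_def algebra_simps)
qed

lemma max_cell_size_le: "1 \<le> L \<Longrightarrow> max_cell_size L \<le> (bits_factor + 5 + size_slack) * L"
proof -
  assume L: "1 \<le> L"
  then have "(5 + size_slack) * 1 \<le> (5 + size_slack) * L" by (intro mult_left_mono) auto
  then show ?thesis using bits_bound_le[OF L] by (simp add: max_cell_size_def algebra_simps)
qed

text \<open>The bounds on \<open>e\<close> serve different purposes:
  \<open>max_words \<kappa>\<close> limits the case distinction in the program, while the bounds in
  terms of \<open>max_cell_size L\<close> are free of \<open>\<kappa>\<close>, and so will be the
  space constant. Long words get cells of \<open>max_cell_size L\<close> bits, not of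
  \<open>w\<close> bits, since the space must not grow with \<open>w\<close>.\<close>

lemma ex_geometry:
  assumes \<kappa>: "0 < \<kappa>" and n: "2 \<le> n" and w: "real w \<ge> \<kappa> * log 2 (real n)" "min_word_size \<kappa> \<le> w"
    and L: "1 \<le> L" "real L \<le> 2 * log 2 n"
  shows "\<exists>s e. (e = 1 \<and> s \<le> w \<or> s = w) \<and> 0 < e \<and> e \<le> max_words \<kappa> \<and> 16 \<le> s \<and> chunk_count \<le> s \<and> s \<le> max_cell_size L \<and>
    e * chunk_count * 2 ^ chunk_size chunk_count s * 2 ^ record_bits e \<le> 2 ^ s \<and> bits_bound L + record_bits e \<le> s * e \<and>
    s * e \<le> 3 * max_cell_size L \<and> e \<le> max_cell_size L"
proof (cases "max_cell_size L \<le> w")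
  case True
  have "1 * chunk_count * 2 ^ record_bits 1 \<le> 2 ^ chunk_count * 2 ^ 5"
    using less_exp[of chunk_count] record_bits_1 by (intro mult_mono power_increasing) auto
  also have "\<dots> = 2 ^ (chunk_count + 5)" by (simp add: power_add)
  finally have "1 * chunk_count * 2 ^ chunk_size chunk_count (max_cell_size L) * 2 ^ record_bits 1 \<le> 2 ^ max_cell_size L"
    by (intro chunk_room[OF chunk_count(2)]) (auto simp: max_cell_size_def size_slack_def)
  then show ?thesis using True record_bits_1
    by (intro exI[of _ "max_cell_size L"] exI[of _ 1]) (auto simp: max_words_def max_cell_size_def size_slack_def)
next
  case False
  \<comment> \<open>One additional word is for rounding up, the other for the factor
    \<open>2 ^ record_bits e\<close> in stored addresses.\<close>
  define e where "e = bits_bound L div w + 2"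
  define K where "K = max_words \<kappa> * chunk_count * (40 * max_words \<kappa>)"
  have w16: "2 * K + 16 \<le> w" using w(2) by (simp add: min_word_size_def K_def)
  have "real (bits_bound L) \<le> 2 * bits_factor / \<kappa> * real w"
  proof -
    have "real (bits_bound L) \<le> real (bits_factor * L)" using bits_bound_le[OF L(1)] by (simp only: of_nat_le_iff)
    also have "\<dots> \<le> real bits_factor * (2 * log 2 n)" using L(2) by (simp add: mult_left_mono)
    also have "\<dots> = 2 * bits_factor / \<kappa> * (\<kappa> * log 2 n)" using \<kappa> by simp
    also have "\<dots> \<le> 2 * bits_factor / \<kappa> * real w" using w(1) \<kappa> by (intro mult_left_mono) auto
    finally show ?thesis .
  qed
  then have "real (bits_bound L) / real w \<le> 2 * bits_factor / \<kappa>"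
    using w16 by (simp add: divide_le_eq)
  moreover have "real (bits_bound L div w) \<le> real (bits_bound L) / real w" by (rule of_nat_div_le_of_nat)
  ultimately have "real (bits_bound L div w) \<le> 2 * bits_factor / \<kappa>" by linarith
  then have "bits_bound L div w \<le> nat \<lceil>2 * bits_factor / \<kappa>\<rceil>" by linarith
  then have e: "e \<le> max_words \<kappa>" "0 < e" by (auto simp: e_def max_words_def)
  have room: "e * chunk_count * 2 ^ chunk_size chunk_count w * 2 ^ record_bits e \<le> 2 ^ w"
  proof (rule chunk_room[OF chunk_count(2)])
    have "e * chunk_count * 2 ^ record_bits e \<le> K"
      unfolding K_def using e record_bits(2)[OF e(2)] by (intro mult_mono) auto
    then show "e * chunk_count * 2 ^ record_bits e \<le> 2 ^ K" using less_exp[of K] by linarith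
  qed (use w16 in simp)
  have "record_bits e \<le> w"
  proof -
    have "1 \<le> e * chunk_count * 2 ^ chunk_size chunk_count w" using e(2) chunk_count(2) by (simp add: Suc_le_eq)
    then have "1 * 2 ^ record_bits e \<le> e * chunk_count * 2 ^ chunk_size chunk_count w * 2 ^ record_bits e"
      by (rule mult_right_mono) simp
    then have "(2 :: nat) ^ record_bits e \<le> 2 ^ w" using room by linarith
    then show ?thesis by simp
  qed
  moreover have "bits_bound L < w * (bits_bound L div w) + w"
    using w16 mult_div_mod_eq[of w "bits_bound L"] mod_less_divisor[of w "bits_bound L"] by linarith
  ultimately have size: "bits_bound L + record_bits e \<le> w * e" by (simp add: e_def)
  have "w * (bits_bound L div w) \<le> bits_bound L" by simp
  then have "w * e \<le> bits_bound L + 2 * w" by (simp add: e_def)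
  then have "w * e \<le> 3 * max_cell_size L" using False by (simp add: max_cell_size_def)
  moreover have "e \<le> max_cell_size L"
    unfolding e_def max_cell_size_def using div_le_dividend[of "bits_bound L" w] by linarith
  moreover have "chunk_count \<le> K"
  proof -
    have "1 * chunk_count * 1 \<le> K" unfolding K_def by (intro mult_mono) (auto simp: max_words_def)
    then show ?thesis by simp
  qed
  ultimately show ?thesis
    using e room size w16 False by (intro exI[of _ w] exI[of _ e]) auto
qed

definition size_factor :: real where "size_factor = bits_factor + 5 + size_slack"
definition record_factor :: real where "record_factor = 4 * 2 ^ (2 * root_depth + 3) + size_factor * 8 * c * chunk_count * 2 ^ (7 + size_slack)"
text \<open>480 is \<open>2 * 40 * 3 * 2\<close>: from \<open>layout\<close>, from
  \<open>record_bits\<close>, from \<open>s * e \<le> 3 * max_cell_size L\<close> and from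
  \<open>L \<le> 2 * log 2 n\<close>.\<close>

definition space_const :: real where "space_const = 480 * size_factor * record_factor"

lemma powr_log_le:
  assumes "0 < n" "2 ^ L \<le> 2 * n" "1 \<le> x"
  shows "2 powr (real L / x) \<le> 2 * real n powr (1 / x)"
proof -
  have "2 powr (real L / x) = (2 ^ L) powr (1 / x)"
    by (simp add: powr_powr flip: powr_realpow)
  also have "\<dots> \<le> real (2 * n) powr (1 / x)"
  proof (rule powr_mono2)
    have "real (2 ^ L) \<le> real (2 * n)" using assms(2) by (simp only: of_nat_le_iff)
    then show "2 ^ L \<le> real (2 * n)" by simp
  qed (use assms in auto)
  also have "\<dots> = 2 powr (1 / x) * real n powr (1 / x)" by (simp add: powr_mult)
  also have "\<dots> \<le> 2 powr 1 * real n powr (1 / x)"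
    using assms(3) by (intro mult_right_mono powr_mono) auto
  finally show ?thesis by simp
qed

text \<open>Let \<open>Y = n powr (1 / (2 * c))\<close>. A chunk table has order \<open>Y\<close>
  rows, and the number of chunks is of order \<open>L \<le> 8 * c * Y\<close>, so the chunk tables
  need order \<open>Y * Y\<close> records, no more than the slots may. The only logarithmic factor
  comes from the order \<open>s * e\<close> bits of a record.\<close>

lemma space_bound:
  assumes n: "2 \<le> n" and L: "1 \<le> L" "2 ^ L \<le> 2 * n" "real L \<le> 2 * log 2 n"
    and s: "s \<le> max_cell_size L" "0 < e" "s * e \<le> 3 * max_cell_size L" "e \<le> max_cell_size L"
  shows "real (2 * s * ((2 ^ Suc (short_length L + 1) + e * chunk_count * 2 ^ chunk_size chunk_count s) * 2 ^ record_bits e))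
    \<le> space_const * real n powr (1 / c) * log 2 n"
proof -
  define X where "X = real n powr (1 / c)"
  define Y where "Y = real n powr (1 / (2 * c))"
  have XY: "X = Y * Y" by (simp add: X_def Y_def flip: powr_add)
  have Y1: "1 \<le> Y" using n c by (simp add: Y_def ge_one_powr_ge_zero)
  have X1: "1 \<le> X" using n c by (simp add: X_def ge_one_powr_ge_zero)
  have size_le: "real (max_cell_size L) \<le> size_factor * L"
    using max_cell_size_le[OF L(1)] unfolding size_factor_def by (metis of_nat_add of_nat_le_iff of_nat_mult of_nat_numeral)
  have size_factor: "0 \<le> size_factor" by (simp add: size_factor_def)
  have LY: "real L \<le> 8 * c * Y"
  proof -
    have "log 2 n = 2 * c * log 2 Y" using n c by (simp add: Y_def log_powr)
    also have "log 2 Y \<le> 2 * Y"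
    proof -
      have "ln Y \<le> Y" using ln_le_minus_one[of Y] Y1 by simp
      moreover have "1 / 2 \<le> ln (2 :: real)" using ln_le_minus_one[of "1 / 2 :: real"] by (simp add: ln_div)
      then have "Y * (1 / 2) \<le> Y * ln 2" using Y1 by (intro mult_left_mono) auto
      ultimately have "ln Y \<le> 2 * Y * ln 2" by simp
      then show ?thesis by (simp add: log_def divide_le_eq)
    qed
    finally show ?thesis using L(3) c by simp
  qed
  have "2 powr real (short_length L + 1) \<le> 2 powr (real L / c + real (2 * root_depth + 3))"
    using short_length(3)[of L] by (intro powr_mono) auto
  also have "\<dots> = 2 ^ (2 * root_depth + 3) * 2 powr (real L / c)"
    by (simp only: powr_add powr_realpow[OF zero_less_numeral] mult.commute)
  also have "\<dots> \<le> 2 ^ (2 * root_depth + 3) * (2 * X)"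
    unfolding X_def using powr_log_le[OF _ L(2), of c] n c by (intro mult_left_mono) auto
  finally have "2 powr real (short_length L + 1) \<le> 2 ^ (2 * root_depth + 3) * (2 * X)" .
  then have "(2 :: real) ^ (short_length L + 1) \<le> 2 ^ (2 * root_depth + 3) * (2 * X)"
    by (simp only: powr_realpow[OF zero_less_numeral])
  then have T1: "(2 :: real) ^ Suc (short_length L + 1) \<le> 4 * 2 ^ (2 * root_depth + 3) * X" by simp
  have \<omega>: "real (chunk_size chunk_count s) \<le> real L / (2 * c) + real (6 + size_slack)"
  proof -
    have "real (chunk_size chunk_count s) \<le> real (s div chunk_count + 1)" using chunk_size_le[of chunk_count s] chunk_count(2) by simp
    also have "\<dots> \<le> real s / real chunk_count + 1" using of_nat_div_le_of_nat[of s chunk_count] by simp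
    also have "real s / real chunk_count \<le> real (bits_factor * L + (5 + size_slack)) / real chunk_count"
    proof (rule divide_right_mono)
      have "s \<le> bits_factor * L + (5 + size_slack)" using s(1) bits_bound_le[OF L(1)] by (simp add: max_cell_size_def)
      then show "real s \<le> real (bits_factor * L + (5 + size_slack))" by (simp only: of_nat_le_iff)
    qed simp
    also have "\<dots> = real (bits_factor * L) / real chunk_count + real (5 + size_slack) / real chunk_count"
      by (simp only: of_nat_add add_divide_distrib)
    also have "real (bits_factor * L) / real chunk_count \<le> real (bits_factor * L) / (2 * c * bits_factor)"
      using chunk_count c by (intro divide_left_mono) (auto simp: bits_factor_def)
    also have "\<dots> = real L / (2 * c)" by (simp add: bits_factor_def)
    also have "real (5 + size_slack) / real chunk_count \<le> real (5 + size_slack) / 1" using chunk_count(2) by (intro divide_left_mono) auto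
    finally show ?thesis by simp
  qed
  have "2 powr real (chunk_size chunk_count s) \<le> 2 powr (real L / (2 * c) + real (6 + size_slack))"
    using \<omega> by (intro powr_mono) auto
  also have "\<dots> = 2 ^ (6 + size_slack) * 2 powr (real L / (2 * c))"
    by (simp only: powr_add powr_realpow[OF zero_less_numeral] mult.commute)
  also have "\<dots> \<le> 2 ^ (6 + size_slack) * (2 * Y)"
    unfolding Y_def using powr_log_le[OF _ L(2), of "2 * c"] n c by (intro mult_left_mono) auto
  finally have "2 powr real (chunk_size chunk_count s) \<le> 2 ^ (6 + size_slack) * (2 * Y)" .
  then have "(2 :: real) ^ chunk_size chunk_count s \<le> 2 ^ (6 + size_slack) * (2 * Y)"
    by (simp only: powr_realpow[OF zero_less_numeral])
  also have "\<dots> = 2 ^ (7 + size_slack) * Y" by (simp add: power_add)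
  finally have T2: "(2 :: real) ^ chunk_size chunk_count s \<le> 2 ^ (7 + size_slack) * Y" .
  have "real e \<le> size_factor * L" using s(4) size_le by linarith
  also have "\<dots> \<le> size_factor * (8 * c * Y)" using LY size_factor by (intro mult_left_mono) auto
  finally have "real e * chunk_count * 2 ^ chunk_size chunk_count s \<le> (size_factor * (8 * c * Y)) * chunk_count * (2 ^ (7 + size_slack) * Y)"
    using T2 size_factor c Y1 by (intro mult_mono) auto
  also have "\<dots> = size_factor * 8 * c * chunk_count * 2 ^ (7 + size_slack) * X" by (simp add: XY)
  finally have N: "2 ^ Suc (short_length L + 1) + real e * chunk_count * 2 ^ chunk_size chunk_count s \<le> record_factor * X"
    using T1 by (simp add: record_factor_def algebra_simps)
  have record_factor: "0 \<le> record_factor" using size_factor c by (simp add: record_factor_def)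
  have "real (2 ^ record_bits e) \<le> real (40 * e)" using record_bits(2)[OF s(2)] by (simp only: of_nat_le_iff)
  then have "2 * real s * 2 ^ record_bits e \<le> 2 * real s * (40 * e)" by (intro mult_left_mono) auto
  also have "\<dots> = 80 * real (s * e)" by simp
  also have "\<dots> \<le> 80 * real (3 * max_cell_size L)" using s(3) by (intro mult_left_mono) (auto simp only: of_nat_le_iff)
  also have "\<dots> \<le> 240 * (size_factor * L)" using size_le by simp
  also have "\<dots> \<le> 240 * (size_factor * (2 * log 2 n))" using L(3) size_factor by (intro mult_left_mono) auto
  finally have S: "2 * real s * 2 ^ record_bits e \<le> 480 * size_factor * log 2 n" by simp
  have "real (2 * s * ((2 ^ Suc (short_length L + 1) + e * chunk_count * 2 ^ chunk_size chunk_count s) * 2 ^ record_bits e))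
      = (2 * real s * 2 ^ record_bits e) * (2 ^ Suc (short_length L + 1) + real e * chunk_count * 2 ^ chunk_size chunk_count s)"
    by simp
  also have "\<dots> \<le> (480 * size_factor * log 2 n) * (record_factor * X)"
    using size_factor n by (intro mult_mono[OF S N]) (auto intro: add_nonneg_nonneg)
  also have "\<dots> = space_const * real n powr (1 / c) * log 2 n"
    by (simp add: space_const_def X_def)
  finally show ?thesis .
qed

end

section \<open>Words of logarithmic length\<close>

definition yields :: "nat \<Rightarrow> nat \<Rightarrow> ex list \<Rightarrow> bool list \<Rightarrow> nat \<Rightarrow> nat \<Rightarrow> nat \<Rightarrow> bool" where
  "yields w d outs bits x y z \<longleftrightarrow>
    multiword w (map (eval w (input_regs w d x) (packed w bits)) (take d outs)) = y \<and>
    multiword w (map (eval w (input_regs w d x) (packed w bits)) (drop d outs)) = z"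

fun case_ex :: "ex \<Rightarrow> (nat \<Rightarrow> ex) \<Rightarrow> nat \<Rightarrow> ex" where
  "case_ex a f 0 = const_ex 0"
| "case_ex a f (Suc v) = Ite (Bin Eq a (const_ex v)) (f v) (case_ex a f v)"

text \<open>\<open>V \<le> 2 ^ w\<close> ensures that the constants in the tests are not
  reduced.\<close>

lemma eval_case:
  "eval w \<rho> \<mu> a = v \<Longrightarrow> v < V \<Longrightarrow> V \<le> 2 ^ w \<Longrightarrow> eval w \<rho> \<mu> (case_ex a f V) = eval w \<rho> \<mu> (f v)"
  by (induction V) (auto simp: less_Suc_eq)

lemma regs_below_case:
  "regs_below d a \<Longrightarrow> (\<And>v. v < V \<Longrightarrow> regs_below d (f v)) \<Longrightarrow> regs_below d (case_ex a f V)"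
  by (induction V) auto

text \<open>The number \<open>d\<close> of result words is fixed by the program, whereas
  \<open>e\<close> varies with the input, so the upper words must be zero. If \<open>e = 1\<close>,
  the only digit may be shorter than a word.\<close>

lemma multiword_padded:
  assumes "e = 1 \<and> s \<le> w \<or> s = w" "0 < e" "e \<le> d" "y < 2 ^ (s * e)"
  shows "multiword w (map (\<lambda>i. if i < e then digit s y i else 0) [0..<d]) = y"
proof -
  have "[0..<d] = [0..<e] @ [e..<d]" using assms(3) by (metis le_add_diff_inverse upt_add_eq_append zero_le)
  moreover have "map (\<lambda>i. if i < e then digit s y i else 0) [e..<d] = map (\<lambda>_. 0) [e..<d]"
    "map (\<lambda>i. if i < e then digit s y i else 0) [0..<e] = map (digit s y) [0..<e]" by auto
  ultimately have "multiword w (map (\<lambda>i. if i < e then digit s y i else 0) [0..<d]) =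
      multiword w (map (digit s y) [0..<e])"
    by (simp only: map_append multiword_append multiword_zeros mult_0_right add_0_right)
  also have "\<dots> = y"
    using assms(1)
  proof (elim disjE)
    assume "e = 1 \<and> s \<le> w"
    then show ?thesis using assms(4) by (simp add: multiword_Cons digit_0)
  next
    assume "s = w"
    then show ?thesis using assms(4) by (simp add: multiword_digits)
  qed
  finally show ?thesis .
qed

lemma regs_below_size: "regs_below d size_ex"
  by (simp add: size_ex_def half_ex_def low_ex_def)

lemma regs_below_cell:
  "regs_below d a \<Longrightarrow> list_all (regs_below d) as \<Longrightarrow> regs_below d (cell_ex a as)"
  by (simp add: cell_ex_def per_word_ex_def mask_ex_def regs_below_size)

lemma regs_below_chunk_cell: "c div q < d \<Longrightarrow> regs_below d (chunk_cell_ex q t off c)"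
  unfolding chunk_cell_ex_def
  by (intro regs_below_cell) (simp_all add: chunk_ex_def chunk_size_ex_def mask_ex_def regs_below_size)

lemma regs_below_xor: "(\<And>i. i < n \<Longrightarrow> regs_below d (f i)) \<Longrightarrow> regs_below d (xor_ex f n)"
  by (induction n) auto

lemma regs_below_all: "(\<And>i. i < n \<Longrightarrow> regs_below d (f i)) \<Longrightarrow> regs_below d (all_ex f n)"
  by (induction n) auto

lemma regs_below_affine: "e \<le> d \<Longrightarrow> regs_below d (affine_ex e q t \<phi> i)"
  unfolding affine_ex_def
  by (intro regs_below_xor regs_below_chunk_cell) (simp add: less_le_trans less_mult_imp_div_less)

lemma regs_below_field:
  "(\<And>i. regs_below d (A i)) \<Longrightarrow> regs_below d (field_ex e A \<phi> i)"
  unfolding field_ex_def by (intro regs_below_cell) (auto simp: list_all_iff)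

lemma regs_below_result: "e \<le> d \<Longrightarrow> regs_below d (result_ex e q t \<phi> b i)"
  by (simp add: result_ex_def hit_ex_def slot_ex_def regs_below_all regs_below_affine regs_below_field)

context approximation_ratio
begin

text \<open>The number of digits shapes the expression, so the program contains one version for each
  possible \<open>e\<close> and selects by cell 1. The outer test recognises empty memory: for
  \<open>n = 1\<close> the space bound is 0 bits, and zeros are the right answer for symbol 0 with
  the empty codeword.\<close>

definition output_ex :: "real \<Rightarrow> nat \<Rightarrow> nat \<Rightarrow> nat \<Rightarrow> ex" where
  "output_ex \<kappa> \<phi> b i = Ite (Ld []) (case_ex (cell_ex (const_ex 1) [])
     (\<lambda>e. if i < e then result_ex e chunk_count (record_bits e) \<phi> b i else const_ex 0) (Suc (max_words \<kappa>))) (const_ex 0)"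

definition outputs :: "real \<Rightarrow> nat \<Rightarrow> nat \<Rightarrow> ex list" where
  "outputs \<kappa> d \<phi> = map (output_ex \<kappa> \<phi> 0) [0..<d] @ map (output_ex \<kappa> \<phi> 1) [0..<d]"

lemma length_outputs: "length (outputs \<kappa> d \<phi>) = 2 * d"
  by (simp add: outputs_def)

lemma regs_below_outputs:
  assumes "max_words \<kappa> \<le> d"
  shows "list_all (regs_below d) (outputs \<kappa> d \<phi>)"
proof -
  have "regs_below d (output_ex \<kappa> \<phi> b i)" for b i
    unfolding output_ex_def using assms
    by (auto intro!: regs_below_case regs_below_cell regs_below_result)
  then show ?thesis by (auto simp: outputs_def list_all_iff)
qed

lemma space_const_nonneg: "0 \<le> space_const"
  using c by (simp add: space_const_def size_factor_def record_factor_def)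

lemma ex_stored_code:
  assumes \<kappa>: "0 < \<kappa>" and n: "1 \<le> n" and p: "prob_dist n p"
    and w: "real w \<ge> \<kappa> * log 2 (real n)" "min_word_size \<kappa> \<le> w" and d: "max_words \<kappa> \<le> d"
  shows "\<exists>code bits. prefix_code n code \<and> avg_len n p code \<le> c * opt_avg_len n p \<and>
    real (length bits) \<le> space_const * real n powr (1 / c) * log 2 n \<and>
    (\<forall>i<n. length (code i) \<le> max_words \<kappa> * w \<and>
       yields w d (outputs \<kappa> d 0) bits i (bits_val (code i)) (length (code i)) \<and>
       (\<forall>x. matches (code i) x \<longrightarrow> yields w d (outputs \<kappa> d 9) bits x i (length (code i))))"
proof (cases "n = 1")
  case True
  have "multiword w (map (eval w \<rho> (packed w [])) (map (output_ex \<kappa> \<phi> b) [0..<d])) = 0" for \<rho> \<phi> b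
  proof -
    have "packed w [] 0 = 0" by (simp add: packed_def bits_val_def)
    then have "map (eval w \<rho> (packed w [])) (map (output_ex \<kappa> \<phi> b) [0..<d]) = map (\<lambda>_. 0) [0..<d]"
      by (simp add: output_ex_def)
    then show ?thesis by (simp only: multiword_zeros)
  qed
  then have y: "yields w d (outputs \<kappa> d \<phi>) [] x 0 0" for \<phi> x by (simp add: yields_def outputs_def)
  obtain oc where "avg_len n p oc = opt_avg_len n p" using opt_avg_len_attained(1)[OF p] by blast
  moreover have "0 \<le> avg_len n p oc"
    using p unfolding avg_len_def prob_dist_def by (intro sum_nonneg mult_nonneg_nonneg) auto
  ultimately have "0 \<le> c * opt_avg_len n p" using c by simp
  then show ?thesis using True y
    by (intro exI[of _ "\<lambda>_. []"] exI[of _ "[]"]) (auto simp: prefix_code_def avg_len_def bits_val_def)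
next
  case False
  then have n2: "2 \<le> n" using n by simp
  obtain L where L: "1 \<le> L" "n \<le> 2 ^ L" "2 ^ L \<le> 2 * n" "real L \<le> 2 * log 2 n"
    using ex_log[OF n2] by blast
  define m where "m = short_length L"
  obtain oc where oc: "prefix_code n oc" "avg_len n p oc = opt_avg_len n p"
    using opt_avg_len_attained(1)[OF p] by blast
  obtain code S u where code: "prefix_code n code" "S \<subseteq> {..<n}" "length u = root_depth + 1"
    "\<forall>i\<in>S. length (code i) \<le> m + 1" "\<forall>i<n. i \<notin> S \<longrightarrow> code i = u @ map (bit i) [0..<L]"
    "\<And>i. i < n \<Longrightarrow> real (length (code i)) \<le> c * real (length (oc i))"
    using ex_short_and_fixed_length_code[OF oc(1) L(2) short_length(1) root_depth short_length(2)] c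
    unfolding m_def by (metis less_imp_le)
  define B where "B = bits_bound L"
  have B: "length u + L \<le> B" "m + 1 \<le> B" "m + 2 \<le> B" "L < B"
    using short_length(4)[of L] by (auto simp: B_def bits_bound_def m_def code(3))
  have len: "length (code i) \<le> B" if "i < n" for i
    using code(4,5) that B by (cases "i \<in> S") auto
  obtain \<pi> :: "nat \<Rightarrow> nat \<Rightarrow> nat" and X :: "nat \<Rightarrow> nat set" and val :: "nat \<Rightarrow> nat \<Rightarrow> nat \<Rightarrow> nat"
      and dv :: "nat \<Rightarrow> nat \<Rightarrow> nat" and E :: "nat \<Rightarrow> nat \<Rightarrow> nat \<Rightarrow> nat" where Q:
    "\<And>b. b < 2 \<Longrightarrow> X b \<subseteq> {..<2 ^ (if b = 0 then L else m + 1)}" "\<And>b. b < 2 \<Longrightarrow> card (X b) \<le> 2 ^ (m + 1)"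
    "\<And>b. b < 2 \<Longrightarrow> xor_linear B (\<pi> b)" "\<And>b x. b < 2 \<Longrightarrow> \<pi> b x < 2 ^ (if b = 0 then L else m + 1)"
    "\<And>b r. b < 2 \<Longrightarrow> r < 2 \<Longrightarrow> xor_linear B (E b r)"
    "\<And>i. i < n \<Longrightarrow> lookup (\<pi> 0) (X 0) (val 0 0) (dv 0 0) (E 0 0) i = bits_val (code i)"
    "\<And>i. i < n \<Longrightarrow> lookup (\<pi> 0) (X 0) (val 0 1) (dv 0 1) (E 0 1) i = length (code i)"
    "\<And>i x. i < n \<Longrightarrow> matches (code i) x \<Longrightarrow> lookup (\<pi> 1) (X 1) (val 1 0) (dv 1 0) (E 1 0) x = i"
    "\<And>i x. i < n \<Longrightarrow> matches (code i) x \<Longrightarrow> lookup (\<pi> 1) (X 1) (val 1 1) (dv 1 1) (E 1 1) x = length (code i)"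
    using ex_code_queries[OF code(1) L(2) code(2,4,5) B(1,2)]
  proof (elim exE conjE, goal_cases)
    case (1 \<pi> X val dv E)
    show ?case by (rule 1(1)[of X \<pi> E val dv]) (use 1(2-4) in blast)+
  qed
  obtain s e where g: "e = 1 \<and> s \<le> w \<or> s = w" "0 < e" "e \<le> max_words \<kappa>" "16 \<le> s" "chunk_count \<le> s" "s \<le> max_cell_size L"
    "e * chunk_count * 2 ^ chunk_size chunk_count s * 2 ^ record_bits e \<le> 2 ^ s" "bits_bound L + record_bits e \<le> s * e"
    "s * e \<le> 3 * max_cell_size L" "e \<le> max_cell_size L"
    using ex_geometry[OF \<kappa> n2 w L(1,4)] by (elim exE conjE) (rule that; assumption)
  define t where "t = record_bits e"
  define N where "N = 2 ^ Suc (m + 1) + e * chunk_count * 2 ^ chunk_size chunk_count s"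
  have "\<exists>bits. length bits = 2 * s * (N * 2 ^ t) \<and> packed w bits 0 \<noteq> 0 \<and>
    (\<forall>\<rho>. eval w \<rho> (packed w bits) (cell_ex (const_ex 1) []) = e) \<and>
    (\<forall>\<rho> x b r i. (\<forall>j<e. \<rho> j = digit w x j) \<longrightarrow> b < 2 \<longrightarrow> r < 2 \<longrightarrow> i < e \<longrightarrow>
       eval w \<rho> (packed w bits) (result_ex e chunk_count t (9 * b) r i) =
       digit s (lookup (\<pi> b) (X b) (val b r) (dv b r) (E b r) x) i)"
  proof (rule ex_stored_queries[where P = "\<lambda>b. if b = 0 then L else m + 1" and M = "m + 1" and B = B])
    show "m + 1 + 1 + t \<le> s * e" "B \<le> s * e" "(if b = 0 then L else m + 1) < s * e" for b :: nat
      using g(8) B unfolding t_def B_def by auto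
    show "2 + 18 * e \<le> 2 ^ t" unfolding t_def by (rule record_bits(1)[OF g(2)])
  qed (use Q g chunk_count(2) in \<open>auto simp: N_def t_def\<close>)
  then obtain bits where bits: "length bits = 2 * s * (N * 2 ^ t)" "packed w bits 0 \<noteq> 0"
    "\<And>\<rho>. eval w \<rho> (packed w bits) (cell_ex (const_ex 1) []) = e"
    "\<And>\<rho> x b r i. (\<forall>j<e. \<rho> j = digit w x j) \<Longrightarrow> b < 2 \<Longrightarrow> r < 2 \<Longrightarrow> i < e \<Longrightarrow>
       eval w \<rho> (packed w bits) (result_ex e chunk_count t (9 * b) r i) =
       digit s (lookup (\<pi> b) (X b) (val b r) (dv b r) (E b r) x) i"
    by blast
  have "max_words \<kappa> * 1 * (40 * 1) \<le> max_words \<kappa> * chunk_count * (40 * max_words \<kappa>)"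
    using chunk_count(2) by (intro mult_mono) (auto simp: max_words_def)
  then have "Suc (max_words \<kappa>) \<le> w" using w(2) unfolding min_word_size_def by linarith
  also have "w \<le> 2 ^ w" using less_exp[of w] by simp
  finally have V: "Suc (max_words \<kappa>) \<le> 2 ^ w" .
  have result: "multiword w (map (eval w (input_regs w d x) (packed w bits)) (map (output_ex \<kappa> (9 * b) r) [0..<d])) =
      y"
    if b: "b < 2" and r: "r < 2" and ly: "lookup (\<pi> b) (X b) (val b r) (dv b r) (E b r) x = y"
      and y: "y < 2 ^ (s * e)" for b r x y
  proof -
    have "eval w (input_regs w d x) (packed w bits) (output_ex \<kappa> (9 * b) r i) = (if i < e then digit s y i else 0)" for i
    proof -
      have \<rho>: "\<forall>j<e. input_regs w d x j = digit w x j" using d g(3) by (auto simp: input_regs_def digit_def)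
      have "eval w (input_regs w d x) (packed w bits) (output_ex \<kappa> (9 * b) r i) =
          eval w (input_regs w d x) (packed w bits)
            (if i < e then result_ex e chunk_count (record_bits e) (9 * b) r i else const_ex 0)"
      proof -
        have "eval w (input_regs w d x) (packed w bits) (Ld []) \<noteq> 0" using bits(2) by simp
        moreover have "e < Suc (max_words \<kappa>)" using g(3) by simp
        ultimately show ?thesis
          unfolding output_ex_def eval.simps(4) by (simp only: eval_case[OF bits(3) _ V] if_True simp_thms)
      qed
      also have "\<dots> = (if i < e then digit s y i else 0)"
        using bits(4)[OF \<rho> b r] by (simp add: t_def ly)
      finally show ?thesis .
    qed
    then have "map (eval w (input_regs w d x) (packed w bits)) (map (output_ex \<kappa> (9 * b) r) [0..<d]) =
        map (\<lambda>i. if i < e then digit s y i else 0) [0..<d]" by simp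
    moreover have "multiword w (map (\<lambda>i. if i < e then digit s y i else 0) [0..<d]) = y"
      using multiword_padded[OF g(1,2) _ y, of d] g(3) d by simp
    ultimately show ?thesis by (simp only:)
  qed
  have small: "y < 2 ^ (s * e)" if "y < 2 ^ B" for y :: nat
  proof -
    have "(2 :: nat) ^ B \<le> 2 ^ (s * e)" using g(8) unfolding B_def by (intro power_increasing) auto
    then show ?thesis using that by linarith
  qed
  have sizes: "bits_val (code i) < 2 ^ (s * e)" "length (code i) < 2 ^ (s * e)" "i < 2 ^ (s * e)" if i: "i < n" for i
  proof -
    have "(2 :: nat) ^ length (code i) \<le> 2 ^ B" "(2 :: nat) ^ L \<le> 2 ^ B"
      using len[OF i] B by (auto intro!: power_increasing)
    then have "bits_val (code i) < 2 ^ B" "length (code i) < 2 ^ B" "i < 2 ^ B"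
      using bits_val_less[of "code i"] less_exp[of "length (code i)"] i L(2) by linarith+
    then show "bits_val (code i) < 2 ^ (s * e)" "length (code i) < 2 ^ (s * e)" "i < 2 ^ (s * e)"
      using small by blast+
  qed
  have enc: "yields w d (outputs \<kappa> d 0) bits i (bits_val (code i)) (length (code i))" if i: "i < n" for i
    using result[OF _ _ Q(6)[OF i] sizes(1)[OF i]] result[OF _ _ Q(7)[OF i] sizes(2)[OF i]] by (simp add: yields_def outputs_def)
  have dec: "yields w d (outputs \<kappa> d 9) bits x i (length (code i))" if i: "i < n" and x: "matches (code i) x" for i x
    using result[OF _ _ Q(8)[OF i x] sizes(3)[OF i]] result[OF _ _ Q(9)[OF i x] sizes(2)[OF i]] by (simp add: yields_def outputs_def)
  have "length (code i) \<le> max_words \<kappa> * w" if i: "i < n" for i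
  proof -
    have "length (code i) \<le> s * e" using len[OF i] g(8) by (simp add: B_def)
    also have "\<dots> \<le> w * max_words \<kappa>" using g(1,3) by (intro mult_mono) auto
    finally show ?thesis by (simp add: mult.commute)
  qed
  moreover have "avg_len n p code \<le> c * opt_avg_len n p"
  proof -
    have "avg_len n p code \<le> (\<Sum>i<n. c * (p i * real (length (oc i))))"
      unfolding avg_len_def
    proof (rule sum_mono)
      fix i assume "i \<in> {..<n}"
      then have "p i * real (length (code i)) \<le> p i * (c * real (length (oc i)))"
        using p code(6) by (intro mult_left_mono) (auto simp: prob_dist_def)
      then show "p i * real (length (code i)) \<le> c * (p i * real (length (oc i)))" by (simp add: ac_simps)
    qed
    also have "\<dots> = c * opt_avg_len n p" by (simp add: avg_len_def sum_distrib_left flip: oc(2))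
    finally show ?thesis .
  qed
  moreover have "real (length bits) \<le> space_const * real n powr (1 / c) * log 2 n"
    unfolding bits(1) N_def t_def m_def by (rule space_bound[OF n2 L(1,3,4) g(6,2,9,10)])
  ultimately show ?thesis using code(1) enc dec by blast
qed

end

section \<open>Short words\<close>

text \<open>If the word size is bounded, there are only finitely many possible inputs and memory contents, so
  a program can tabulate the answers.\<close>

fun table_ex :: "nat \<Rightarrow> ex list \<Rightarrow> (nat list \<Rightarrow> nat) \<Rightarrow> ex" where
  "table_ex V [] \<Phi> = const_ex (\<Phi> [])"
| "table_ex V (a # as) \<Phi> = case_ex a (\<lambda>v. table_ex V as (\<lambda>vs. \<Phi> (v # vs))) V"

lemma eval_table:
  "list_all (\<lambda>a. eval w \<rho> \<mu> a < 2 ^ w) as \<Longrightarrow>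
    eval w \<rho> \<mu> (table_ex (2 ^ w) as \<Phi>) = \<Phi> (map (eval w \<rho> \<mu>) as) mod 2 ^ w"
  by (induction as arbitrary: \<Phi>) (simp_all add: eval_case[OF refl])

lemma regs_below_table: "list_all (regs_below d) as \<Longrightarrow> regs_below d (table_ex V as \<Phi>)"
  by (induction as arbitrary: \<Phi>) (auto intro!: regs_below_case)

text \<open>Addresses are written with \<open>N\<close> digits, which is enough for every positive
  word size, as \<open>N < 2 ^ N \<le> 2 ^ (w * N)\<close>.\<close>

definition sources :: "nat \<Rightarrow> nat \<Rightarrow> nat \<Rightarrow> ex list" where
  "sources w N d = map (\<lambda>a. Ld (map (\<lambda>j. const_ex (digit w a j)) [0..<N])) [0..<N] @
     map (\<lambda>j. Opd (Reg j)) [0..<d]"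

text \<open>The results on words of size \<open>w'\<close>, as a function of the contents \<open>vs\<close> of the memory and the input
  registers on words of size \<open>w\<close>.\<close>

definition simulated :: "nat \<Rightarrow> nat \<Rightarrow> nat \<Rightarrow> nat \<Rightarrow> ex list \<Rightarrow> nat list \<Rightarrow> nat" where
  "simulated w w' N d outs vs = multiword w' (map
     (eval w' (input_regs w' d (multiword w (drop N vs))) (digit w' (multiword w (take N vs)))) outs)"

definition simulating :: "nat \<Rightarrow> nat \<Rightarrow> nat \<Rightarrow> nat \<Rightarrow> ex list \<Rightarrow> ex list" where
  "simulating w w' N d outs =
     map (\<lambda>i. table_ex (2 ^ w) (sources w N d) (\<lambda>vs. digit w (simulated w w' N d (take d outs) vs) i)) [0..<d] @
     map (\<lambda>i. table_ex (2 ^ w) (sources w N d) (\<lambda>vs. digit w (simulated w w' N d (drop d outs) vs) i)) [0..<d]"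

lemma length_simulating: "length (simulating w w' N d outs) = 2 * d"
  by (simp add: simulating_def)

lemma regs_below_simulating: "list_all (regs_below d) (simulating w w' N d outs)"
  by (auto simp: simulating_def sources_def list_all_iff intro!: regs_below_table)

lemma packed_eq_digit: "packed w bits = digit w (bits_val bits)"
  by (intro ext bit_eqI) (auto simp: packed_bit bit_digit bits_val_bit mult.commute)

lemma input_regs_eq_digit: "r < d \<Longrightarrow> input_regs w d x r = digit w x r"
  by (simp add: input_regs_def digit_def)

text \<open>The words of size \<open>w\<close> determine the stored string, which in turn determines
  the memory at word size \<open>w'\<close>; the same holds for the argument. So the answers at word
  size \<open>w'\<close> are a function of finitely many short words, and the string is stored
  unchanged.\<close>

lemma yields_simulating:
  assumes w: "0 < w" and bits: "length bits \<le> w * N" and x: "x < 2 ^ (w * d)"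
    and y: "yields w' d outs bits x y z" and small: "y < 2 ^ (w * d)" "z < 2 ^ (w * d)"
  shows "yields w d (simulating w w' N d outs) bits x y z"
proof -
  define \<rho> where "\<rho> = input_regs w d x"
  define \<mu> where "\<mu> = packed w bits"
  define vs where "vs = map \<mu> [0..<N] @ map \<rho> [0..<d]"
  define adr where "adr a = map (\<lambda>j. const_ex (digit w a j)) [0..<N]" for a
  have addr: "multiword w (map (eval w \<rho> \<mu>) (adr a)) = a" if "a < N" for a
  proof -
    have "map (eval w \<rho> \<mu>) (adr a) = map (digit w a) [0..<N]"
      by (simp add: digit_less adr_def)
    moreover have "a < 2 ^ (w * N)"
    proof -
      have "N < 2 ^ N" by (rule less_exp)
      also have "\<dots> \<le> 2 ^ (w * N)" using w by (intro power_increasing) auto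
      finally show ?thesis using that by linarith
    qed
    ultimately show ?thesis by (simp only: multiword_digits mod_less)
  qed
  have vs: "map (eval w \<rho> \<mu>) (sources w N d) = vs"
    unfolding sources_def vs_def adr_def[symmetric] using addr by simp
  have small_vs: "list_all (\<lambda>a. eval w \<rho> \<mu> a < 2 ^ w) (sources w N d)"
  proof -
    have "\<forall>v\<in>set vs. v < 2 ^ w"
      by (auto simp: vs_def \<mu>_def \<rho>_def packed_less input_regs_def)
    then show ?thesis unfolding vs[symmetric] by (auto simp: list_all_iff)
  qed
  have "bits_val bits < 2 ^ (w * N)"
  proof -
    have "(2 :: nat) ^ length bits \<le> 2 ^ (w * N)" using bits by (intro power_increasing) auto
    then show ?thesis using bits_val_less[of bits] by linarith
  qed
  then have M: "multiword w (take N vs) = bits_val bits"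
    by (simp add: vs_def \<mu>_def packed_eq_digit multiword_digits)
  have "map \<rho> [0..<d] = map (digit w x) [0..<d]"
    by (simp add: \<rho>_def input_regs_eq_digit)
  then have X: "multiword w (drop N vs) = x"
    using x by (simp add: vs_def multiword_digits del: map_eq_conv)
  have out: "multiword w (map (eval w \<rho> \<mu>) (map (\<lambda>i. table_ex (2 ^ w) (sources w N d)
      (\<lambda>vs. digit w (simulated w w' N d os vs) i)) [0..<d])) = simulated w w' N d os vs"
    if "simulated w w' N d os vs < 2 ^ (w * d)" for os
    using that small_vs by (simp add: eval_table vs digit_less comp_def multiword_digits)
  have sim: "simulated w w' N d os vs =
      multiword w' (map (eval w' (input_regs w' d x) (packed w' bits)) os)" for os
    by (simp add: simulated_def M X packed_eq_digit)
  show ?thesis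
    using out[of "take d outs"] out[of "drop d outs"] sim[of "take d outs"] sim[of "drop d outs"] y small
    by (simp add: yields_def simulating_def \<rho>_def \<mu>_def)
qed

section \<open>Selection by the word size\<close>

fun word_size_ex :: "nat list \<Rightarrow> (nat \<Rightarrow> ex) \<Rightarrow> ex \<Rightarrow> ex" where
  "word_size_ex [] f a = a"
| "word_size_ex (k # ks) f a = Ite (Bin Eq (Opd WordSize) (const_ex k)) (f k) (word_size_ex ks f a)"

lemma eval_word_size_large:
  assumes "\<And>k. k \<in> set ks \<Longrightarrow> k < w"
  shows "eval w \<rho> \<mu> (word_size_ex ks f a) = eval w \<rho> \<mu> a"
  using assms
proof (induction ks)
  case (Cons k ks)
  have "k < w" using Cons.prems by simp
  then have "k mod 2 ^ w = k" by (intro mod_less less_trans[OF _ less_exp])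
  moreover have "w \<noteq> k" using \<open>k < w\<close> by simp
  ultimately show ?case using Cons by simp
qed simp

text \<open>The constant \<open>k\<close> is read as \<open>k mod 2 ^ w\<close>, so the word sizes are tested in increasing order.\<close>

lemma eval_word_size_small:
  assumes "w < w0" "k \<le> w"
  shows "eval w \<rho> \<mu> (word_size_ex [k..<w0] f a) = eval w \<rho> \<mu> (f w)"
  using assms(2,1)
proof (induction k rule: inc_induct)
  case base
  moreover have "w < 2 ^ w" by (rule less_exp)
  ultimately show ?case by (simp add: upt_conv_Cons)
next
  case (step k)
  have "k mod 2 ^ w = k" using step.hyps by (intro mod_less less_trans[OF _ less_exp])
  moreover have "[k..<w0] = k # [Suc k..<w0]" using step by (simp add: upt_conv_Cons)
  ultimately show ?case using step by simp
qed

lemma regs_below_word_size: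
  "(\<And>k. k \<in> set ks \<Longrightarrow> regs_below d (f k)) \<Longrightarrow> regs_below d a \<Longrightarrow> regs_below d (word_size_ex ks f a)"
  by (induction ks) auto

definition by_word_size :: "nat \<Rightarrow> nat \<Rightarrow> (nat \<Rightarrow> ex list) \<Rightarrow> ex list \<Rightarrow> ex list" where
  "by_word_size w0 d f outs = map (\<lambda>j. word_size_ex [1..<w0] (\<lambda>k. f k ! j) (outs ! j)) [0..<2 * d]"

lemma length_by_word_size: "length (by_word_size w0 d f outs) = 2 * d"
  by (simp add: by_word_size_def)

lemma regs_below_by_word_size:
  assumes "\<And>k. list_all (regs_below d) (f k)" "\<And>k. length (f k) = 2 * d"
    and "list_all (regs_below d) outs" "length outs = 2 * d"
  shows "list_all (regs_below d) (by_word_size w0 d f outs)"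
  using assms by (auto simp: by_word_size_def list_all_length intro!: regs_below_word_size)

lemma yields_by_word_size:
  assumes "\<And>k. length (f k) = 2 * d" "length outs = 2 * d" "0 < w"
    and "yields w d (if w < w0 then f w else outs) bits x y z"
  shows "yields w d (by_word_size w0 d f outs) bits x y z"
proof -
  let ?eval = "eval w (input_regs w d x) (packed w bits)"
  let ?outs = "if w < w0 then f w else outs"
  have "?eval (word_size_ex [1..<w0] (\<lambda>k. f k ! j) (outs ! j)) = ?eval (?outs ! j)" for j
    using assms(3) eval_word_size_large[of "[1..<w0]" w] eval_word_size_small[of w w0 1] by auto
  then have "map ?eval (by_word_size w0 d f outs) = map ?eval ?outs"
    using assms(1,2) by (intro nth_equalityI) (auto simp: by_word_size_def)
  then have "map ?eval (take d (by_word_size w0 d f outs)) = map ?eval (take d ?outs)"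
    "map ?eval (drop d (by_word_size w0 d f outs)) = map ?eval (drop d ?outs)"
    by (simp_all only: take_map[symmetric] drop_map[symmetric])
  then show ?thesis using assms(4) by (simp only: yields_def)
qed

lemma answers_mono: "answers w d T bits c x y z \<Longrightarrow> T \<le> T' \<Longrightarrow> answers w d T' bits c x y z"
  unfolding answers_def using le_trans by fast

theorem theorem3:
  fixes c :: real
  assumes "c > 1"
  shows "\<exists>C :: real. \<forall>\<kappa> > 0. \<exists>(enc :: prog) (dec :: prog) (d :: nat) (T :: nat).
    \<forall>(n :: nat) (p :: nat \<Rightarrow> real) (w :: nat).
      n \<ge> 1 \<and> prob_dist n p \<and> w \<ge> 1 \<and> real w \<ge> \<kappa> * log 2 (real n) \<longrightarrow>
      (\<exists>(code :: nat \<Rightarrow> bool list) (bits :: bool list).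
         prefix_code n code \<and>
         avg_len n p code \<le> c * opt_avg_len n p \<and>
         real (length bits) \<le> C * real n powr (1 / c) * log 2 (real n) \<and>
         encodes w d T bits enc n code \<and>
         decodes w d T bits dec n code)"
proof -
  interpret approximation_ratio c by unfold_locales (rule assms)
  show ?thesis
  proof (rule exI[of _ space_const], intro allI impI)
    fix \<kappa> :: real assume \<kappa>: "0 < \<kappa>"
    define w0 where "w0 = min_word_size \<kappa>"
    define d0 where "d0 = max_words \<kappa>"
    \<comment> \<open>For \<open>w < w0\<close>, the assumption on the word size bounds
      \<open>n\<close> by \<open>2 ^ l\<close>.\<close>
    define l where "l = nat \<lceil>w0 / \<kappa>\<rceil>"
    \<comment> \<open>Even one-bit words can then hold a codeword of \<open>d0 * w0\<close> bits or
      a symbol of \<open>l\<close> bits in \<open>d\<close> registers.\<close>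
    define d where "d = d0 * w0 + l"
    \<comment> \<open>An upper bound for the space if \<open>n \<le> 2 ^ l\<close>, because
      \<open>n powr (1 / c) \<le> n\<close>.\<close>
    define N where "N = nat \<lceil>space_const * 2 ^ l * l\<rceil>"
    have w0: "1 \<le> w0" by (simp add: w0_def min_word_size_def)
    then have "d0 * 1 \<le> d0 * w0" by (intro mult_left_mono) auto
    then have d: "max_words \<kappa> \<le> d" unfolding d_def d0_def by linarith
    define outs where "outs \<phi> = by_word_size w0 d (\<lambda>w. simulating w w0 N d (outputs \<kappa> d \<phi>)) (outputs \<kappa> d \<phi>)" for \<phi>
    have outs: "list_all (regs_below d) (outs \<phi>)" "length (outs \<phi>) = 2 * d" for \<phi>
      unfolding outs_def
      by (rule regs_below_by_word_size length_by_word_size regs_below_simulating length_simulating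
          regs_below_outputs length_outputs d)+
    obtain enc T1 where enc: "\<And>w bits x y z. yields w d (outs 0) bits x y z \<Longrightarrow> answers w d T1 bits enc x y z"
      by (rule program_of_expressions[OF outs(1)[of 0] outs(2)[of 0]]) (auto simp: yields_def)
    obtain dec T2 where dec: "\<And>w bits x y z. yields w d (outs 9) bits x y z \<Longrightarrow> answers w d T2 bits dec x y z"
      by (rule program_of_expressions[OF outs(1)[of 9] outs(2)[of 9]]) (auto simp: yields_def)
    have large: "yields w d (outs \<phi>) bits x y z"
      if "w0 \<le> w" "yields w d (outputs \<kappa> d \<phi>) bits x y z" for w \<phi> bits x y z
      unfolding outs_def using that w0
      by (intro yields_by_word_size) (auto simp: length_simulating length_outputs)
    have small: "yields w d (outs \<phi>) bits x y z"
      if "1 \<le> w" "w < w0" "length bits \<le> N" "x < 2 ^ (w * d)" "yields w0 d (outputs \<kappa> d \<phi>) bits x y z"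
        "y < 2 ^ (w * d)" "z < 2 ^ (w * d)" for w \<phi> bits x y z
    proof -
      have "1 * N \<le> w * N" using that(1) by (intro mult_right_mono) auto
      then have "length bits \<le> w * N" using that(3) by linarith
      then have "yields w d (simulating w w0 N d (outputs \<kappa> d \<phi>)) bits x y z"
        using that by (intro yields_simulating) auto
      then show ?thesis
        unfolding outs_def using that(1,2)
        by (intro yields_by_word_size) (auto simp: length_simulating length_outputs)
    qed
    show "\<exists>enc dec d T. \<forall>n p w. n \<ge> 1 \<and> prob_dist n p \<and> w \<ge> 1 \<and> real w \<ge> \<kappa> * log 2 (real n) \<longrightarrow>
      (\<exists>code bits. prefix_code n code \<and> avg_len n p code \<le> c * opt_avg_len n p \<and>
         real (length bits) \<le> space_const * real n powr (1 / c) * log 2 (real n) \<and>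
         encodes w d T bits enc n code \<and> decodes w d T bits dec n code)"
    proof (rule exI[of _ enc], rule exI[of _ dec], rule exI[of _ d], rule exI[of _ "max T1 T2"],
        intro allI impI, elim conjE)
      fix n w :: nat and p :: "nat \<Rightarrow> real"
      assume n: "1 \<le> n" and p: "prob_dist n p" and w: "1 \<le> w" "real w \<ge> \<kappa> * log 2 (real n)"
      \<comment> \<open>The structure is built for word size \<open>w'\<close>; on shorter words the
        programs simulate word size \<open>w0\<close> on the same bits.\<close>
      define w' where "w' = max w w0"
      have w': "real w' \<ge> \<kappa> * log 2 (real n)" "min_word_size \<kappa> \<le> w'"
        using w by (auto simp: w'_def w0_def)
      obtain code bits where code: "prefix_code n code" "avg_len n p code \<le> c * opt_avg_len n p"
        "real (length bits) \<le> space_const * real n powr (1 / c) * log 2 n"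
        "\<And>i. i < n \<Longrightarrow> length (code i) \<le> d0 * w'"
        "\<And>i. i < n \<Longrightarrow> yields w' d (outputs \<kappa> d 0) bits i (bits_val (code i)) (length (code i))"
        "\<And>i x. i < n \<Longrightarrow> matches (code i) x \<Longrightarrow> yields w' d (outputs \<kappa> d 9) bits x i (length (code i))"
        using ex_stored_code[OF \<kappa> n p w' d] unfolding d0_def by blast
      have wd: "d \<le> w * d" using w(1) by simp
      have len: "length (code i) \<le> w * d" if "i < n" for i
      proof (cases "w < w0")
        case True
        then have "length (code i) \<le> d" using code(4)[OF that] by (simp add: w'_def d_def)
        then show ?thesis using wd by linarith
      next
        case False
        then have "length (code i) \<le> d0 * w" using code(4)[OF that] by (simp add: w'_def)
        also have "\<dots> \<le> d * w" using d by (intro mult_right_mono) (auto simp: d0_def)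
        finally show ?thesis by (simp add: mult.commute)
      qed
      have short: "n \<le> 2 ^ l \<and> length bits \<le> N" if "w < w0"
      proof -
        have "\<kappa> * log 2 n \<le> real w0" using w(2) that by linarith
        then have "log 2 n \<le> w0 / \<kappa>" using \<kappa> by (simp add: pos_le_divide_eq mult.commute)
        then have log: "log 2 n \<le> real l" unfolding l_def by linarith
        have "real n = 2 powr (log 2 n)" using n by simp
        also have "\<dots> \<le> 2 powr real l" using log by (intro powr_mono) auto
        also have "\<dots> = real (2 ^ l)" by (simp add: powr_realpow)
        finally have nl: "n \<le> 2 ^ l" by (simp only: of_nat_le_iff)
        have "real n powr (1 / c) \<le> real n powr 1" using n assms by (intro powr_mono) auto
        also have "\<dots> \<le> real (2 ^ l)" using nl by (simp only: powr_one of_nat_0_le_iff of_nat_le_iff)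
        finally have "space_const * real n powr (1 / c) * log 2 n \<le> space_const * 2 ^ l * l"
          using log n space_const_nonneg by (intro mult_mono mult_nonneg_nonneg) auto
        then have "real (length bits) \<le> real N" using code(3) unfolding N_def by linarith
        then show ?thesis using nl by simp
      qed
      have pow: "(2 :: nat) ^ length (code i) \<le> 2 ^ (w * d)" if "i < n" for i
        using len[OF that] by (intro power_increasing) auto
      have sizes: "bits_val (code i) < 2 ^ (w * d)" "length (code i) < 2 ^ (w * d)" if "i < n" for i
        using pow[OF that] bits_val_less[of "code i"] less_exp[of "length (code i)"] by linarith+
      have i_less: "i < 2 ^ (w * d)" if "i < n" "w < w0" for i
      proof -
        have "l \<le> w * d" using wd unfolding d_def by linarith
        then have "(2 :: nat) ^ l \<le> 2 ^ (w * d)" by (intro power_increasing) auto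
        then show ?thesis using short that by linarith
      qed
      have "yields w d (outs 0) bits i (bits_val (code i)) (length (code i))" if i: "i < n" for i
      proof (cases "w < w0")
        case True
        then have "w' = w0" by (simp add: w'_def)
        then show ?thesis
          using small[OF w(1) True _ i_less[OF i True] _ sizes[OF i]] short[OF True] code(5)[OF i] by simp
      next
        case False
        then show ?thesis using large code(5)[OF i] by (simp add: w'_def)
      qed
      then have "encodes w d (max T1 T2) bits enc n code"
        unfolding encodes_def using enc answers_mono by (meson max.cobounded1)
      moreover have "yields w d (outs 9) bits (bits_val (map \<sigma> [0..<d * w])) i (length (code i))"
        if i: "i < n" and \<sigma>: "\<forall>j<length (code i). \<sigma> j = code i ! j" for i \<sigma>
      proof -
        define x where "x = bits_val (map \<sigma> [0..<d * w])"
        have x: "matches (code i) x"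
          using len[OF i] \<sigma> by (auto simp: matches_def x_def bits_val_bit mult.commute)
        have xl: "x < 2 ^ (w * d)" using bits_val_less[of "map \<sigma> [0..<d * w]"] by (simp add: x_def mult.commute)
        have "yields w d (outs 9) bits x i (length (code i))"
        proof (cases "w < w0")
          case True
          then have "w' = w0" by (simp add: w'_def)
          then show ?thesis
            using small[OF w(1) True _ xl _ i_less[OF i True] sizes(2)[OF i]] short[OF True] code(6)[OF i x] by simp
        next
          case False
          then show ?thesis using large code(6)[OF i x] by (simp add: w'_def)
        qed
        then show ?thesis by (simp add: x_def)
      qed
      then have "decodes w d (max T1 T2) bits dec n code"
        unfolding decodes_def using dec answers_mono by (meson max.cobounded2)
      ultimately show "\<exists>code bits. prefix_code n code \<and> avg_len n p code \<le> c * opt_avg_len n p \<and>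
         real (length bits) \<le> space_const * real n powr (1 / c) * log 2 (real n) \<and>
         encodes w d (max T1 T2) bits enc n code \<and> decodes w d (max T1 T2) bits dec n code"
        using code(1-3) by blast
    qed
  qed
qed

end
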